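(* Let $L$ be a real analytic $\mathrm{gl}$-regular Nijenhuis operator on an open domain $U\subset\mathbb R^n$ with coordinates $u=(u^1,\dots,u^n)$, and let $f_1,\dots,f_n$ be the coefficients of its characteristic polynomial $\det(\lambda\,\mathrm{Id}-L)=\lambda^n-f_1\lambda^{n-1}-\dots-f_n$. Consider the following two systems of PDEs for an unknown vector-function $u=u(x^1,\dots,x^n)$: $$\text{(I)}\quad u_{x^{n-k}}=L^k(u)\,u_{x^n},\quad 1\le k\le n-1;\qquad\qquad \text{(II)}\quad u_{x^{n-k}}=M_k(u)\,u_{x^n},\quad 1\le k\le n-1,$$ where $M_k=L^k-f_1L^{k-1}-f_2L^{k-2}-\dots-f_{k-1}L-f_k\,\mathrm{Id}$. Writing either system as $u_{x^{n-k}}=A_k(u)u_{x^n}$ (with $A_k=L^k$, respectively $A_k=M_k$), both systems satisfy the following Property (B), and therefore the following Property (A). (B) The operators $A_k$ pairwise commute ($A_kA_j=A_jA_k$) and $$\langle A_k,A_j\rangle(\xi,\xi):=[A_k\xi,A_j\xi]-A_j[A_k\xi,\xi]-A_k[\xi,A_j\xi]=0$$ for any vector field $\xi$ and all $k,j=1,\dots,n-1$. (A) For any real analytic initial condition $u(0,\dots,0,x^n)=h(x^n)$, where $h=(h^1,\dots,h^n)$ is a real analytic vector-function of one variable with values in $U$, there exists a unique (local) real analytic solution $u=u(x)$ of the system.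
   Context: The Nijenhuis torsion of a $(1,1)$-tensor field $L$ is $\mathcal N_L(\xi,\eta)=L^2[\xi,\eta]-L[L\xi,\eta]-L[\xi,L\eta]+[L\xi,L\eta]$; $L$ is Nijenhuis if $\mathcal N_L\equiv0$. $L$ is $\mathrm{gl}$-regular if $\mathrm{Id},L,\dots,L^{n-1}$ are linearly independent at every point. Subscripts $x^i$ denote partial derivatives, $u$ is treated as a column vector, $[\cdot,\cdot]$ is the Lie bracket of vector fields. *)

theory Defs
  imports "HOL-Analysis.Analysis" "HOL-Computational_Algebra.Polynomial"
begin

section \<open>Real analytic and smooth maps\<close>

text \<open>
  Near every point of \<open>S\<close> the map is the sum of a (multivariate) power series. The multi-indices are
  the maps \<open>Basis \<rightarrow> nat\<close>, extended by \<open>undefined\<close> outside \<open>Basis\<close> so that each of them is counted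
  only once. Summation is unconditional, hence absolute in finite dimension. Only used for open \<open>S\<close>.
\<close>

definition real_analytic_on ::
    "('a::euclidean_space \<Rightarrow> 'b::real_normed_vector) \<Rightarrow> 'a set \<Rightarrow> bool" where
  "real_analytic_on f S \<longleftrightarrow>
     (\<forall>p\<in>S. \<exists>r>0. \<exists>c :: ('a \<Rightarrow> nat) \<Rightarrow> 'b. \<forall>x\<in>ball p r.
        ((\<lambda>\<alpha>. (\<Prod>b\<in>Basis. ((x - p) \<bullet> b) ^ \<alpha> b) *\<^sub>R c \<alpha>) has_sum f x)
          (Basis \<rightarrow>\<^sub>E (UNIV :: nat set)))"

primrec C_diff_on ::
    "nat \<Rightarrow> ('a::real_normed_vector \<Rightarrow> 'b::real_normed_vector) \<Rightarrow> 'a set \<Rightarrow> bool" where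
  "C_diff_on 0 f U \<longleftrightarrow> continuous_on U f"
| "C_diff_on (Suc k) f U \<longleftrightarrow>
     f differentiable_on U \<and> (\<forall>v. C_diff_on k (\<lambda>x. frechet_derivative f (at x) v) U)"

definition smooth_on ::
    "('a::real_normed_vector \<Rightarrow> 'b::real_normed_vector) \<Rightarrow> 'a set \<Rightarrow> bool" where
  "smooth_on f U \<longleftrightarrow> (\<forall>k. C_diff_on k f U)"

section \<open>Operators on an open subset of \<open>\<real>\<^sup>n\<close>\<close>

text \<open>
  In the coordinates \<open>u\<close>, vector fields are maps \<open>real ^ 'n \<Rightarrow> real ^ 'n\<close> and \<open>(1,1)\<close>-tensor fields
  are matrix-valued maps \<open>real ^ 'n \<Rightarrow> real ^ 'n ^ 'n\<close>.
\<close>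

definition lie_bracket ::
    "(real ^ 'n \<Rightarrow> real ^ 'n) \<Rightarrow> (real ^ 'n \<Rightarrow> real ^ 'n) \<Rightarrow> real ^ 'n \<Rightarrow> real ^ 'n" where
  "lie_bracket \<xi> \<eta> u =
     frechet_derivative \<eta> (at u) (\<xi> u) - frechet_derivative \<xi> (at u) (\<eta> u)"

definition apply_op ::
    "(real ^ 'n \<Rightarrow> real ^ 'n ^ 'n) \<Rightarrow> (real ^ 'n \<Rightarrow> real ^ 'n) \<Rightarrow> real ^ 'n \<Rightarrow> real ^ 'n" where
  "apply_op A \<xi> u = A u *v \<xi> u"

text \<open>The operation \<open>^\<close> on \<open>real ^ 'n ^ 'n\<close> is the entrywise power, not the matrix power.\<close>

definition mat_power :: "'a::semiring_1 ^ 'n ^ 'n \<Rightarrow> nat \<Rightarrow> 'a ^ 'n ^ 'n" where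
  "mat_power A k = (((**) A) ^^ k) (mat 1)"

definition nijenhuis_torsion ::
    "(real ^ 'n \<Rightarrow> real ^ 'n ^ 'n) \<Rightarrow> (real ^ 'n \<Rightarrow> real ^ 'n) \<Rightarrow> (real ^ 'n \<Rightarrow> real ^ 'n)
      \<Rightarrow> real ^ 'n \<Rightarrow> real ^ 'n" where
  "nijenhuis_torsion L \<xi> \<eta> u =
     mat_power (L u) 2 *v lie_bracket \<xi> \<eta> u
     - L u *v lie_bracket (apply_op L \<xi>) \<eta> u
     - L u *v lie_bracket \<xi> (apply_op L \<eta>) u
     + lie_bracket (apply_op L \<xi>) (apply_op L \<eta>) u"

definition nijenhuis_on :: "(real ^ 'n) set \<Rightarrow> (real ^ 'n \<Rightarrow> real ^ 'n ^ 'n) \<Rightarrow> bool" where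
  "nijenhuis_on U L \<longleftrightarrow>
     (\<forall>\<xi> \<eta>. smooth_on \<xi> U \<and> smooth_on \<eta> U \<longrightarrow> (\<forall>u\<in>U. nijenhuis_torsion L \<xi> \<eta> u = 0))"

text \<open>Injectivity is needed since linear independence is that of a family, not of a set.\<close>

definition gl_regular_on :: "(real ^ 'n) set \<Rightarrow> (real ^ 'n \<Rightarrow> real ^ 'n ^ 'n) \<Rightarrow> bool" where
  "gl_regular_on U L \<longleftrightarrow>
     (\<forall>u\<in>U. inj_on (mat_power (L u)) {..<CARD('n)} \<and>
             independent (mat_power (L u) ` {..<CARD('n)}))"

definition matrix_char_poly :: "'a::comm_ring_1 ^ 'n ^ 'n \<Rightarrow> 'a poly" where
  "matrix_char_poly A = det (mat [:0, 1:] - (\<chi> i j. [:A $ i $ j:]))"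

text \<open>
  The sign convention is \<open>det (\<lambda> Id - A) = \<lambda>\<^sup>n - f\<^sub>1 \<lambda>\<^bsup>n-1\<^esup> - \<dots> - f\<^sub>n\<close>; meaningful for \<open>1 \<le> i \<le> n\<close>.
\<close>

definition char_coeff :: "'a::comm_ring_1 ^ 'n ^ 'n \<Rightarrow> nat \<Rightarrow> 'a" where
  "char_coeff A i = - coeff (matrix_char_poly A) (CARD('n) - i)"

definition op_I :: "(real ^ 'n \<Rightarrow> real ^ 'n ^ 'n) \<Rightarrow> nat \<Rightarrow> real ^ 'n \<Rightarrow> real ^ 'n ^ 'n" where
  "op_I L k u = mat_power (L u) k"

definition op_II :: "(real ^ 'n \<Rightarrow> real ^ 'n ^ 'n) \<Rightarrow> nat \<Rightarrow> real ^ 'n \<Rightarrow> real ^ 'n ^ 'n" where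
  "op_II L k u =
     mat_power (L u) k - (\<Sum>i = 1..k. char_coeff (L u) i *\<^sub>R mat_power (L u) (k - i))"

section \<open>The systems \<open>u\<^bsub>x\<^bsup>n-k\<^esup>\<^esub> = A\<^sub>k(u) u\<^bsub>x\<^bsup>n\<^esup>\<^esub>\<close> and the two properties\<close>

definition partial_derivative ::
    "'m \<Rightarrow> (real ^ 'm \<Rightarrow> real ^ 'n) \<Rightarrow> real ^ 'm \<Rightarrow> real ^ 'n" where
  "partial_derivative i u x = vector_derivative (\<lambda>t. u (x + t *\<^sub>R axis i 1)) (at 0)"

text \<open>
  The bijection \<open>e\<close> from \<open>{1..n}\<close> to the index type numbers the independent variables: \<open>x\<^sup>i\<close> is
  \<open>x $ e i\<close>. The family \<open>A\<close> is given on \<open>U\<close>, so a solution takes values in \<open>U\<close>.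
\<close>

definition solves_on ::
    "(nat \<Rightarrow> 'n) \<Rightarrow> (real ^ 'n) set \<Rightarrow> (nat \<Rightarrow> real ^ 'n \<Rightarrow> real ^ 'n ^ 'n)
      \<Rightarrow> (real ^ 'n) set \<Rightarrow> (real ^ 'n \<Rightarrow> real ^ 'n) \<Rightarrow> bool" where
  "solves_on e U A W u \<longleftrightarrow>
     u ` W \<subseteq> U \<and>
     (\<forall>x\<in>W. \<forall>k\<in>{1..CARD('n) - 1}.
        partial_derivative (e (CARD('n) - k)) u x
          = A k (u x) *v partial_derivative (e CARD('n)) u x)"

definition cauchy_solution ::
    "(nat \<Rightarrow> 'n) \<Rightarrow> (real ^ 'n) set \<Rightarrow> (nat \<Rightarrow> real ^ 'n \<Rightarrow> real ^ 'n ^ 'n)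
      \<Rightarrow> real set \<Rightarrow> (real \<Rightarrow> real ^ 'n) \<Rightarrow> (real ^ 'n) set \<Rightarrow> (real ^ 'n \<Rightarrow> real ^ 'n) \<Rightarrow> bool" where
  "cauchy_solution e U A I h W u \<longleftrightarrow>
     open W \<and> axis (e CARD('n)) ` I \<subseteq> W \<and>
     real_analytic_on u W \<and> solves_on e U A W u \<and>
     (\<forall>t\<in>I. u (axis (e CARD('n)) t) = h t)"

text \<open>
  Existence and uniqueness are local around the initial curve. As \<open>I\<close> is an arbitrary open interval
  (possibly small), this contains existence and uniqueness of germs at each point of the curve.
\<close>

definition property_A ::
    "(nat \<Rightarrow> 'n) \<Rightarrow> (real ^ 'n) set \<Rightarrow> (nat \<Rightarrow> real ^ 'n \<Rightarrow> real ^ 'n ^ 'n) \<Rightarrow> bool" where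
  "property_A e U A \<longleftrightarrow>
     (\<forall>I h. open I \<and> is_interval I \<and> real_analytic_on h I \<and> h ` I \<subseteq> U \<longrightarrow>
        (\<exists>W u. cauchy_solution e U A I h W u) \<and>
        (\<forall>W u W' u'. cauchy_solution e U A I h W u \<and> cauchy_solution e U A I h W' u' \<longrightarrow>
           (\<exists>V. open V \<and> axis (e CARD('n)) ` I \<subseteq> V \<and> V \<subseteq> W \<inter> W' \<and> (\<forall>x\<in>V. u x = u' x))))"

definition op_bracket ::
    "(real ^ 'n \<Rightarrow> real ^ 'n ^ 'n) \<Rightarrow> (real ^ 'n \<Rightarrow> real ^ 'n ^ 'n) \<Rightarrow> (real ^ 'n \<Rightarrow> real ^ 'n)
      \<Rightarrow> real ^ 'n \<Rightarrow> real ^ 'n" where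
  "op_bracket A B \<xi> u =
     lie_bracket (apply_op A \<xi>) (apply_op B \<xi>) u
     - B u *v lie_bracket (apply_op A \<xi>) \<xi> u
     - A u *v lie_bracket \<xi> (apply_op B \<xi>) u"

definition property_B ::
    "(real ^ 'n) set \<Rightarrow> (nat \<Rightarrow> real ^ 'n \<Rightarrow> real ^ 'n ^ 'n) \<Rightarrow> bool" where
  "property_B U A \<longleftrightarrow>
     (\<forall>k\<in>{1..CARD('n) - 1}. \<forall>j\<in>{1..CARD('n) - 1}.
        (\<forall>u\<in>U. A k u ** A j u = A j u ** A k u) \<and>
        (\<forall>\<xi>. smooth_on \<xi> U \<longrightarrow> (\<forall>u\<in>U. op_bracket (A k) (A j) \<xi> u = 0)))"

end

theory Submission
  imports Defs "HOL-Library.Function_Algebras"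
begin

text \<open>
  Property (B) is a pointwise identity in \<open>L\<close> and its first derivative. For \<open>M\<^bsub>k+1\<^esub> = L M\<^sub>k - f\<^bsub>k+1\<^esub> Id\<close> it
  follows by induction from the Nijenhuis identity and from \<open>df\<^bsub>k+1\<^esub> = L\<^sup>* df\<^sub>k - f\<^sub>k df\<^sub>1\<close>, which is the
  coefficientwise form of \<open>L\<^sup>* d\<chi> = \<lambda> d\<chi> + \<chi> d(tr L)\<close> for the characteristic polynomial \<open>\<chi>\<close>, itself a
  consequence of Jacobi's formula for the derivative of a determinant.

  Property (A) follows from (B) by a Cauchy--Kovalevskaya argument. All equations
  \<open>v\<^bsub>y\<^sub>i\<^esub> = A\<^sub>i(v) v\<^sub>x\<close> are combined into the Euler equation \<open>\<Sum>\<^sub>i y\<^sub>i v\<^bsub>y\<^sub>i\<^esub> = \<Sum>\<^sub>i y\<^sub>i A\<^sub>i(v) v\<^sub>x\<close>, which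
  is solved by a contraction in a Banach algebra of power series in \<open>(y, x)\<close>. Compatibility of the
  \<open>A\<^sub>i\<close> then shows that the solution satisfies each equation separately. Conversely every analytic
  solution is a fixed point of the contraction, so that local solutions are unique; they are glued
  along the initial curve by the identity theorem. The equation for \<open>y\<^sub>n\<close> has the matrix \<open>A = Id\<close>, so
  that \<open>v\<close> depends on \<open>x + y\<^sub>n\<close> only, and \<open>u(y) = v(y, 0)\<close>.
\<close>

section \<open>Absolutely summable families\<close>

text \<open>The obstacle is the loss of regularity in x: \<open>pd None\<close> is unbounded on
  \<open>wps\<close>, whereas the matrices along v arise by substituting v into their Taylor series,
  which needs a complete norm. Therefore two types coexist: \<open>mps\<close> for formal identities
  that contain derivatives, and the Banach algebra \<open>wps\<close> for substitution and
  contraction. Only the composite of x-derivative, multiplication by a time variable and time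
  integration acts on the latter. Evaluation at small real points separates the elements of
  \<open>wps\<close>. Pointwise information, such as Property (B) or the equations of a given
  solution, is therefore transferred to the algebra without any manipulation of coefficients. In the
  Euler equation all times enter symmetrically, so that existence requires no order of integration
  and uniqueness no successive restriction to coordinate planes. Three scales make everything small:
  \<rho> for the values of the unknown, s for the space variable, \<epsilon> s for the
  times.\<close>

lemma abs_summable_product_Times:
  fixes f :: "'b \<Rightarrow> 'a::{real_normed_algebra, banach}" and g :: "'c \<Rightarrow> 'a"
  assumes f: "(\<lambda>x. norm (f x)) summable_on A" and g: "(\<lambda>x. norm (g x)) summable_on B"
  shows "(\<lambda>(x, y). norm (f x * g y)) summable_on A \<times> B"
    and "((\<lambda>(x, y). f x * g y) has_sum (infsum f A * infsum g B)) (A \<times> B)"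
proof -
  have "(\<lambda>(x, y). norm (f x) * norm (g y)) summable_on A \<times> B"
  proof (rule summable_on_SigmaI)
    fix x assume "x \<in> A"
    show "((\<lambda>y. case (x, y) of (x, y) \<Rightarrow> norm (f x) * norm (g y)) has_sum
        norm (f x) * (\<Sum>\<^sub>\<infinity>y\<in>B. norm (g y))) B"
      using has_sum_cmult_right[OF has_sum_infsum[OF g]] by simp
  qed (auto intro: summable_on_cmult_left f)
  then show nsum: "(\<lambda>(x, y). norm (f x * g y)) summable_on A \<times> B"
    by (rule Infinite_Sum.summable_on_comparison_test) (auto simp: norm_mult_ineq)
  have s: "(\<lambda>(x, y). f x * g y) summable_on A \<times> B"
    by (rule Infinite_Sum.abs_summable_summable) (use nsum in \<open>simp add: case_prod_unfold\<close>)
  have fs: "f summable_on A" and gs: "g summable_on B"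
    using f g by (auto intro: Infinite_Sum.abs_summable_summable)
  from s obtain S where S: "((\<lambda>(x, y). f x * g y) has_sum S) (A \<times> B)"
    by (auto simp: summable_on_def)
  have "((\<lambda>x. f x * infsum g B) has_sum S) A"
    by (rule has_sum_SigmaD[OF S])
       (use has_sum_cmult_right[OF has_sum_infsum[OF gs]] in auto)
  moreover have "((\<lambda>x. f x * infsum g B) has_sum (infsum f A * infsum g B)) A"
    by (intro has_sum_cmult_left has_sum_infsum fs)
  ultimately have "S = infsum f A * infsum g B"
    by (rule has_sum_unique)
  with S show "((\<lambda>(x, y). f x * g y) has_sum (infsum f A * infsum g B)) (A \<times> B)"
    by simp
qed

section \<open>Formal power series in several variables\<close>

text \<open>The antidiagonal over \<gamma>, the index set of the Cauchy product.\<close>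

definition adiag :: "('j \<Rightarrow> nat) \<Rightarrow> (('j \<Rightarrow> nat) \<times> ('j \<Rightarrow> nat)) set" where
  "adiag \<gamma> = {(\<alpha>, \<beta>). \<alpha> + \<beta> = \<gamma>}"

definition unit_index :: "'j \<Rightarrow> 'j \<Rightarrow> nat" where
  "unit_index j = (\<lambda>i. if i = j then 1 else 0)"

definition index_degree :: "('j::finite \<Rightarrow> nat) \<Rightarrow> nat" where
  "index_degree \<alpha> = (\<Sum>j\<in>UNIV. \<alpha> j)"

lemma in_adiag [simp]: "(\<alpha>, \<beta>) \<in> adiag \<gamma> \<longleftrightarrow> \<alpha> + \<beta> = \<gamma>"
  by (simp add: adiag_def)

lemma finite_indices_le: "finite {\<alpha>::'j::finite \<Rightarrow> nat. \<alpha> \<le> \<gamma>}"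
proof -
  have "finite (PiE UNIV (\<lambda>j. {..\<gamma> j}))"
    by (intro finite_PiE) auto
  then show ?thesis
    by (rule rev_finite_subset) (auto simp: le_fun_def)
qed

lemma finite_adiag [simp]: "finite (adiag (\<gamma>::'j::finite \<Rightarrow> nat))"
proof (rule finite_subset)
  show "adiag \<gamma> \<subseteq> {\<alpha>. \<alpha> \<le> \<gamma>} \<times> {\<alpha>. \<alpha> \<le> \<gamma>}"
    by (auto simp: le_fun_def)
qed (auto intro: finite_indices_le)

lemma unit_index_same [simp]: "unit_index j j = 1"
  and unit_index_other: "i \<noteq> j \<Longrightarrow> unit_index j i = 0"
  by (auto simp: unit_index_def)

lemma index_degree_0 [simp]: "index_degree 0 = 0"
  and index_degree_add [simp]: "index_degree (\<alpha> + \<beta>) = index_degree \<alpha> + index_degree \<beta>"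
  and index_degree_unit [simp]: "index_degree (unit_index j) = 1"
  by (auto simp: index_degree_def sum.distrib unit_index_def)

lemma index_degree_eq_0 [simp]: "index_degree \<alpha> = 0 \<longleftrightarrow> \<alpha> = 0"
  by (auto simp: index_degree_def fun_eq_iff)

lemma index_le_degree: "\<alpha> j \<le> index_degree \<alpha>"
  unfolding index_degree_def by (rule member_le_sum) auto

lemma index_plus_unit_neq_0 [simp]: "\<alpha> + unit_index j \<noteq> 0"
proof
  assume "\<alpha> + unit_index j = 0"
  then have "(\<alpha> + unit_index j) j = 0" by simp
  then show False by simp
qed

lemma unit_index_neq_0 [simp]: "unit_index j \<noteq> 0"
  using index_plus_unit_neq_0[of 0 j] by simp

lemma index_split:
  assumes "\<alpha> j \<noteq> 0"
  obtains \<beta> where "\<alpha> = \<beta> + unit_index j"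
proof
  show "\<alpha> = (\<lambda>i. \<alpha> i - unit_index j i) + unit_index j"
    using assms by (auto simp: fun_eq_iff unit_index_def)
qed

text \<open>The product family on pairs is regrouped by the value of \<alpha> + \<beta>; absolute
  summability permits this, and each group \<open>adiag \<gamma>\<close> is finite.\<close>

lemma has_sum_cauchy_product:
  fixes f g :: "('j::finite \<Rightarrow> nat) \<Rightarrow> 'a::{real_normed_algebra, banach}"
  assumes f: "(\<lambda>x. norm (f x)) summable_on UNIV" and g: "(\<lambda>x. norm (g x)) summable_on UNIV"
  shows "((\<lambda>\<gamma>. \<Sum>(\<alpha>, \<beta>)\<in>adiag \<gamma>. f \<alpha> * g \<beta>) has_sum (infsum f UNIV * infsum g UNIV)) UNIV"
proof -
  note P = abs_summable_product_Times[OF f g]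
  have "((\<lambda>(\<gamma>, \<alpha>, \<beta>). f \<alpha> * g \<beta>) has_sum (infsum f UNIV * infsum g UNIV)) (SIGMA \<gamma>:UNIV. adiag \<gamma>)"
    using P(2)
    by (subst has_sum_reindex_bij_witness[of _ "\<lambda>(\<alpha>, \<beta>). (\<alpha> + \<beta>, \<alpha>, \<beta>)" "\<lambda>(\<gamma>, \<alpha>, \<beta>). (\<alpha>, \<beta>)"
          "UNIV \<times> UNIV" "\<lambda>(x, y). f x * g y" _ _ "infsum f UNIV * infsum g UNIV"]) auto
  then show ?thesis
    by (rule has_sum_SigmaD) (auto intro!: has_sum_finiteI simp: case_prod_unfold)
qed

typedef 'j mps = "UNIV :: (('j \<Rightarrow> nat) \<Rightarrow> real) set"
  morphisms mcoeff Abs_mps ..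

lemma mcoeff_Abs_mps [simp]: "mcoeff (Abs_mps f) = f"
  by (simp add: Abs_mps_inverse)

lemma mps_eqI: "(\<And>\<gamma>. mcoeff F \<gamma> = mcoeff G \<gamma>) \<Longrightarrow> F = G"
  by (simp add: mcoeff_inject[symmetric] fun_eq_iff)

text \<open>The splittings of \<gamma> + \<open>unit_index j\<close> whose first part contains the
  unit correspond to the splittings of \<gamma>; the others contribute 0 by assumption.
  Multiplication by a variable and the Leibniz rule both reduce to this.\<close>

lemma sum_adiag_shift:
  fixes f :: "('j::finite \<Rightarrow> nat) \<Rightarrow> ('j \<Rightarrow> nat) \<Rightarrow> 'a::comm_monoid_add"
  assumes "\<And>\<alpha> \<beta>. \<alpha> j = 0 \<Longrightarrow> f \<alpha> \<beta> = 0"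
  shows "(\<Sum>(\<alpha>, \<beta>)\<in>adiag (\<gamma> + unit_index j). f \<alpha> \<beta>) = (\<Sum>(\<alpha>, \<beta>)\<in>adiag \<gamma>. f (\<alpha> + unit_index j) \<beta>)"
proof -
  have "(\<Sum>(\<alpha>, \<beta>)\<in>adiag (\<gamma> + unit_index j). f \<alpha> \<beta>)
      = (\<Sum>(\<alpha>, \<beta>)\<in>(\<lambda>(\<alpha>, \<beta>). (\<alpha> + unit_index j, \<beta>)) ` adiag \<gamma>. f \<alpha> \<beta>)"
  proof (rule sum.mono_neutral_right)
    show "\<forall>p\<in>adiag (\<gamma> + unit_index j) - (\<lambda>(\<alpha>, \<beta>). (\<alpha> + unit_index j, \<beta>)) ` adiag \<gamma>.
        (case p of (\<alpha>, \<beta>) \<Rightarrow> f \<alpha> \<beta>) = 0"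
    proof (clarify)
      fix \<alpha> \<beta>
      assume *: "(\<alpha>, \<beta>) \<in> adiag (\<gamma> + unit_index j)"
        and **: "(\<alpha>, \<beta>) \<notin> (\<lambda>(\<alpha>, \<beta>). (\<alpha> + unit_index j, \<beta>)) ` adiag \<gamma>"
      have "\<alpha> j = 0"
      proof (rule ccontr)
        assume "\<alpha> j \<noteq> 0"
        then obtain \<delta> where \<delta>: "\<alpha> = \<delta> + unit_index j" by (rule index_split)
        with * have "\<delta> + \<beta> + unit_index j = \<gamma> + unit_index j"
          by (simp add: ac_simps)
        then have "(\<delta>, \<beta>) \<in> adiag \<gamma>" by simp
        then have "(\<lambda>(\<alpha>, \<beta>). (\<alpha> + unit_index j, \<beta>)) (\<delta>, \<beta>) \<in> (\<lambda>(\<alpha>, \<beta>). (\<alpha> + unit_index j, \<beta>)) ` adiag \<gamma>"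
          by (rule imageI)
        with ** \<delta> show False by simp
      qed
      then show "f \<alpha> \<beta> = 0" by (rule assms)
    qed
  qed (auto simp: ac_simps)
  also have "\<dots> = (\<Sum>(\<alpha>, \<beta>)\<in>adiag \<gamma>. f (\<alpha> + unit_index j) \<beta>)"
    by (subst sum.reindex) (auto simp: inj_on_def case_prod_unfold)
  finally show ?thesis .
qed

lemma sum_adiag_swap:
  "(\<Sum>(\<alpha>, \<beta>)\<in>adiag (\<gamma>::'j::finite \<Rightarrow> nat). f \<alpha> \<beta>) = (\<Sum>(\<alpha>, \<beta>)\<in>adiag \<gamma>. f \<beta> \<alpha>)"
  by (rule sum.reindex_bij_witness[of _ "\<lambda>(\<alpha>, \<beta>). (\<beta>, \<alpha>)" "\<lambda>(\<alpha>, \<beta>). (\<beta>, \<alpha>)"])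
     (auto simp: ac_simps)

lemma sum_adiag_delta:
  fixes f :: "('j::finite \<Rightarrow> nat) \<Rightarrow> 'a::semiring_1"
  shows "(\<Sum>(\<alpha>, \<beta>)\<in>adiag \<gamma>. (if \<alpha> = 0 then 1 else 0) * f \<beta>) = f \<gamma>"
proof -
  have "(\<Sum>(\<alpha>, \<beta>)\<in>adiag \<gamma>. (if \<alpha> = 0 then 1 else 0) * f \<beta>)
      = (\<Sum>(\<alpha>, \<beta>)\<in>{(0::'j \<Rightarrow> nat, \<gamma>)}. (if \<alpha> = 0 then 1 else 0) * f \<beta>)"
    by (rule sum.mono_neutral_right) (auto split: if_splits)
  then show ?thesis by simp
qed

instantiation mps :: (finite) "{comm_ring_1, real_algebra_1}"
begin

definition "0 = Abs_mps (\<lambda>_. 0)"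
definition "1 = Abs_mps (\<lambda>\<gamma>. if \<gamma> = 0 then 1 else 0)"
definition "F + G = Abs_mps (\<lambda>\<gamma>. mcoeff F \<gamma> + mcoeff G \<gamma>)"
definition "F - G = Abs_mps (\<lambda>\<gamma>. mcoeff F \<gamma> - mcoeff G \<gamma>)"
definition "- F = Abs_mps (\<lambda>\<gamma>. - mcoeff F \<gamma>)"
definition "F * G = Abs_mps (\<lambda>\<gamma>. \<Sum>(\<alpha>, \<beta>)\<in>adiag \<gamma>. mcoeff F \<alpha> * mcoeff G \<beta>)"
definition "r *\<^sub>R F = Abs_mps (\<lambda>\<gamma>. r * mcoeff F \<gamma>)"

instance
proof
  fix a b c :: "'a mps" and r s :: real
  have comm: "a * b = b * a" for a b :: "'a mps"
    unfolding times_mps_def by (subst sum_adiag_swap) (simp add: mult.commute)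
  have distr: "(a + b) * c = a * c + b * c"
    by (rule mps_eqI) (simp add: times_mps_def plus_mps_def case_prod_unfold sum.distrib distrib_right)
  have one: "1 * a = a" for a :: "'a mps"
    by (rule mps_eqI) (simp add: times_mps_def one_mps_def sum_adiag_delta)
  show "a * b * c = a * (b * c)"
  proof (rule mps_eqI)
    fix \<gamma>
    have "mcoeff (a * b * c) \<gamma>
        = (\<Sum>(\<alpha>, \<beta>)\<in>adiag \<gamma>. \<Sum>(\<delta>, \<epsilon>)\<in>adiag \<alpha>. mcoeff a \<delta> * mcoeff b \<epsilon> * mcoeff c \<beta>)"
      by (simp add: times_mps_def sum_distrib_right case_prod_unfold)
    also have "\<dots> = (\<Sum>((\<alpha>, \<beta>), (\<delta>, \<epsilon>))\<in>(SIGMA p:adiag \<gamma>. adiag (fst p)). mcoeff a \<delta> * mcoeff b \<epsilon> * mcoeff c \<beta>)"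
      by (subst sum.Sigma[symmetric]) (auto simp: case_prod_unfold)
    \<comment> \<open>Both double sums run over the triples of indices with sum \<gamma>; only the
      bracketing differs.\<close>
    also have "\<dots> = (\<Sum>((\<alpha>, \<beta>), (\<delta>, \<epsilon>))\<in>(SIGMA p:adiag \<gamma>. adiag (snd p)). mcoeff a \<alpha> * (mcoeff b \<delta> * mcoeff c \<epsilon>))"
      by (rule sum.reindex_bij_witness[of _ "\<lambda>((\<alpha>, \<beta>), (\<delta>, \<epsilon>)). ((\<alpha> + \<delta>, \<epsilon>), (\<alpha>, \<delta>))"
             "\<lambda>((\<alpha>, \<beta>), (\<delta>, \<epsilon>)). ((\<delta>, \<epsilon> + \<beta>), (\<epsilon>, \<beta>))"]) (auto simp: ac_simps)
    also have "\<dots> = (\<Sum>(\<alpha>, \<beta>)\<in>adiag \<gamma>. \<Sum>(\<delta>, \<epsilon>)\<in>adiag \<beta>. mcoeff a \<alpha> * (mcoeff b \<delta> * mcoeff c \<epsilon>))"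
      by (subst sum.Sigma[symmetric]) (auto simp: case_prod_unfold)
    also have "\<dots> = mcoeff (a * (b * c)) \<gamma>"
      by (simp add: times_mps_def sum_distrib_left case_prod_unfold)
    finally show "mcoeff (a * b * c) \<gamma> = mcoeff (a * (b * c)) \<gamma>" .
  qed
  show "a * b = b * a" by (rule comm)
  show "(a + b) * c = a * c + b * c" by (rule distr)
  show "1 * a = a" by (rule one)
  show "a * 1 = a" by (simp add: comm[of a 1] one)
  show scl: "r *\<^sub>R a * b = r *\<^sub>R (a * b)" for a b :: "'a mps"
    by (rule mps_eqI) (simp add: times_mps_def scaleR_mps_def sum_distrib_left case_prod_unfold ac_simps)
  show "a * r *\<^sub>R b = r *\<^sub>R (a * b)"
    by (simp only: comm[of a] scl)
  show "a * (b + c) = a * b + a * c"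
    by (rule mps_eqI) (simp add: times_mps_def plus_mps_def case_prod_unfold sum.distrib distrib_left)
  show "(0::'a mps) \<noteq> 1"
  proof
    assume "(0::'a mps) = 1"
    then have "mcoeff (0::'a mps) 0 = mcoeff (1::'a mps) 0" by simp
    then show False by (simp add: zero_mps_def one_mps_def)
  qed
qed (simp_all add: zero_mps_def plus_mps_def minus_mps_def uminus_mps_def scaleR_mps_def
       algebra_simps mcoeff_inverse)

end

lemma mcoeff_simps [simp]:
  "mcoeff 0 \<gamma> = 0"
  "mcoeff 1 \<gamma> = (if \<gamma> = 0 then 1 else 0)"
  "mcoeff (F + G) \<gamma> = mcoeff F \<gamma> + mcoeff G \<gamma>"
  "mcoeff (F - G) \<gamma> = mcoeff F \<gamma> - mcoeff G \<gamma>"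
  "mcoeff (- F) \<gamma> = - mcoeff F \<gamma>"
  "mcoeff (r *\<^sub>R F) \<gamma> = r * mcoeff F \<gamma>"
  by (simp_all add: zero_mps_def one_mps_def plus_mps_def minus_mps_def uminus_mps_def scaleR_mps_def)

lemma mcoeff_sum [simp]: "mcoeff (sum F A) \<gamma> = (\<Sum>x\<in>A. mcoeff (F x) \<gamma>)"
  by (induction A rule: infinite_finite_induct) auto

lemma mcoeff_times: "mcoeff (F * G) \<gamma> = (\<Sum>(\<alpha>, \<beta>)\<in>adiag \<gamma>. mcoeff F \<alpha> * mcoeff G \<beta>)"
  by (simp add: times_mps_def)

lemma mcoeff_times_0: "mcoeff (F * G) 0 = mcoeff F 0 * mcoeff G 0"
proof -
  have "adiag (0 :: 'a \<Rightarrow> nat) = {(0, 0)}"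
    by (auto simp: adiag_def fun_eq_iff)
  then show ?thesis by (simp add: mcoeff_times)
qed

definition mvar :: "'j \<Rightarrow> 'j mps" where
  "mvar j = Abs_mps (\<lambda>\<gamma>. if \<gamma> = unit_index j then 1 else 0)"

definition pd :: "'j \<Rightarrow> 'j mps \<Rightarrow> 'j mps" where
  "pd j F = Abs_mps (\<lambda>\<gamma>. of_nat (\<gamma> j + 1) * mcoeff F (\<gamma> + unit_index j))"

lemma mcoeff_mvar: "mcoeff (mvar j) \<gamma> = (if \<gamma> = unit_index j then 1 else 0)"
  by (simp add: mvar_def)

lemma mcoeff_pd: "mcoeff (pd j F) \<gamma> = of_nat (\<gamma> j + 1) * mcoeff F (\<gamma> + unit_index j)"
  by (simp add: pd_def)

lemma mcoeff_mvar_times_shift: "mcoeff (mvar j * F) (\<gamma> + unit_index j) = mcoeff F \<gamma>"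
proof -
  have "mcoeff (mvar j * F) (\<gamma> + unit_index j)
      = (\<Sum>(\<alpha>, \<beta>)\<in>adiag \<gamma>. mcoeff (mvar j) (\<alpha> + unit_index j) * mcoeff F \<beta>)"
    unfolding mcoeff_times by (rule sum_adiag_shift) (auto simp: mcoeff_mvar)
  also have "\<dots> = (\<Sum>(\<alpha>, \<beta>)\<in>adiag \<gamma>. (if \<alpha> = 0 then 1 else 0) * mcoeff F \<beta>)"
    by (intro sum.cong refl) (auto simp: mcoeff_mvar fun_eq_iff)
  finally show ?thesis by (simp only: sum_adiag_delta)
qed

lemma mcoeff_mvar_times_0:
  assumes "\<gamma> j = 0" shows "mcoeff (mvar j * F) \<gamma> = 0"
  unfolding mcoeff_times
proof (intro sum.neutral ballI, clarify)
  fix \<alpha> \<beta> assume "(\<alpha>, \<beta>) \<in> adiag \<gamma>"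
  with assms have "\<alpha> j = 0" by auto
  then have "\<alpha> \<noteq> unit_index j" by (metis unit_index_same zero_neq_one)
  then show "mcoeff (mvar j) \<alpha> * mcoeff F \<beta> = 0" by (simp add: mcoeff_mvar)
qed

lemma mcoeff_mvar_times_pd: "mcoeff (mvar j * pd j F) \<gamma> = of_nat (\<gamma> j) * mcoeff F \<gamma>"
proof (cases "\<gamma> j = 0")
  case True then show ?thesis by (simp add: mcoeff_mvar_times_0)
next
  case False
  then obtain \<beta> where \<beta>: "\<gamma> = \<beta> + unit_index j" by (rule index_split)
  show ?thesis unfolding \<beta> by (simp add: mcoeff_mvar_times_shift mcoeff_pd)
qed

lemma pd_add [simp]: "pd j (F + G) = pd j F + pd j G"
  and pd_diff [simp]: "pd j (F - G) = pd j F - pd j G"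
  and pd_scaleR [simp]: "pd j (r *\<^sub>R F) = r *\<^sub>R pd j F"
  and pd_0 [simp]: "pd j 0 = 0"
  and pd_1 [simp]: "pd j 1 = 0"
  by (auto intro!: mps_eqI simp: mcoeff_pd algebra_simps)

lemma pd_sum [simp]: "pd j (sum F A) = (\<Sum>x\<in>A. pd j (F x))"
  by (induction A rule: infinite_finite_induct) auto

lemma pd_commute: "pd i (pd j F) = pd j (pd i F)"
  by (cases "i = j") (auto intro!: mps_eqI simp: mcoeff_pd unit_index_def ac_simps)

lemma pd_mvar: "pd i (mvar j) = (if i = j then 1 else 0)"
proof (rule mps_eqI)
  fix \<gamma>
  have "\<gamma> + unit_index i = unit_index j \<longleftrightarrow> i = j \<and> \<gamma> = 0"
    by (auto simp: fun_eq_iff unit_index_def split: if_splits)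
  then show "mcoeff (pd i (mvar j)) \<gamma> = mcoeff (if i = j then 1 else 0) \<gamma>"
    by (auto simp: mcoeff_pd mcoeff_mvar)
qed

text \<open>On the antidiagonal of \<gamma> + \<open>unit_index j\<close> the factor (\<gamma> +
  \<open>unit_index j\<close>) j equals \<alpha> j + \<beta> j. The two resulting sums are mirror
  images of each other, and \<open>sum_adiag_shift\<close> applies to each.\<close>

lemma pd_mult: "pd j (F * G) = pd j F * G + F * pd j (G::'j::finite mps)"
proof (rule mps_eqI)
  fix \<gamma>
  let ?e = "unit_index j"
  have A: "(\<Sum>(\<alpha>, \<beta>)\<in>adiag (\<gamma> + ?e). of_nat (\<alpha> j) * (mcoeff F \<alpha> * mcoeff G \<beta>)) = mcoeff (pd j F * G) \<gamma>" for F G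
    by (subst sum_adiag_shift) (auto simp: mcoeff_times mcoeff_pd mult.assoc intro!: sum.cong)
  have "mcoeff (pd j (F * G)) \<gamma>
      = (\<Sum>(\<alpha>, \<beta>)\<in>adiag (\<gamma> + ?e). of_nat ((\<gamma> + ?e) j) * (mcoeff F \<alpha> * mcoeff G \<beta>))"
    by (simp add: mcoeff_pd mcoeff_times sum_distrib_left case_prod_unfold)
  also have "\<dots> = (\<Sum>(\<alpha>, \<beta>)\<in>adiag (\<gamma> + ?e).
      of_nat (\<alpha> j) * (mcoeff F \<alpha> * mcoeff G \<beta>) + of_nat (\<beta> j) * (mcoeff G \<beta> * mcoeff F \<alpha>))"
  proof (intro sum.cong refl, clarify)
    fix \<alpha> \<beta> assume "(\<alpha>, \<beta>) \<in> adiag (\<gamma> + ?e)"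
    then have "(\<gamma> + ?e) j = \<alpha> j + \<beta> j" by (metis in_adiag plus_fun_apply)
    then show "of_nat ((\<gamma> + ?e) j) * (mcoeff F \<alpha> * mcoeff G \<beta>)
      = of_nat (\<alpha> j) * (mcoeff F \<alpha> * mcoeff G \<beta>) + of_nat (\<beta> j) * (mcoeff G \<beta> * mcoeff F \<alpha>)"
      by (simp add: algebra_simps)
  qed
  also have "\<dots> = (\<Sum>(\<alpha>, \<beta>)\<in>adiag (\<gamma> + ?e). of_nat (\<alpha> j) * (mcoeff F \<alpha> * mcoeff G \<beta>))
      + (\<Sum>(\<alpha>, \<beta>)\<in>adiag (\<gamma> + ?e). of_nat (\<beta> j) * (mcoeff G \<beta> * mcoeff F \<alpha>))"
    by (simp add: case_prod_unfold sum.distrib)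
  also have "(\<Sum>(\<alpha>, \<beta>)\<in>adiag (\<gamma> + ?e). of_nat (\<beta> j) * (mcoeff G \<beta> * mcoeff F \<alpha>))
      = (\<Sum>(\<alpha>, \<beta>)\<in>adiag (\<gamma> + ?e). of_nat (\<alpha> j) * (mcoeff G \<alpha> * mcoeff F \<beta>))"
    by (rule sum_adiag_swap)
  finally show "mcoeff (pd j (F * G)) \<gamma> = mcoeff (pd j F * G + F * pd j G) \<gamma>"
    unfolding A by (simp add: mult.commute[of "pd j G"])
qed

section \<open>Weighted summability\<close>

text \<open>The weight is a parameter because two kinds occur: powers
  \<open>r ^ index_degree \<alpha>\<close> for convergence on a polydisc, and \<open>cwt\<close> for
  the Cauchy problem.\<close>

definition wsummable :: "(('j \<Rightarrow> nat) \<Rightarrow> real) \<Rightarrow> 'j mps \<Rightarrow> bool" where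
  "wsummable w F \<longleftrightarrow> (\<lambda>\<alpha>. \<bar>mcoeff F \<alpha>\<bar> * w \<alpha>) summable_on UNIV"

definition wnorm :: "(('j \<Rightarrow> nat) \<Rightarrow> real) \<Rightarrow> 'j mps \<Rightarrow> real" where
  "wnorm w F = (\<Sum>\<^sub>\<infinity>\<alpha>. \<bar>mcoeff F \<alpha>\<bar> * w \<alpha>)"

lemma wsummable_has_sum: "wsummable w F \<Longrightarrow> ((\<lambda>\<alpha>. \<bar>mcoeff F \<alpha>\<bar> * w \<alpha>) has_sum wnorm w F) UNIV"
  by (simp add: wsummable_def wnorm_def)

lemma wsummable_comparison:
  assumes "f summable_on UNIV" "\<And>\<alpha>. 0 \<le> w \<alpha>" "\<And>\<alpha>. \<bar>mcoeff F \<alpha>\<bar> * w \<alpha> \<le> f \<alpha>"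
  shows "wsummable w F" "wnorm w F \<le> infsum f UNIV"
proof -
  show s: "wsummable w F"
    unfolding wsummable_def
    by (rule summable_on_comparison_test[OF assms(1)]) (use assms in auto)
  then show "wnorm w F \<le> infsum f UNIV"
    unfolding wnorm_def wsummable_def by (intro infsum_mono) (use assms in auto)
qed

lemma wsummable_finite:
  assumes "finite {\<alpha>. mcoeff F \<alpha> \<noteq> 0}"
  shows "wsummable w F"
    and "wnorm w F = (\<Sum>\<alpha> | mcoeff F \<alpha> \<noteq> 0. \<bar>mcoeff F \<alpha>\<bar> * w \<alpha>)"
proof -
  have "((\<lambda>\<alpha>. \<bar>mcoeff F \<alpha>\<bar> * w \<alpha>) has_sum (\<Sum>\<alpha> | mcoeff F \<alpha> \<noteq> 0. \<bar>mcoeff F \<alpha>\<bar> * w \<alpha>)) UNIV"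
    by (rule has_sum_finite_neutralI[OF assms]) auto
  then show "wsummable w F"
    and "wnorm w F = (\<Sum>\<alpha> | mcoeff F \<alpha> \<noteq> 0. \<bar>mcoeff F \<alpha>\<bar> * w \<alpha>)"
    by (auto simp: wsummable_def wnorm_def has_sum_iff)
qed

lemma finite_support_0: "finite {\<alpha>. mcoeff (0::'j::finite mps) \<alpha> \<noteq> 0}"
  and finite_support_1: "finite {\<alpha>. mcoeff (1::'j::finite mps) \<alpha> \<noteq> 0}"
  and finite_support_mvar: "finite {\<alpha>. mcoeff (mvar j) \<alpha> \<noteq> 0}"
  by (auto simp: mcoeff_mvar)

lemma wsummable_0: "wsummable w (0::'j::finite mps)"
  and wsummable_1: "wsummable w (1::'j::finite mps)"
  and wsummable_mvar: "wsummable w (mvar j)"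
  by (intro wsummable_finite finite_support_0 finite_support_1 finite_support_mvar)+

lemma wnorm_0: "wnorm w (0::'j::finite mps) = 0"
  and wnorm_1: "wnorm w (1::'j::finite mps) = w 0"
  and wnorm_mvar: "wnorm w (mvar j) = w (unit_index j)"
  by (auto simp: wsummable_finite(2) finite_support_0 finite_support_1 finite_support_mvar mcoeff_mvar)

lemma wsummable_add:
  assumes "wsummable w F" "wsummable w (G::'j::finite mps)" "\<And>\<alpha>. 0 \<le> w \<alpha>"
  shows "wsummable w (F + G)" "wnorm w (F + G) \<le> wnorm w F + wnorm w G"
proof -
  have "((\<lambda>\<alpha>. \<bar>mcoeff F \<alpha>\<bar> * w \<alpha> + \<bar>mcoeff G \<alpha>\<bar> * w \<alpha>) has_sum wnorm w F + wnorm w G) UNIV"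
    using assms by (intro has_sum_add wsummable_has_sum)
  moreover have "\<bar>mcoeff (F + G) \<alpha>\<bar> * w \<alpha> \<le> \<bar>mcoeff F \<alpha>\<bar> * w \<alpha> + \<bar>mcoeff G \<alpha>\<bar> * w \<alpha>" for \<alpha>
    using mult_right_mono[OF abs_triangle_ineq[of "mcoeff F \<alpha>" "mcoeff G \<alpha>"] assms(3)[of \<alpha>]] by (simp add: algebra_simps)
  ultimately show "wsummable w (F + G)" "wnorm w (F + G) \<le> wnorm w F + wnorm w G"
    using wsummable_comparison[of "\<lambda>\<alpha>. \<bar>mcoeff F \<alpha>\<bar> * w \<alpha> + \<bar>mcoeff G \<alpha>\<bar> * w \<alpha>" w "F + G"] assms(3) by (auto simp: has_sum_iff)
qed

lemma wsummable_scaleR: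
  assumes "wsummable w (F::'j::finite mps)"
  shows "wsummable w (r *\<^sub>R F)" "wnorm w (r *\<^sub>R F) = \<bar>r\<bar> * wnorm w F"
proof -
  have "((\<lambda>\<alpha>. \<bar>r\<bar> * (\<bar>mcoeff F \<alpha>\<bar> * w \<alpha>)) has_sum \<bar>r\<bar> * wnorm w F) UNIV"
    using assms by (intro has_sum_cmult_right wsummable_has_sum)
  then show "wsummable w (r *\<^sub>R F)" "wnorm w (r *\<^sub>R F) = \<bar>r\<bar> * wnorm w F"
    by (auto simp: wsummable_def wnorm_def abs_mult has_sum_iff mult.assoc)
qed

lemma wsummable_uminus: "wsummable w (F::'j::finite mps) \<Longrightarrow> wsummable w (- F)"
  using wsummable_scaleR(1)[of w F "-1"] by simp

lemma wsummable_diff: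
  "wsummable w F \<Longrightarrow> wsummable w (G::'j::finite mps) \<Longrightarrow> (\<And>\<alpha>. 0 \<le> w \<alpha>) \<Longrightarrow> wsummable w (F - G)"
  using wsummable_add(1)[of w F "- G"] by (simp add: wsummable_uminus)

text \<open>By submultiplicativity of the weight, the weighted coefficients of the product are
  dominated by the Cauchy product of the two weighted families.\<close>

lemma wsummable_times:
  assumes F: "wsummable w F" and G: "wsummable w (G::'j::finite mps)"
    and w: "\<And>\<alpha>. 0 \<le> w \<alpha>" "\<And>\<alpha> \<beta>. w (\<alpha> + \<beta>) \<le> w \<alpha> * w \<beta>"
  shows "wsummable w (F * G)" "wnorm w (F * G) \<le> wnorm w F * wnorm w G"
proof -
  let ?f = "\<lambda>F \<alpha>. \<bar>mcoeff F \<alpha>\<bar> * w \<alpha>"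
  have s: "((\<lambda>\<gamma>. \<Sum>(\<alpha>, \<beta>)\<in>adiag \<gamma>. ?f F \<alpha> * ?f G \<beta>) has_sum (wnorm w F * wnorm w G)) UNIV"
    using has_sum_cauchy_product[of "?f F" "?f G"] F G w
    by (simp add: wsummable_def wnorm_def abs_mult)
  have le: "\<bar>mcoeff (F * G) \<gamma>\<bar> * w \<gamma> \<le> (\<Sum>(\<alpha>, \<beta>)\<in>adiag \<gamma>. ?f F \<alpha> * ?f G \<beta>)" for \<gamma>
  proof -
    have "\<bar>mcoeff (F * G) \<gamma>\<bar> * w \<gamma> \<le> (\<Sum>(\<alpha>, \<beta>)\<in>adiag \<gamma>. \<bar>mcoeff F \<alpha>\<bar> * \<bar>mcoeff G \<beta>\<bar>) * w \<gamma>"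
      unfolding mcoeff_times using w
      by (intro mult_right_mono order_trans[OF sum_abs] sum_mono) (auto simp: abs_mult)
    also have "\<dots> = (\<Sum>(\<alpha>, \<beta>)\<in>adiag \<gamma>. \<bar>mcoeff F \<alpha>\<bar> * \<bar>mcoeff G \<beta>\<bar> * w \<gamma>)"
      by (simp add: sum_distrib_right case_prod_unfold)
    also have "\<dots> \<le> (\<Sum>(\<alpha>, \<beta>)\<in>adiag \<gamma>. ?f F \<alpha> * ?f G \<beta>)"
    proof (intro sum_mono, clarify)
      fix \<alpha> \<beta> assume "(\<alpha>, \<beta>) \<in> adiag \<gamma>"
      then have "\<bar>mcoeff F \<alpha>\<bar> * \<bar>mcoeff G \<beta>\<bar> * w \<gamma> \<le> \<bar>mcoeff F \<alpha>\<bar> * \<bar>mcoeff G \<beta>\<bar> * (w \<alpha> * w \<beta>)"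
        using w(2)[of \<alpha> \<beta>] by (intro mult_left_mono) auto
      then show "\<bar>mcoeff F \<alpha>\<bar> * \<bar>mcoeff G \<beta>\<bar> * w \<gamma> \<le> ?f F \<alpha> * ?f G \<beta>"
        by (simp add: ac_simps)
    qed
    finally show ?thesis .
  qed
  show "wsummable w (F * G)" "wnorm w (F * G) \<le> wnorm w F * wnorm w G"
    using wsummable_comparison[of _ w "F * G", OF _ w(1) le] s by (auto simp: has_sum_iff)
qed

section \<open>The Banach algebra for the Cauchy problem\<close>

text \<open>
  The variable \<open>None\<close> is the space variable \<open>x\<close>, the variables \<open>Some i\<close> are the time variables
  \<open>y\<^sub>i\<close>. The monomial of time degree \<open>m\<close> and space degree \<open>k\<close> gets the weight \<open>m! k! / (m + k)!\<close>.
  These weights are submultiplicative, and they turn the loss of the space derivative into a gain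
  as soon as one integrates in time: the factor \<open>k\<close> from \<open>\<partial>/\<partial>x\<close> and the factor \<open>1 / (m + 1)\<close> from the
  integration are the quotient of consecutive weights (\<open>cauchy_weight_estimate\<close>).
\<close>

definition cwt :: "('i::finite option \<Rightarrow> nat) \<Rightarrow> real" where
  "cwt \<alpha> = 1 / real (index_degree \<alpha> choose \<alpha> None)"

definition time_degree :: "('i::finite option \<Rightarrow> nat) \<Rightarrow> nat" where
  "time_degree \<alpha> = (\<Sum>i\<in>UNIV. \<alpha> (Some i))"

lemma index_degree_option: "index_degree \<alpha> = \<alpha> None + time_degree (\<alpha>::'i::finite option \<Rightarrow> nat)"
proof -
  have "index_degree \<alpha> = (\<Sum>j\<in>insert None (range Some). \<alpha> j)"
    by (simp add: index_degree_def UNIV_option_conv)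
  also have "\<dots> = \<alpha> None + time_degree \<alpha>"
    by (subst sum.insert) (auto simp: time_degree_def sum.reindex)
  finally show ?thesis .
qed

lemma time_degree_add [simp]: "time_degree (\<alpha> + \<beta>) = time_degree \<alpha> + time_degree \<beta>"
  and time_degree_Some [simp]: "time_degree (unit_index (Some i)) = 1"
  and time_degree_None [simp]: "time_degree (unit_index None) = 0"
  and time_degree_0 [simp]: "time_degree 0 = 0"
  by (auto simp: time_degree_def sum.distrib unit_index_def)

lemma choose_None_pos: "index_degree \<alpha> choose \<alpha> None > 0"
  by (simp add: index_le_degree)

lemma cwt_pos: "cwt \<alpha> > 0"
  using choose_None_pos[of \<alpha>] by (simp add: cwt_def)

lemma cwt_nonneg [simp]: "cwt \<alpha> \<ge> 0"
  using cwt_pos[of \<alpha>] by simp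

lemma cwt_0: "cwt 0 = 1" and cwt_unit: "cwt (unit_index j) = 1"
  by (simp add: cwt_def, cases "j = None") (auto simp: cwt_def unit_index_other)

text \<open>A binomial coefficient is at most a power of two. Hence elements of the algebra converge
  absolutely on the polydisc of radius 1/2; this is the origin of the bound 1/2 in all
  evaluations.\<close>

lemma cwt_ge: "(1/2) ^ index_degree \<alpha> \<le> cwt \<alpha>"
proof -
  have "real (index_degree \<alpha> choose \<alpha> None) \<le> 2 ^ index_degree \<alpha>"
    using binomial_le_pow2 of_nat_le_iff[where 'a=real] by force
  then show ?thesis
    using choose_None_pos[of \<alpha>] by (simp add: cwt_def power_one_over divide_simps)
qed

text \<open>The left side is a single term of Vandermonde's sum. As \<open>cwt\<close> is the
  reciprocal of a binomial coefficient, this yields its submultiplicativity.\<close>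

lemma choose_mult_le: "(a choose m) * (b choose k) \<le> (a + b choose (m + k))"
proof -
  have "(a + b choose (m + k)) = (\<Sum>i\<le>m + k. (a choose i) * (b choose (m + k - i)))"
    by (rule vandermonde[symmetric])
  also have "\<dots> \<ge> (a choose m) * (b choose (m + k - m))"
    by (rule member_le_sum) auto
  finally show ?thesis by simp
qed

lemma cwt_add: "cwt (\<alpha> + \<beta>) \<le> cwt \<alpha> * cwt \<beta>"
proof -
  have "real (index_degree \<alpha> choose \<alpha> None) * real (index_degree \<beta> choose \<beta> None)
      \<le> real (index_degree (\<alpha> + \<beta>) choose (\<alpha> + \<beta>) None)"
    using choose_mult_le[of "index_degree \<alpha>" "\<alpha> None" "index_degree \<beta>" "\<beta> None"]
    by (simp flip: of_nat_mult)
  then show ?thesis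
    using choose_None_pos[of \<alpha>] choose_None_pos[of \<beta>] unfolding cwt_def
    by (simp add: frac_le flip: of_nat_mult)
qed

lemma cauchy_weight_estimate:
  "real (\<beta> None + 1) * cwt (\<alpha> + \<beta> + unit_index (Some i))
    \<le> real (time_degree (\<alpha> + \<beta>) + 1) * (cwt \<alpha> * cwt (\<beta> + unit_index None))"
proof -
  define D K where "D = index_degree (\<alpha> + \<beta>)" and "K = \<alpha> None + \<beta> None"
  have M: "time_degree (\<alpha> + \<beta>) + 1 = D + 1 - K" and "K \<le> D"
    using index_degree_option[of "\<alpha> + \<beta>"] by (auto simp: D_def K_def)
  have c1: "cwt (\<alpha> + \<beta> + unit_index (Some i)) = 1 / real (Suc D choose K)"
    by (simp add: cwt_def D_def K_def unit_index_other del: binomial_Suc_Suc)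
  have c2: "cwt (\<alpha> + (\<beta> + unit_index None)) = 1 / real (Suc D choose Suc K)"
    by (simp add: cwt_def D_def K_def del: binomial_Suc_Suc)
  \<comment> \<open>With D the total degree and K the space degree of \<alpha> + \<beta>, the weight
    after adding a time unit, divided by the weight after adding a space unit, is exactly (D + 1 -
    K) / (K + 1); the numerator is the time degree plus 1.\<close>
  have "Suc K * (Suc D choose Suc K) = (Suc D - K) * (Suc D choose K)"
    using binomial_absorption[of K "Suc D"] binomial_absorb_comp[of "Suc D" K]
    by (simp del: binomial_Suc_Suc)
  then have eq: "real (Suc K) * real (Suc D choose Suc K) = real (time_degree (\<alpha> + \<beta>) + 1) * real (Suc D choose K)"
    unfolding M by (metis Suc_eq_plus1 of_nat_mult)
  have pos: "real (Suc D choose K) > 0" "real (Suc D choose Suc K) > 0"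
    using \<open>K \<le> D\<close> by (auto simp del: binomial_Suc_Suc)
  have "real (\<beta> None + 1) * cwt (\<alpha> + \<beta> + unit_index (Some i)) \<le> real (Suc K) / real (Suc D choose K)"
    unfolding c1 using pos by (auto simp: K_def intro: divide_right_mono)
  also have "\<dots> = real (time_degree (\<alpha> + \<beta>) + 1) * cwt (\<alpha> + (\<beta> + unit_index None))"
    unfolding c2 using eq pos by (simp add: field_simps del: binomial_Suc_Suc)
  also have "\<dots> \<le> real (time_degree (\<alpha> + \<beta>) + 1) * (cwt \<alpha> * cwt (\<beta> + unit_index None))"
    by (intro mult_left_mono cwt_add) auto
  finally show ?thesis .
qed

text \<open>Turning the weighted l1 space into a type with Banach algebra instances allows its
  elements to be substituted into power series by the same \<open>psum\<close> that evaluates at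
  real points.\<close>

typedef ('i::finite) wps = "{F :: 'i option mps. wsummable cwt F}"
  morphisms mps_of Abs_wps
  by (auto intro: wsummable_0)

lemma wsummable_mps_of [simp]: "wsummable cwt (mps_of F)"
  using mps_of by auto

lemma mps_of_eqI: "mps_of F = mps_of G \<Longrightarrow> F = G"
  by (simp add: mps_of_inject)

lemma mcoeff_le_wnorm:
  assumes "wsummable w F" "\<And>\<alpha>. 0 \<le> w \<alpha>"
  shows "\<bar>mcoeff F \<alpha>\<bar> * w \<alpha> \<le> wnorm w F"
proof -
  have "(\<Sum>\<alpha>\<in>{\<alpha>}. \<bar>mcoeff F \<alpha>\<bar> * w \<alpha>) \<le> wnorm w F"
    unfolding wnorm_def using assms
    by (intro finite_sum_le_infsum) (auto simp: wsummable_def)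
  then show ?thesis by simp
qed

instantiation wps :: (finite) "{comm_ring_1, real_normed_algebra_1}"
begin

definition "0 = Abs_wps 0"
definition "1 = Abs_wps 1"
definition "F + G = Abs_wps (mps_of F + mps_of G)"
definition "F - G = Abs_wps (mps_of F - mps_of G)"
definition "- F = Abs_wps (- mps_of F)"
definition "F * G = Abs_wps (mps_of F * mps_of G)"
definition "r *\<^sub>R F = Abs_wps (r *\<^sub>R mps_of F)"
definition "norm F = wnorm cwt (mps_of F)"
definition "dist F G = norm (F - G :: 'a wps)"
definition "sgn F = (inverse (norm F) *\<^sub>R F :: 'a wps)"
definition [code del]: "uniformity = (INF e\<in>{0 <..}. principal {(F, G :: 'a wps). dist F G < e})"
definition [code del]: "open (S :: 'a wps set) = (\<forall>F\<in>S. \<forall>\<^sub>F (F', G) in uniformity. F' = F \<longrightarrow> G \<in> S)"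

lemma mps_of_simps:
  "mps_of 0 = (0::'a option mps)"
  "mps_of 1 = (1::'a option mps)"
  "mps_of (F + G) = mps_of F + (mps_of G::'a option mps)"
  "mps_of (F - G) = mps_of F - (mps_of G::'a option mps)"
  "mps_of (- F) = - (mps_of F::'a option mps)"
  "mps_of (F * G) = mps_of F * (mps_of G::'a option mps)"
  "mps_of (r *\<^sub>R F) = r *\<^sub>R (mps_of F::'a option mps)"
  unfolding zero_wps_def one_wps_def plus_wps_def minus_wps_def uminus_wps_def times_wps_def scaleR_wps_def
  by (simp_all add: Abs_wps_inverse wsummable_0 wsummable_1 wsummable_add wsummable_diff wsummable_uminus
     wsummable_times wsummable_scaleR cwt_add)

instance
proof
  fix F G H :: "'a wps" and r s :: real
  show "norm F = 0 \<longleftrightarrow> F = 0"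
  proof
    assume *: "norm F = 0"
    have "mcoeff (mps_of F) \<alpha> = 0" for \<alpha>
    proof -
      have "\<bar>mcoeff (mps_of F) \<alpha>\<bar> * cwt \<alpha> \<le> 0"
        using mcoeff_le_wnorm[of cwt "mps_of F" \<alpha>] * by (simp add: norm_wps_def)
      then show ?thesis using cwt_pos[of \<alpha>] by (simp add: mult_le_0_iff)
    qed
    then show "F = 0" by (intro mps_of_eqI mps_eqI) (simp add: mps_of_simps)
  qed (simp add: norm_wps_def mps_of_simps wnorm_0)
  show "norm (F + G) \<le> norm F + norm G"
    by (simp add: norm_wps_def mps_of_simps wsummable_add(2))
  show "norm (r *\<^sub>R F) = \<bar>r\<bar> * norm F"
    by (simp add: norm_wps_def mps_of_simps wsummable_scaleR(2))
  show "norm (F * G) \<le> norm F * norm G"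
    by (simp add: norm_wps_def mps_of_simps wsummable_times(2) cwt_add)
  show "norm (1::'a wps) = 1"
    by (simp add: norm_wps_def mps_of_simps wnorm_1 cwt_0)
  show "(0::'a wps) \<noteq> 1"
  proof
    assume "(0::'a wps) = 1"
    then have "mps_of (0::'a wps) = mps_of 1" by simp
    then show False by (simp add: mps_of_simps)
  qed
qed (auto intro!: mps_of_eqI simp: mps_of_simps algebra_simps dist_wps_def sgn_wps_def
      uniformity_wps_def open_wps_def)

end

declare mps_of_simps [simp]

lemma mps_of_sum [simp]: "mps_of (sum F A) = (\<Sum>x\<in>A. mps_of (F x))"
  by (induction A rule: infinite_finite_induct) auto

lemma mps_of_power [simp]: "mps_of (F ^ n) = mps_of F ^ n"
  by (induction n) auto

lemma mps_of_prod [simp]: "mps_of (prod F A) = (\<Prod>x\<in>A. mps_of (F x))"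
  by (induction A rule: infinite_finite_induct) auto

lemma mcoeff_le_norm: "\<bar>mcoeff (mps_of F) \<alpha>\<bar> \<le> norm F / cwt \<alpha>"
  using mcoeff_le_wnorm[of cwt "mps_of F" \<alpha>] cwt_pos[of \<alpha>] by (simp add: norm_wps_def field_simps)

lemma bounded_linear_mcoeff: "bounded_linear (\<lambda>F. mcoeff (mps_of F) \<alpha>)"
proof (rule bounded_linear_intro)
  show "norm (mcoeff (mps_of F) \<alpha>) \<le> norm F * (1 / cwt \<alpha>)" for F :: "'a wps"
    using mcoeff_le_norm[of F \<alpha>] by simp
qed auto

lemma infsum_le_of_finite_sums:
  fixes f :: "'a \<Rightarrow> real"
  assumes "\<And>x. 0 \<le> f x" and "\<And>A. finite A \<Longrightarrow> sum f A \<le> C"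
  shows "f summable_on UNIV" "infsum f UNIV \<le> C"
proof -
  show s: "f summable_on UNIV"
    by (rule nonneg_bdd_above_summable_on) (use assms in \<open>auto intro!: bdd_aboveI[of _ C]\<close>)
  show "infsum f UNIV \<le> C"
    using s assms(2) by (intro infsum_le_finite_sums) auto
qed

text \<open>The coefficients converge one by one. The Cauchy bound holds for every finite partial
  sum, survives the limit there, and so bounds the full weighted sum; in particular the limit series
  differs from a member of the sequence by a summable one.\<close>

instance wps :: (finite) banach
proof
  fix X :: "nat \<Rightarrow> 'a wps"
  assume X: "Cauchy X"
  define c where "c n \<alpha> = mcoeff (mps_of (X n)) \<alpha>" for n \<alpha>
  have "convergent (\<lambda>n. c n \<alpha>)" for \<alpha>
    unfolding c_def using bounded_linear.Cauchy[OF bounded_linear_mcoeff X]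
    by (simp add: Cauchy_convergent)
  then obtain g where g: "\<And>\<alpha>. (\<lambda>n. c n \<alpha>) \<longlonglongrightarrow> g \<alpha>"
    unfolding convergent_def by metis
  have key: "\<exists>N. \<forall>n\<ge>N. wsummable cwt (mps_of (X n) - Abs_mps g) \<and> wnorm cwt (mps_of (X n) - Abs_mps g) \<le> e"
    if "e > 0" for e
  proof -
    from X \<open>e > 0\<close> obtain N where N: "\<And>m n. m \<ge> N \<Longrightarrow> n \<ge> N \<Longrightarrow> dist (X n) (X m) < e"
      unfolding Cauchy_def by blast
    have "(\<Sum>\<alpha>\<in>A. \<bar>mcoeff (mps_of (X n) - Abs_mps g) \<alpha>\<bar> * cwt \<alpha>) \<le> e" if "n \<ge> N" "finite A" for n A
    proof (rule Lim_bounded)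
      have "(\<lambda>m. \<Sum>\<alpha>\<in>A. \<bar>c n \<alpha> - c m \<alpha>\<bar> * cwt \<alpha>) \<longlonglongrightarrow> (\<Sum>\<alpha>\<in>A. \<bar>c n \<alpha> - g \<alpha>\<bar> * cwt \<alpha>)"
        by (intro tendsto_intros g)
      then show "(\<lambda>m. \<Sum>\<alpha>\<in>A. \<bar>c n \<alpha> - c m \<alpha>\<bar> * cwt \<alpha>) \<longlonglongrightarrow> (\<Sum>\<alpha>\<in>A. \<bar>mcoeff (mps_of (X n) - Abs_mps g) \<alpha>\<bar> * cwt \<alpha>)"
        by (simp add: c_def)
      show "\<forall>m\<ge>N. (\<Sum>\<alpha>\<in>A. \<bar>c n \<alpha> - c m \<alpha>\<bar> * cwt \<alpha>) \<le> e"
      proof (intro allI impI)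
        fix m assume "m \<ge> N"
        have "(\<Sum>\<alpha>\<in>A. \<bar>c n \<alpha> - c m \<alpha>\<bar> * cwt \<alpha>) = (\<Sum>\<alpha>\<in>A. \<bar>mcoeff (mps_of (X n - X m)) \<alpha>\<bar> * cwt \<alpha>)"
          by (simp add: c_def)
        also have "\<dots> \<le> norm (X n - X m)"
          unfolding norm_wps_def wnorm_def
          using wsummable_mps_of[of "X n - X m"] \<open>finite A\<close> unfolding wsummable_def
          by (intro finite_sum_le_infsum) auto
        also have "\<dots> \<le> e"
          using N[OF \<open>m \<ge> N\<close> \<open>n \<ge> N\<close>] by (simp add: dist_norm)
        finally show "(\<Sum>\<alpha>\<in>A. \<bar>c n \<alpha> - c m \<alpha>\<bar> * cwt \<alpha>) \<le> e" .
      qed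
    qed
    then show ?thesis
      unfolding wsummable_def wnorm_def
      by (intro exI[of _ N] allI impI conjI infsum_le_of_finite_sums) auto
  qed
  obtain N where "wsummable cwt (mps_of (X N) - Abs_mps g)"
    using key[of 1] by auto
  from wsummable_diff[OF wsummable_mps_of[of "X N"] this]
  have g': "mps_of (Abs_wps (Abs_mps g)) = Abs_mps g"
    by (simp add: Abs_wps_inverse)
  have "X \<longlonglongrightarrow> Abs_wps (Abs_mps g)"
  proof (rule metric_LIMSEQ_I)
    fix e :: real assume "e > 0"
    then obtain N where "\<forall>n\<ge>N. wnorm cwt (mps_of (X n) - Abs_mps g) \<le> e / 2"
      using key[of "e/2"] by auto
    then show "\<exists>N. \<forall>n\<ge>N. dist (X n) (Abs_wps (Abs_mps g)) < e"
      using \<open>e > 0\<close> by (force simp: dist_norm norm_wps_def g')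
  qed
  then show "convergent X" by (auto simp: convergent_def)
qed

definition wvar :: "'i::finite option \<Rightarrow> 'i wps" where
  "wvar j = Abs_wps (mvar j)"

lemma mps_of_wvar [simp]: "mps_of (wvar j) = mvar j"
  by (simp add: wvar_def Abs_wps_inverse wsummable_mvar)

lemma norm_wvar [simp]: "norm (wvar j) = 1"
  by (simp add: norm_wps_def wnorm_mvar cwt_unit)

text \<open>
  The inverse of \<open>F \<mapsto> \<Sum>\<^sub>i y\<^sub>i \<partial>F/\<partial>y\<^sub>i\<close> on the series without terms of time degree 0; these terms
  are sent to 0 because \<open>x / 0 = 0\<close>.
\<close>

definition time_integral :: "'i::finite option mps \<Rightarrow> 'i option mps" where
  "time_integral F = Abs_mps (\<lambda>\<gamma>. mcoeff F \<gamma> / real (time_degree \<gamma>))"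

text \<open>The factors are packed into one operator because \<open>pd None\<close> alone is
  unbounded; the loss is repaired only after the integration in time.\<close>

definition cauchy_op :: "'i::finite \<Rightarrow> 'i wps \<Rightarrow> 'i wps \<Rightarrow> 'i wps" where
  "cauchy_op i a f = Abs_wps (time_integral (mvar (Some i) * (mps_of a * pd None (mps_of f))))"

text \<open>Up to the shift by \<open>unit_index (Some i)\<close>, the weighted coefficients are
  dominated by the Cauchy product of those of a with the shifted ones of f, by
  \<open>cauchy_weight_estimate\<close>. The bound holds with constant 1.\<close>

lemma cauchy_op_bound:
  fixes a f :: "'i::finite wps" and i
  defines "F \<equiv> time_integral (mvar (Some i) * (mps_of a * pd None (mps_of f)))"
  shows "wsummable cwt F" "wnorm cwt F \<le> norm a * norm f"
proof -
  let ?A = "\<lambda>\<alpha>. \<bar>mcoeff (mps_of a) \<alpha>\<bar> * cwt \<alpha>"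
  let ?B = "\<lambda>\<alpha>. \<bar>mcoeff (mps_of f) \<alpha>\<bar> * cwt \<alpha>"
  let ?x = "unit_index None :: 'i option \<Rightarrow> nat" and ?y = "unit_index (Some i)"
  have inj: "inj (\<lambda>\<alpha>. \<alpha> + u)" for u :: "'i option \<Rightarrow> nat"
    by (auto simp: inj_def)
  have sA: "?A summable_on UNIV" and sB: "?B summable_on UNIV"
    using wsummable_mps_of by (auto simp: wsummable_def)
  have sB': "?B summable_on range (\<lambda>\<alpha>. \<alpha> + ?x)"
    using sB by (rule summable_on_subset_banach) auto
  then have sBx: "(\<lambda>\<beta>. ?B (\<beta> + ?x)) summable_on UNIV"
    by (simp add: summable_on_reindex[OF inj] o_def)
  have iBx: "infsum (\<lambda>\<beta>. ?B (\<beta> + ?x)) UNIV \<le> norm f"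
  proof -
    have "infsum (\<lambda>\<beta>. ?B (\<beta> + ?x)) UNIV = infsum ?B (range (\<lambda>\<alpha>. \<alpha> + ?x))"
      by (simp add: infsum_reindex[OF inj] o_def)
    also have "\<dots> \<le> infsum ?B UNIV"
      by (intro infsum_mono_neutral sB sB') auto
    finally show ?thesis by (simp add: norm_wps_def wnorm_def)
  qed
  let ?P = "\<lambda>\<gamma>. \<Sum>(\<alpha>, \<beta>)\<in>adiag \<gamma>. ?A \<alpha> * ?B (\<beta> + ?x)"
  have P: "(?P has_sum (norm a * infsum (\<lambda>\<beta>. ?B (\<beta> + ?x)) UNIV)) UNIV"
    using has_sum_cauchy_product[of ?A "\<lambda>\<beta>. ?B (\<beta> + ?x)"] sA sBx
    by (simp add: norm_wps_def wnorm_def abs_mult)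
  have le: "\<bar>mcoeff F (\<gamma> + ?y)\<bar> * cwt (\<gamma> + ?y) \<le> ?P \<gamma>" for \<gamma>
  proof -
    let ?t = "real (time_degree \<gamma> + 1)"
    have "\<bar>mcoeff F (\<gamma> + ?y)\<bar> * cwt (\<gamma> + ?y)
        = \<bar>\<Sum>(\<alpha>, \<beta>)\<in>adiag \<gamma>. mcoeff (mps_of a) \<alpha> * (real (\<beta> None + 1) * mcoeff (mps_of f) (\<beta> + ?x))\<bar> * (cwt (\<gamma> + ?y) / ?t)"
      unfolding F_def time_integral_def mcoeff_Abs_mps mcoeff_mvar_times_shift
      by (simp add: mcoeff_times mcoeff_pd add.commute)
    also have "\<dots> \<le> (\<Sum>(\<alpha>, \<beta>)\<in>adiag \<gamma>. \<bar>mcoeff (mps_of a) \<alpha>\<bar> * (real (\<beta> None + 1) * \<bar>mcoeff (mps_of f) (\<beta> + ?x)\<bar>)) * (cwt (\<gamma> + ?y) / ?t)"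
      by (intro mult_right_mono order_trans[OF sum_abs] sum_mono) (auto simp: abs_mult)
    also have "\<dots> = (\<Sum>(\<alpha>, \<beta>)\<in>adiag \<gamma>. \<bar>mcoeff (mps_of a) \<alpha>\<bar> * \<bar>mcoeff (mps_of f) (\<beta> + ?x)\<bar> * (real (\<beta> None + 1) * cwt (\<gamma> + ?y) / ?t))"
      by (subst sum_distrib_right) (simp add: case_prod_unfold ac_simps)
    also have "\<dots> \<le> ?P \<gamma>"
    proof (intro sum_mono, clarify)
      fix \<alpha> \<beta> assume "(\<alpha>, \<beta>) \<in> adiag \<gamma>"
      then have g: "\<gamma> = \<alpha> + \<beta>" by simp
      have "real (\<beta> None + 1) * cwt (\<gamma> + ?y) / ?t \<le> cwt \<alpha> * cwt (\<beta> + ?x)"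
        using cauchy_weight_estimate[of \<beta> \<alpha> i] unfolding g by (simp add: divide_simps mult.commute)
      then have "\<bar>mcoeff (mps_of a) \<alpha>\<bar> * \<bar>mcoeff (mps_of f) (\<beta> + ?x)\<bar> * (real (\<beta> None + 1) * cwt (\<gamma> + ?y) / ?t)
          \<le> \<bar>mcoeff (mps_of a) \<alpha>\<bar> * \<bar>mcoeff (mps_of f) (\<beta> + ?x)\<bar> * (cwt \<alpha> * cwt (\<beta> + ?x))"
        by (intro mult_left_mono) auto
      then show "\<bar>mcoeff (mps_of a) \<alpha>\<bar> * \<bar>mcoeff (mps_of f) (\<beta> + ?x)\<bar> * (real (\<beta> None + 1) * cwt (\<gamma> + ?y) / ?t)
          \<le> ?A \<alpha> * ?B (\<beta> + ?x)"
        by (simp add: ac_simps)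
    qed
    finally show ?thesis .
  qed
  let ?f = "\<lambda>\<gamma>. \<bar>mcoeff F \<gamma>\<bar> * cwt \<gamma>"
  \<comment> \<open>Indices without the factor \<open>mvar (Some i)\<close> carry the coefficient 0,
    so that summing over the shifted indices loses nothing.\<close>
  have z: "?f \<gamma> = 0" if "\<gamma> \<notin> range (\<lambda>\<gamma>. \<gamma> + ?y)" for \<gamma>
  proof -
    have "\<gamma> (Some i) = 0"
      using that index_split[of \<gamma> "Some i"] by blast
    then show ?thesis
      by (simp add: F_def time_integral_def mcoeff_mvar_times_0)
  qed
  have s1: "(\<lambda>\<gamma>. ?f (\<gamma> + ?y)) summable_on UNIV"
    by (rule summable_on_comparison_test[of ?P]) (use P le in \<open>auto simp: has_sum_iff\<close>)
  then have s2: "?f summable_on range (\<lambda>\<gamma>. \<gamma> + ?y)"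
    by (simp add: summable_on_reindex[OF inj] o_def)
  then show "wsummable cwt F"
    unfolding wsummable_def
    by (rule summable_on_cong_neutral[THEN iffD1, rotated -1]) (use z in auto)
  have "wnorm cwt F = infsum ?f (range (\<lambda>\<gamma>. \<gamma> + ?y))"
    unfolding wnorm_def by (rule infsum_cong_neutral) (use z in auto)
  also have "\<dots> = infsum (\<lambda>\<gamma>. ?f (\<gamma> + ?y)) UNIV"
    by (simp add: infsum_reindex[OF inj] o_def)
  also have "\<dots> \<le> infsum ?P UNIV"
    using P s1 le by (intro infsum_mono) (auto simp: has_sum_iff)
  also have "\<dots> \<le> norm a * norm f"
    using P iBx by (auto simp: has_sum_iff intro!: mult_left_mono)
  finally show "wnorm cwt F \<le> norm a * norm f" .
qed

lemma mps_of_cauchy_op: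
  "mps_of (cauchy_op i a f) = time_integral (mvar (Some i) * (mps_of a * pd None (mps_of f)))"
  using cauchy_op_bound[of i a f] by (simp add: cauchy_op_def Abs_wps_inverse)

lemma norm_cauchy_op: "norm (cauchy_op i a f) \<le> norm a * norm f"
  using cauchy_op_bound(2)[of i a f] by (simp add: norm_wps_def mps_of_cauchy_op)

lemma cauchy_op_diff_left: "cauchy_op i (a - b) f = cauchy_op i a f - cauchy_op i b f"
  and cauchy_op_diff_right: "cauchy_op i a (f - g) = cauchy_op i a f - cauchy_op i a g"
  by (auto intro!: mps_of_eqI mps_eqI
     simp: mps_of_cauchy_op time_integral_def diff_divide_distrib algebra_simps)

lemma has_sum_sum:
  fixes f :: "'i \<Rightarrow> 'a \<Rightarrow> 'b::topological_comm_monoid_add"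
  shows "(\<And>i. i \<in> I \<Longrightarrow> (f i has_sum s i) A) \<Longrightarrow> ((\<lambda>x. \<Sum>i\<in>I. f i x) has_sum (\<Sum>i\<in>I. s i)) A"
  by (induction I rule: infinite_finite_induct) (auto intro: has_sum_add)

section \<open>Convergent power series in commutative Banach algebras\<close>

definition zpow :: "('j::finite \<Rightarrow> 'a::comm_monoid_mult) \<Rightarrow> ('j \<Rightarrow> nat) \<Rightarrow> 'a" where
  "zpow Z \<alpha> = (\<Prod>j\<in>UNIV. Z j ^ \<alpha> j)"

text \<open>Substitution into a power series: with real arguments the value of the series, with
  arguments in \<open>wps\<close> a composition of series. As \<open>infsum\<close> is 0 on families
  that are not summable, the later laws carry convergence hypotheses.\<close>

definition psum :: "'j::finite mps \<Rightarrow> ('j \<Rightarrow> 'a) \<Rightarrow> 'a::{real_normed_algebra_1, comm_ring_1, banach}" where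
  "psum c Z = (\<Sum>\<^sub>\<infinity>\<alpha>. mcoeff c \<alpha> *\<^sub>R zpow Z \<alpha>)"

text \<open>Absolute convergence on the closed polydisc of radius r, and then also for arguments of
  norm at most r in any commutative Banach algebra.\<close>

definition conv :: "real \<Rightarrow> 'j::finite mps \<Rightarrow> bool" where
  "conv r c \<longleftrightarrow> wsummable (\<lambda>\<alpha>. r ^ index_degree \<alpha>) c"

lemma zpow_0 [simp]: "zpow Z 0 = 1"
  and zpow_add: "zpow Z (\<alpha> + \<beta>) = zpow Z \<alpha> * zpow Z \<beta>"
  by (auto simp: zpow_def power_add prod.distrib)

lemma zpow_unit [simp]: "zpow Z (unit_index j) = Z j"
proof -
  have "zpow Z (unit_index j) = (\<Prod>i\<in>UNIV. if i = j then Z i else 1)"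
    unfolding zpow_def by (intro prod.cong) (auto simp: unit_index_def)
  then show ?thesis by simp
qed

lemma zpow_const: "zpow (\<lambda>_. r) \<alpha> = r ^ index_degree \<alpha>"
  by (simp add: zpow_def index_degree_def power_sum)

lemma norm_zpow_le:
  fixes Z :: "'j::finite \<Rightarrow> 'a::{real_normed_algebra_1, comm_monoid_mult}"
  assumes "\<And>j. norm (Z j) \<le> r j"
  shows "norm (zpow Z \<alpha>) \<le> zpow r \<alpha>"
  unfolding zpow_def
  by (intro order_trans[OF norm_prod_le] prod_mono conjI norm_ge_zero
      order_trans[OF norm_power_ineq] power_mono assms)

lemma norm_zpow_le_power:
  fixes Z :: "'j::finite \<Rightarrow> 'a::{real_normed_algebra_1, comm_monoid_mult}"
  assumes "\<And>j. norm (Z j) \<le> r"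
  shows "norm (zpow Z \<alpha>) \<le> r ^ index_degree \<alpha>"
  using norm_zpow_le[of Z "\<lambda>_. r" \<alpha>] assms by (simp add: zpow_const)

lemma zpow_scaleR:
  fixes Z :: "'j::finite \<Rightarrow> 'a::{real_algebra_1, comm_monoid_mult}"
  shows "zpow (\<lambda>j. r *\<^sub>R Z j) \<alpha> = r ^ index_degree \<alpha> *\<^sub>R zpow Z \<alpha>"
proof -
  have pw: "(r *\<^sub>R x) ^ n = r ^ n *\<^sub>R x ^ n" for x :: 'a and n
    by (induction n) auto
  have "(\<Prod>j\<in>A. (r *\<^sub>R Z j) ^ \<alpha> j) = (\<Prod>j\<in>A. r ^ \<alpha> j) *\<^sub>R (\<Prod>j\<in>A. Z j ^ \<alpha> j)" if "finite A" for A
    using that by induction (auto simp: pw)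
  then show ?thesis by (simp add: zpow_def index_degree_def power_sum)
qed

lemma psum_summable:
  assumes "wsummable w c" "\<And>\<alpha>. norm (zpow Z \<alpha>) \<le> w \<alpha>"
  shows "(\<lambda>\<alpha>. norm (mcoeff c \<alpha> *\<^sub>R zpow Z \<alpha>)) summable_on UNIV"
  by (rule summable_on_comparison_test[OF assms(1)[unfolded wsummable_def]])
     (auto intro: mult_left_mono assms(2))

lemma psum_has_sum:
  fixes Z :: "'j::finite \<Rightarrow> 'a::{real_normed_algebra_1, comm_ring_1, banach}"
  assumes "wsummable w c" "\<And>\<alpha>. norm (zpow Z \<alpha>) \<le> w \<alpha>"
  shows "((\<lambda>\<alpha>. mcoeff c \<alpha> *\<^sub>R zpow Z \<alpha>) has_sum psum c Z) UNIV"
  unfolding psum_def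
  by (intro has_sum_infsum Infinite_Sum.abs_summable_summable[OF psum_summable[OF assms]])

lemma norm_psum_le:
  fixes Z :: "'j::finite \<Rightarrow> 'a::{real_normed_algebra_1, comm_ring_1, banach}"
  assumes "wsummable w c" "\<And>\<alpha>. norm (zpow Z \<alpha>) \<le> w \<alpha>"
  shows "norm (psum c Z) \<le> wnorm w c"
proof -
  have "norm (psum c Z) \<le> (\<Sum>\<^sub>\<infinity>\<alpha>. norm (mcoeff c \<alpha> *\<^sub>R zpow Z \<alpha>))"
    unfolding psum_def by (rule norm_infsum_bound[OF psum_summable[OF assms]])
  also have "\<dots> \<le> wnorm w c"
    unfolding wnorm_def
    by (intro infsum_mono psum_summable[OF assms] assms(1)[unfolded wsummable_def])
       (auto intro: mult_left_mono assms(2))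
  finally show ?thesis .
qed

lemma psum_eqI: "((\<lambda>\<alpha>. mcoeff c \<alpha> *\<^sub>R zpow Z \<alpha>) has_sum s) UNIV \<Longrightarrow> psum c Z = s"
  unfolding psum_def by (rule infsumI)

context
  fixes w :: "('j::finite \<Rightarrow> nat) \<Rightarrow> real" and Z :: "'j \<Rightarrow> 'a::{real_normed_algebra_1, comm_ring_1, banach}"
  assumes w: "\<And>\<alpha>. norm (zpow Z \<alpha>) \<le> w \<alpha>"
begin

lemma psum_add: "wsummable w c \<Longrightarrow> wsummable w d \<Longrightarrow> psum (c + d) Z = psum c Z + psum d Z"
  by (rule psum_eqI) (use has_sum_add[OF psum_has_sum[OF _ w] psum_has_sum[OF _ w], of c d]
     in \<open>simp add: scaleR_add_left\<close>)

lemma psum_scaleR: "wsummable w c \<Longrightarrow> psum (r *\<^sub>R c) Z = r *\<^sub>R psum c Z"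
  by (rule psum_eqI) (use has_sum_scaleR[OF psum_has_sum[OF _ w], of c r] in simp)

lemma psum_diff: "wsummable w c \<Longrightarrow> wsummable w d \<Longrightarrow> psum (c - d) Z = psum c Z - psum d Z"
  using psum_add[of c "- d"] psum_scaleR[of d "-1"] by (simp add: wsummable_uminus)

lemma psum_times:
  assumes "wsummable w c" "wsummable w d"
  shows "psum (c * d) Z = psum c Z * psum d Z"
proof (rule psum_eqI)
  have "((\<lambda>\<gamma>. \<Sum>(\<alpha>, \<beta>)\<in>adiag \<gamma>. (mcoeff c \<alpha> *\<^sub>R zpow Z \<alpha>) * (mcoeff d \<beta> *\<^sub>R zpow Z \<beta>))
      has_sum (psum c Z * psum d Z)) UNIV"
    unfolding psum_def
    by (rule has_sum_cauchy_product[OF psum_summable[OF assms(1) w] psum_summable[OF assms(2) w]])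
  moreover have "(\<Sum>(\<alpha>, \<beta>)\<in>adiag \<gamma>. (mcoeff c \<alpha> *\<^sub>R zpow Z \<alpha>) * (mcoeff d \<beta> *\<^sub>R zpow Z \<beta>))
      = mcoeff (c * d) \<gamma> *\<^sub>R zpow Z \<gamma>" for \<gamma>
    unfolding mcoeff_times scaleR_sum_left
    by (intro sum.cong) (auto simp: zpow_add)
  ultimately show "((\<lambda>\<gamma>. mcoeff (c * d) \<gamma> *\<^sub>R zpow Z \<gamma>) has_sum psum c Z * psum d Z) UNIV"
    by simp
qed

end

lemma psum_finite_support:
  fixes Z :: "'j::finite \<Rightarrow> 'a::{real_normed_algebra_1, comm_ring_1, banach}"
  assumes "finite {\<alpha>. mcoeff c \<alpha> \<noteq> 0}"
  shows "psum c Z = (\<Sum>\<alpha> | mcoeff c \<alpha> \<noteq> 0. mcoeff c \<alpha> *\<^sub>R zpow Z \<alpha>)"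
  by (rule psum_eqI, rule has_sum_finite_neutralI[OF assms]) auto

lemma psum_0 [simp]: "psum 0 Z = 0"
  and psum_1 [simp]: "psum 1 Z = 1"
  and psum_mvar [simp]: "psum (mvar j) Z = Z j"
  by (auto simp: psum_finite_support finite_support_0 finite_support_1 finite_support_mvar mcoeff_mvar)

lemma psum_at_0: "psum c (\<lambda>_. 0 :: 'a::{real_normed_algebra_1, comm_ring_1, banach}) = mcoeff c 0 *\<^sub>R 1"
proof (rule psum_eqI, rule has_sum_finite_neutralI)
  fix \<alpha> :: "'b \<Rightarrow> nat" assume "\<alpha> \<in> UNIV - {0}"
  then show "mcoeff c \<alpha> *\<^sub>R zpow (\<lambda>_. 0::'a) \<alpha> = 0"
    by (simp add: zpow_const power_0_left)
qed auto

text \<open>A bounded algebra homomorphism passes through the sum and through each monomial. It is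
  applied to evaluation at a point and to the constant coefficient.\<close>

lemma psum_bounded_hom:
  fixes h :: "'a::{real_normed_algebra_1, comm_ring_1, banach} \<Rightarrow> 'b::{real_normed_algebra_1, comm_ring_1, banach}"
  assumes h: "bounded_linear h" "\<And>x y. h (x * y) = h x * h y" "h 1 = 1"
    and "wsummable w c" "\<And>\<alpha>. norm (zpow Z \<alpha>) \<le> w \<alpha>"
  shows "h (psum c Z) = psum c (\<lambda>j. h (Z j))"
proof -
  have pw: "h (x ^ n) = h x ^ n" for x n
    by (induction n) (auto simp: h)
  have "h (\<Prod>j\<in>A. Z j ^ \<alpha> j) = (\<Prod>j\<in>A. h (Z j) ^ \<alpha> j)" if "finite A" for A \<alpha>
    using that by induction (auto simp: h pw)
  then have "h (zpow Z \<alpha>) = zpow (\<lambda>j. h (Z j)) \<alpha>" for \<alpha>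
    by (simp add: zpow_def)
  then show ?thesis
    using has_sum_bounded_linear[OF h(1) psum_has_sum[OF assms(4,5)]]
    by (intro psum_eqI[symmetric]) (simp add: bounded_linear.linear[OF h(1)] linear_scale)
qed

definition rescale :: "real \<Rightarrow> 'j::finite mps \<Rightarrow> 'j mps" where
  "rescale r c = Abs_mps (\<lambda>\<alpha>. mcoeff c \<alpha> * r ^ index_degree \<alpha>)"

lemma psum_rescale:
  fixes Z :: "'j::finite \<Rightarrow> 'a::{real_normed_algebra_1, comm_ring_1, banach}"
  shows "psum (rescale r c) Z = psum c (\<lambda>j. r *\<^sub>R Z j)"
  by (simp add: psum_def zpow_scaleR rescale_def)

lemma conv_mono:
  assumes "conv r c" "0 \<le> s" "s \<le> r" shows "conv s c"
  unfolding conv_def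
  by (rule wsummable_comparison(1)[OF assms(1)[unfolded conv_def wsummable_def]])
     (use assms in \<open>auto intro!: mult_left_mono power_mono\<close>)

lemma conv_add: "conv r c \<Longrightarrow> conv r d \<Longrightarrow> 0 \<le> r \<Longrightarrow> conv r (c + d)"
  and conv_diff: "conv r c \<Longrightarrow> conv r d \<Longrightarrow> 0 \<le> r \<Longrightarrow> conv r (c - d)"
  and conv_scaleR: "conv r c \<Longrightarrow> conv r (s *\<^sub>R c)"
  and conv_times: "conv r c \<Longrightarrow> conv r d \<Longrightarrow> 0 \<le> r \<Longrightarrow> conv r (c * d)"
  and conv_0: "conv r 0" and conv_1: "conv r 1"
  by (auto simp: conv_def power_add wsummable_0 wsummable_1
      intro!: wsummable_add wsummable_diff wsummable_scaleR wsummable_times)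

lemma conv_rescale: "conv s (rescale r c) \<longleftrightarrow> conv (s * \<bar>r\<bar>) c"
  by (simp add: rescale_def conv_def wsummable_def abs_mult power_abs power_mult_distrib mult_ac)

lemma Suc_le_pow2: "real (Suc n) \<le> 2 ^ n"
proof -
  have "Suc n \<le> 2 ^ n" by (induction n) auto
  then have "real (Suc n) \<le> real (2 ^ n)" by (rule of_nat_mono)
  then show ?thesis by simp
qed

text \<open>Halving the radius gains a factor \<open>2 ^ index_degree\<close>, which absorbs the
  factor \<alpha> j + 1 produced by the derivative.\<close>

lemma conv_pd:
  assumes "conv (2 * r) c" "r > 0"
  shows "conv r (pd j c)"
proof -
  let ?f = "\<lambda>\<alpha>. \<bar>mcoeff c \<alpha>\<bar> * (2 * r) ^ index_degree \<alpha>"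
  have "?f summable_on range (\<lambda>\<alpha>. \<alpha> + unit_index j)"
    using assms(1) unfolding conv_def wsummable_def by (rule summable_on_subset_banach) auto
  moreover have "inj (\<lambda>\<alpha>::'a \<Rightarrow> nat. \<alpha> + unit_index j)"
    by (auto simp: inj_def)
  ultimately have "(\<lambda>\<alpha>. ?f (\<alpha> + unit_index j)) summable_on UNIV"
    by (simp add: summable_on_reindex o_def mult_ac)
  then have s: "(\<lambda>\<alpha>. 1 / r * ?f (\<alpha> + unit_index j)) summable_on UNIV"
    by (rule summable_on_cmult_right)
  show ?thesis
    unfolding conv_def
  proof (rule wsummable_comparison(1)[OF s])
    fix \<alpha> :: "'a \<Rightarrow> nat"
    let ?c = "\<bar>mcoeff c (\<alpha> + unit_index j)\<bar>"
    have "real (\<alpha> j + 1) \<le> 2 ^ Suc (index_degree \<alpha>)"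
    proof -
      have "real (\<alpha> j + 1) \<le> real (Suc (Suc (index_degree \<alpha>)))"
        using index_le_degree[of \<alpha> j] by simp
      also have "\<dots> \<le> 2 ^ Suc (index_degree \<alpha>)" by (rule Suc_le_pow2)
      finally show ?thesis .
    qed
    then have "real (\<alpha> j + 1) * (?c * r ^ index_degree \<alpha>) \<le> 2 ^ Suc (index_degree \<alpha>) * (?c * r ^ index_degree \<alpha>)"
      using assms by (intro mult_right_mono) auto
    then show "\<bar>mcoeff (pd j c) \<alpha>\<bar> * r ^ index_degree \<alpha> \<le> 1 / r * ?f (\<alpha> + unit_index j)"
      using assms by (simp add: mcoeff_pd abs_mult power_mult_distrib mult_ac)
  qed (use assms in auto)
qed

text \<open>Monomials with arguments in the unit ball differ by at most the sum of the \<alpha> j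
  \<open>norm (Z j - W j)\<close>; the crude bound \<alpha> j \<le>
  \<open>2 ^ index_degree \<alpha>\<close> is the reason for the radius 2.\<close>

lemma psum_lipschitz:
  fixes Z W :: "'j::finite \<Rightarrow> 'a::{real_normed_algebra_1, comm_ring_1, banach}"
  assumes c: "conv 2 c" and Z: "\<And>j. norm (Z j) \<le> 1" and W: "\<And>j. norm (W j) \<le> 1"
  shows "norm (psum c Z - psum c W) \<le> wnorm (\<lambda>\<alpha>. 2 ^ index_degree \<alpha>) c * (\<Sum>j\<in>UNIV. norm (Z j - W j))"
proof -
  let ?S = "\<Sum>j\<in>UNIV. norm (Z j - W j)"
  have le: "norm (zpow Z \<alpha> - zpow W \<alpha>) \<le> 2 ^ index_degree \<alpha> * ?S" for \<alpha>
  proof -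
    have p1: "norm (x ^ n) \<le> 1" if "norm x \<le> 1" for x :: 'a and n
      by (rule order_trans[OF norm_power_ineq]) (use that in \<open>simp add: power_le_one\<close>)
    have "norm (zpow Z \<alpha> - zpow W \<alpha>) \<le> (\<Sum>j\<in>UNIV. norm (Z j ^ \<alpha> j - W j ^ \<alpha> j))"
      unfolding zpow_def using Z W by (intro norm_prod_diff p1) auto
    also have "\<dots> \<le> (\<Sum>j\<in>UNIV. real (\<alpha> j) * norm (Z j - W j))"
      by (intro sum_mono norm_power_diff Z W)
    also have "\<dots> \<le> (\<Sum>j\<in>UNIV. 2 ^ index_degree \<alpha> * norm (Z j - W j))"
    proof (intro sum_mono mult_right_mono norm_ge_zero)
      fix j
      show "real (\<alpha> j) \<le> 2 ^ index_degree \<alpha>"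
        using index_le_degree[of \<alpha> j] Suc_le_pow2[of "index_degree \<alpha>"] by linarith
    qed
    finally show ?thesis by (simp add: sum_distrib_left)
  qed
  have cs: "conv 1 c" using conv_mono[OF c] by simp
  have hs: "((\<lambda>\<alpha>. mcoeff c \<alpha> *\<^sub>R (zpow Z \<alpha> - zpow W \<alpha>)) has_sum (psum c Z - psum c W)) UNIV"
    using has_sum_add[OF psum_has_sum[OF cs[unfolded conv_def] norm_zpow_le_power[OF Z]]
         has_sum_uminusI[OF psum_has_sum[OF cs[unfolded conv_def] norm_zpow_le_power[OF W]]]]
    by (simp add: scaleR_diff_right)
  have bs: "((\<lambda>\<alpha>. \<bar>mcoeff c \<alpha>\<bar> * 2 ^ index_degree \<alpha> * ?S) has_sum (wnorm (\<lambda>\<alpha>. 2 ^ index_degree \<alpha>) c * ?S)) UNIV"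
    by (intro has_sum_cmult_left wsummable_has_sum) (use c in \<open>simp add: conv_def\<close>)
  have ns: "(\<lambda>\<alpha>. norm (mcoeff c \<alpha> *\<^sub>R (zpow Z \<alpha> - zpow W \<alpha>))) summable_on UNIV"
    by (rule summable_on_comparison_test[OF has_sum_imp_summable[OF bs]])
       (use le in \<open>auto simp: mult.assoc intro!: mult_left_mono\<close>)
  have "norm (psum c Z - psum c W) \<le> (\<Sum>\<^sub>\<infinity>\<alpha>. norm (mcoeff c \<alpha> *\<^sub>R (zpow Z \<alpha> - zpow W \<alpha>)))"
    using norm_infsum_bound[OF ns] hs by (simp add: has_sum_iff)
  also have "\<dots> \<le> (\<Sum>\<^sub>\<infinity>\<alpha>. \<bar>mcoeff c \<alpha>\<bar> * 2 ^ index_degree \<alpha> * ?S)"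
    by (rule infsum_mono[OF ns has_sum_imp_summable[OF bs]])
       (use le in \<open>auto simp: mult.assoc intro!: mult_left_mono\<close>)
  also have "\<dots> = wnorm (\<lambda>\<alpha>. 2 ^ index_degree \<alpha>) c * ?S"
    using bs by (simp add: has_sum_iff)
  finally show ?thesis .
qed

section \<open>The formal chain rule\<close>

lemma pd_power: "pd k (F ^ n) = of_nat n * F ^ (n - 1) * pd k (F::'j::finite mps)"
proof (induction n)
  case (Suc n)
  then show ?case by (cases n) (auto simp: pd_mult algebra_simps)
qed simp

lemma pd_prod: "finite A \<Longrightarrow> pd k (\<Prod>j\<in>A. F j) = (\<Sum>j\<in>A. pd k (F j) * (\<Prod>i\<in>A - {j}. F i :: 'k::finite mps))"
proof (induction A rule: finite_induct)
  case (insert x A)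
  have "(\<Sum>j\<in>A. pd k (F j) * (\<Prod>i\<in>insert x A - {j}. F i)) = F x * (\<Sum>j\<in>A. pd k (F j) * (\<Prod>i\<in>A - {j}. F i))"
    unfolding sum_distrib_left
  proof (intro sum.cong refl)
    fix j assume "j \<in> A"
    then have "insert x A - {j} = insert x (A - {j})" using insert by auto
    then show "pd k (F j) * (\<Prod>i\<in>insert x A - {j}. F i) = F x * (pd k (F j) * (\<Prod>i\<in>A - {j}. F i))"
      using insert by (simp add: mult_ac)
  qed
  then show ?case using insert by (simp add: pd_mult)
qed simp

lemma mps_of_zpow: "mps_of (zpow Z \<alpha>) = zpow (\<lambda>j. mps_of (Z j)) \<alpha>"
  by (simp add: zpow_def)

text \<open>If \<alpha> j = 0, the truncated subtraction leaves \<alpha> unchanged, but then the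
  factor \<open>real (\<alpha> j)\<close> kills the term.\<close>

lemma pd_zpow:
  fixes Z :: "'j::finite \<Rightarrow> 'k::finite mps"
  shows "pd k (zpow Z \<alpha>) = (\<Sum>j\<in>UNIV. real (\<alpha> j) *\<^sub>R (zpow Z (\<lambda>i. \<alpha> i - unit_index j i) * pd k (Z j)))"
  unfolding zpow_def
proof (subst pd_prod, simp, intro sum.cong refl)
  fix j
  have "(\<Prod>i\<in>UNIV. Z i ^ (\<alpha> i - unit_index j i)) = Z j ^ (\<alpha> j - 1) * (\<Prod>i\<in>UNIV - {j}. Z i ^ \<alpha> i)"
    by (subst prod.remove[of _ j]) (auto simp: unit_index_other intro!: prod.cong)
  then show "pd k (Z j ^ \<alpha> j) * (\<Prod>i\<in>UNIV - {j}. Z i ^ \<alpha> i)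
      = real (\<alpha> j) *\<^sub>R ((\<Prod>i\<in>UNIV. Z i ^ (\<alpha> i - unit_index j i)) * pd k (Z j))"
    by (simp add: pd_power mult_ac scaleR_conv_of_real)
qed

lemma bounded_linear_mcoeff_times: "bounded_linear (\<lambda>F. mcoeff (mps_of F * G) \<gamma>)"
  unfolding mcoeff_times case_prod_unfold
  by (intro bounded_linear_sum bounded_linear_mult_const bounded_linear_mcoeff)

lemma bounded_linear_mcoeff_pd: "bounded_linear (\<lambda>F. mcoeff (pd k (mps_of F)) \<gamma>)"
  unfolding mcoeff_pd by (intro bounded_linear_const_mult bounded_linear_mcoeff)

text \<open>The derivation \<open>pd k\<close> need not be bounded on \<open>wps\<close>, but each
  single coefficient of a derivative is a bounded functional. The infinite sum is therefore
  differentiated termwise, one coefficient at a time.\<close>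

lemma pd_psum:
  fixes Z :: "'j::finite \<Rightarrow> 'i::finite wps"
  assumes c: "conv (2 * r) c" and r: "r > 0" and Z: "\<And>j. norm (Z j) \<le> r"
  shows "pd k (mps_of (psum c Z)) = (\<Sum>j\<in>UNIV. mps_of (psum (pd j c) Z) * pd k (mps_of (Z j)))"
proof (rule mps_eqI)
  fix \<gamma>
  let ?Z = "\<lambda>j. mps_of (Z j)"
  have cr: "conv r c" using conv_mono[OF c] r by simp
  have "((\<lambda>\<alpha>. mcoeff (pd k (mps_of (mcoeff c \<alpha> *\<^sub>R zpow Z \<alpha>))) \<gamma>) has_sum
      mcoeff (pd k (mps_of (psum c Z))) \<gamma>) UNIV"
    by (rule has_sum_bounded_linear[OF bounded_linear_mcoeff_pd
          psum_has_sum[OF cr[unfolded conv_def] norm_zpow_le_power[OF Z]]])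
  then have L: "((\<lambda>\<alpha>. mcoeff c \<alpha> * mcoeff (pd k (zpow ?Z \<alpha>)) \<gamma>) has_sum
      mcoeff (pd k (mps_of (psum c Z))) \<gamma>) UNIV"
    by (simp add: mps_of_zpow)
  have R: "((\<lambda>\<alpha>. mcoeff c \<alpha> * (real (\<alpha> j) * mcoeff (zpow ?Z (\<lambda>i. \<alpha> i - unit_index j i) * pd k (?Z j)) \<gamma>))
      has_sum mcoeff (mps_of (psum (pd j c) Z) * pd k (?Z j)) \<gamma>) UNIV" (is "(?g has_sum ?s) UNIV") for j
  proof -
    have "((\<lambda>\<alpha>. mcoeff (mps_of (mcoeff (pd j c) \<alpha> *\<^sub>R zpow Z \<alpha>) * pd k (?Z j)) \<gamma>) has_sum ?s) UNIV"
      by (rule has_sum_bounded_linear[OF bounded_linear_mcoeff_times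
            psum_has_sum[OF conv_pd[OF c r, unfolded conv_def] norm_zpow_le_power[OF Z]]])
    moreover have "mcoeff (mps_of (mcoeff (pd j c) \<alpha> *\<^sub>R zpow Z \<alpha>) * pd k (?Z j)) \<gamma> = ?g (\<alpha> + unit_index j)" for \<alpha>
      by (simp add: mps_of_zpow mcoeff_pd)
    ultimately have "((?g \<circ> (\<lambda>\<alpha>. \<alpha> + unit_index j)) has_sum ?s) UNIV"
      by (simp add: o_def)
    moreover have "inj (\<lambda>\<alpha>::'j \<Rightarrow> nat. \<alpha> + unit_index j)"
      by (auto simp: inj_def)
    ultimately have "(?g has_sum ?s) (range (\<lambda>\<alpha>. \<alpha> + unit_index j))"
      by (simp add: has_sum_reindex)
    moreover have "?g \<alpha> = 0" if "\<alpha> \<notin> range (\<lambda>\<alpha>. \<alpha> + unit_index j)" for \<alpha>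
    proof -
      have "\<alpha> j = 0" using that index_split[of \<alpha> j] by blast
      then show ?thesis by simp
    qed
    ultimately show ?thesis
      by (elim has_sum_cong_neutral[where S = "range (\<lambda>\<alpha>. \<alpha> + unit_index j)" and f = ?g, THEN iffD1, rotated -1]) simp_all
  qed
  have "((\<lambda>\<alpha>. \<Sum>j\<in>UNIV. mcoeff c \<alpha> * (real (\<alpha> j) * mcoeff (zpow ?Z (\<lambda>i. \<alpha> i - unit_index j i) * pd k (?Z j)) \<gamma>))
      has_sum (\<Sum>j\<in>UNIV. mcoeff (mps_of (psum (pd j c) Z) * pd k (?Z j)) \<gamma>)) UNIV"
    by (intro has_sum_sum R)
  also have "(\<lambda>\<alpha>. \<Sum>j\<in>UNIV. mcoeff c \<alpha> * (real (\<alpha> j) * mcoeff (zpow ?Z (\<lambda>i. \<alpha> i - unit_index j i) * pd k (?Z j)) \<gamma>))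
     = (\<lambda>\<alpha>. mcoeff c \<alpha> * mcoeff (pd k (zpow ?Z \<alpha>)) \<gamma>)"
    unfolding pd_zpow mcoeff_sum mcoeff_simps sum_distrib_left ..
  finally show "mcoeff (pd k (mps_of (psum c Z))) \<gamma>
      = mcoeff (\<Sum>j\<in>UNIV. mps_of (psum (pd j c) Z) * pd k (mps_of (Z j))) \<gamma>"
    unfolding mcoeff_sum by (rule has_sum_unique[OF L])
qed

section \<open>Evaluation and re-expansion\<close>

definition wev :: "('i::finite option \<Rightarrow> real) \<Rightarrow> 'i wps \<Rightarrow> real" where
  "wev z F = psum (mps_of F) z"

lemma zpow_half_le:
  assumes "\<And>j. \<bar>z j\<bar> \<le> 1/2" shows "norm (zpow z \<alpha> :: real) \<le> cwt \<alpha>"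
  using norm_zpow_le_power[of z "1/2" \<alpha>] assms cwt_ge[of \<alpha>] by auto

lemma conv_half: "conv (1/2) (mps_of F)"
  unfolding conv_def
  by (rule wsummable_comparison(1)[OF wsummable_mps_of[of F, unfolded wsummable_def]])
     (auto intro!: mult_left_mono cwt_ge)

context
  fixes z :: "'i::finite option \<Rightarrow> real"
  assumes z: "\<And>j. \<bar>z j\<bar> \<le> 1/2"
begin

lemma wev_has_sum: "((\<lambda>\<alpha>. mcoeff (mps_of F) \<alpha> * zpow z \<alpha>) has_sum wev z F) UNIV"
  using psum_has_sum[OF wsummable_mps_of zpow_half_le[OF z], of F] by (simp add: wev_def)

lemma abs_wev_le: "\<bar>wev z F\<bar> \<le> norm F"
  using norm_psum_le[OF wsummable_mps_of zpow_half_le[OF z], of F] by (simp add: wev_def norm_wps_def)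

lemma wev_add: "wev z (F + G) = wev z F + wev z G"
  and wev_diff: "wev z (F - G) = wev z F - wev z G"
  and wev_scaleR: "wev z (r *\<^sub>R F) = r * wev z F"
  and wev_times: "wev z (F * G) = wev z F * wev z G"
  and wev_0: "wev z 0 = 0"
  and wev_1: "wev z 1 = 1"
  and wev_wvar: "wev z (wvar j) = z j"
  unfolding wev_def
  by (simp_all add: psum_add[OF zpow_half_le[OF z]] psum_diff[OF zpow_half_le[OF z]]
    psum_scaleR[OF zpow_half_le[OF z]] psum_times[OF zpow_half_le[OF z]])

lemma wev_sum: "wev z (sum F A) = (\<Sum>x\<in>A. wev z (F x))"
  by (induction A rule: infinite_finite_induct) (auto simp: wev_0 wev_add)

lemma bounded_linear_wev: "bounded_linear (wev z)"
  by (rule bounded_linear_intro[of _ 1]) (use abs_wev_le in \<open>auto simp: wev_add wev_scaleR\<close>)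

lemma wev_psum:
  assumes "conv r c" "\<And>j. norm (Z j) \<le> r"
  shows "wev z (psum c Z) = psum c (\<lambda>j. wev z (Z j))"
  by (rule psum_bounded_hom[OF bounded_linear_wev _ _ assms(1)[unfolded conv_def]])
     (auto simp: wev_times wev_1 intro!: norm_zpow_le_power assms)

end

lemma mcoeff_0_psum:
  assumes "conv r c" "\<And>j. norm (Z j) \<le> r"
  shows "mcoeff (mps_of (psum c Z)) 0 = psum c (\<lambda>j. mcoeff (mps_of (Z j)) 0)"
  by (rule psum_bounded_hom[OF bounded_linear_mcoeff _ _ assms(1)[unfolded conv_def]])
     (auto simp: mcoeff_times_0 intro!: norm_zpow_le_power assms)

text \<open>Only monomials of degree at least 2 occur: two factors m are kept, the others are
  estimated by 1/2. The constant 4 completes these to \<open>(1/2) ^ index_degree \<alpha>\<close>,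
  which is at most \<open>cwt \<alpha>\<close>.\<close>

lemma abs_wev_second_order:
  assumes G: "\<And>\<alpha>. index_degree \<alpha> \<le> 1 \<Longrightarrow> mcoeff (mps_of G) \<alpha> = 0"
    and z: "\<And>j. \<bar>z j\<bar> \<le> m" and m: "m \<le> 1/2"
  shows "\<bar>wev z G\<bar> \<le> 4 * m\<^sup>2 * norm G"
proof -
  have m0: "0 \<le> m" using z[of None] by simp
  have z': "\<bar>z j\<bar> \<le> 1/2" for j using z[of j] m by simp
  have le: "\<bar>mcoeff (mps_of G) \<alpha> * zpow z \<alpha>\<bar> \<le> 4 * m\<^sup>2 * (\<bar>mcoeff (mps_of G) \<alpha>\<bar> * cwt \<alpha>)" for \<alpha>
  proof (cases "index_degree \<alpha> \<le> 1")
    case False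
    then obtain k where k: "index_degree \<alpha> = 2 + k" by (metis Suc_1 add_Suc less_eqE not_less_eq_eq plus_1_eq_Suc)
    have "\<bar>zpow z \<alpha>\<bar> \<le> m ^ index_degree \<alpha>"
      using norm_zpow_le_power[of z m \<alpha>] z by simp
    also have "\<dots> = m\<^sup>2 * m ^ k" by (simp only: k power_add)
    also have "\<dots> \<le> m\<^sup>2 * (1/2) ^ k"
      using m m0 by (intro mult_left_mono power_mono) auto
    also have "\<dots> = 4 * m\<^sup>2 * (1/2) ^ index_degree \<alpha>"
      by (simp add: k power_add power2_eq_square)
    also have "\<dots> \<le> 4 * m\<^sup>2 * cwt \<alpha>"
      by (intro mult_left_mono cwt_ge) auto
    finally show ?thesis
      by (simp add: abs_mult mult.left_commute mult_left_mono)
  qed (simp add: G)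
  have s: "((\<lambda>\<alpha>. 4 * m\<^sup>2 * (\<bar>mcoeff (mps_of G) \<alpha>\<bar> * cwt \<alpha>)) has_sum (4 * m\<^sup>2 * norm G)) UNIV"
    unfolding norm_wps_def by (intro has_sum_cmult_right wsummable_has_sum) simp
  show ?thesis
  proof (rule abs_leI)
    show "wev z G \<le> 4 * m\<^sup>2 * norm G"
      by (rule has_sum_mono[OF wev_has_sum[OF z'] s]) (use le in \<open>auto simp: abs_le_iff\<close>)
    show "- wev z G \<le> 4 * m\<^sup>2 * norm G"
      by (rule has_sum_mono[OF has_sum_uminusI[OF wev_has_sum[OF z']] s])
         (use le in \<open>auto simp: abs_le_iff\<close>)
  qed
qed

section \<open>Differentiation, identity theorem and change of centre\<close>

text \<open>Taylor's formula with quadratic remainder, obtained without rearranging series: z plus a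
  multiple of the variables is substituted into c, and the remainder is the value of the resulting
  element of \<open>wps\<close> after removal of its terms of degree at most 1.\<close>

lemma psum_second_order:
  assumes c: "conv r c" and z: "\<And>j. \<bar>z j\<bar> < r / 2"
  shows "\<exists>K. \<exists>\<delta>>0. \<forall>h m. (\<forall>j. \<bar>h j\<bar> \<le> m) \<longrightarrow> m \<le> \<delta> \<longrightarrow>
      \<bar>psum c (\<lambda>j. z j + h j) - psum c z - (\<Sum>j\<in>UNIV. psum (pd j c) z * h j)\<bar> \<le> K * m\<^sup>2"
proof -
  \<comment> \<open>The distance from z to the boundary of the polydisc of radius r/2. The arguments
    \<open>Z\<close> then have norm at most r/2, as \<open>pd_psum\<close> requires.\<close>
  define l where "l = Min (range (\<lambda>j. r / 2 - \<bar>z j\<bar>))"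
  have l: "0 < l" and zl: "\<bar>z j\<bar> + l \<le> r / 2" for j
  proof -
    show "0 < l" unfolding l_def using z by (subst Min_gr_iff) auto
    have "l \<le> r / 2 - \<bar>z j\<bar>" unfolding l_def by (intro Min_le) auto
    then show "\<bar>z j\<bar> + l \<le> r / 2" by simp
  qed
  have r: "0 < r" using zl[of undefined] l abs_ge_zero[of "z undefined"] by linarith
  define Z where "Z = (\<lambda>j. z j *\<^sub>R 1 + l *\<^sub>R wvar (Some j))"
  have nZ: "norm (Z j) \<le> r / 2" for j
    unfolding Z_def using norm_triangle_ineq[of "z j *\<^sub>R 1" "l *\<^sub>R wvar (Some j)"] zl[of j] l by simp
  have c': "conv (2 * (r / 2)) c" using c by simp
  have cpd: "conv (r / 2) (pd j c)" for j
    using conv_pd[OF c'] r by simp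
  have cr: "conv (r / 2) c" using conv_mono[OF c] r by simp
  define F where "F = psum c Z"
  have Z0: "mcoeff (mps_of (Z j)) 0 = z j" for j
    by (simp add: Z_def mcoeff_mvar)
  have F0: "mcoeff (mps_of F) 0 = psum c z"
    unfolding F_def using mcoeff_0_psum[OF cr nZ] by (simp add: Z0)
  have Zpd: "pd (Some j) (mps_of (Z k)) = (if j = k then l *\<^sub>R 1 else 0)" for j k
    by (simp add: Z_def pd_mvar)
  have F1: "mcoeff (mps_of F) (unit_index (Some j)) = l * psum (pd j c) z" for j
  proof -
    have "mcoeff (mps_of F) (unit_index (Some j)) = mcoeff (pd (Some j) (mps_of F)) 0"
      by (simp add: mcoeff_pd)
    also have "pd (Some j) (mps_of F) = (\<Sum>k\<in>UNIV. mps_of (psum (pd k c) Z) * pd (Some j) (mps_of (Z k)))"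
      unfolding F_def using r by (intro pd_psum[OF c' _ nZ]) auto
    also have "\<dots> = l *\<^sub>R mps_of (psum (pd j c) Z)"
      by (simp add: Zpd if_distrib cong: if_cong)
    finally have "mcoeff (mps_of F) (unit_index (Some j)) = l * mcoeff (mps_of (psum (pd j c) Z)) 0"
      by (simp only: mcoeff_simps)
    then show ?thesis
      unfolding mcoeff_0_psum[of "r / 2" "pd j c" Z, OF cpd nZ] Z0 .
  qed
  define G where "G = F - mcoeff (mps_of F) 0 *\<^sub>R 1
      - (\<Sum>j\<in>UNIV. mcoeff (mps_of F) (unit_index j) *\<^sub>R wvar j)"
  have G: "mcoeff (mps_of G) \<alpha> = 0" if "index_degree \<alpha> \<le> 1" for \<alpha>
  proof (cases "\<alpha> = 0")
    case True
    have "(0 :: 'a option \<Rightarrow> nat) \<noteq> unit_index j" for j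
      using unit_index_neq_0[of j] by (rule not_sym)
    with True show ?thesis by (simp add: G_def mcoeff_mvar)
  next
    case False
    then obtain i where "\<alpha> i \<noteq> 0" by (auto simp: fun_eq_iff)
    then obtain \<beta> where "\<alpha> = \<beta> + unit_index i" by (rule index_split)
    with that have a: "\<alpha> = unit_index i" by simp
    have "unit_index i = unit_index j \<longleftrightarrow> i = j" for j :: "'a option"
      by (metis unit_index_other unit_index_same zero_neq_one)
    with a show ?thesis by (simp add: G_def mcoeff_mvar if_distrib cong: if_cong)
  qed
  have main: "\<bar>psum c (\<lambda>j. z j + h j) - psum c z - (\<Sum>j\<in>UNIV. psum (pd j c) z * h j)\<bar> \<le> 4 * norm G / l\<^sup>2 * m\<^sup>2"
    if h: "\<And>j. \<bar>h j\<bar> \<le> m" and m: "m \<le> l / 2" for h m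
  proof -
    define \<zeta> where "\<zeta> = case_option 0 (\<lambda>j. h j / l)"
    have m0: "0 \<le> m" using h[of undefined] by simp
    have \<zeta>m: "\<bar>\<zeta> j\<bar> \<le> m / l" for j
      using h l m0 by (auto simp: \<zeta>_def divide_right_mono split: option.splits)
    have ml: "m / l \<le> 1/2" using m l by (simp add: field_simps)
    have \<zeta>h: "\<bar>\<zeta> j\<bar> \<le> 1/2" for j using order_trans[OF \<zeta>m ml] .
    note ev = wev_add[OF \<zeta>h] wev_diff[OF \<zeta>h] wev_scaleR[OF \<zeta>h] wev_1[OF \<zeta>h] wev_wvar[OF \<zeta>h] wev_sum[OF \<zeta>h]
    have "wev \<zeta> F = psum c (\<lambda>j. z j + h j)"
      unfolding F_def using wev_psum[OF \<zeta>h cr nZ] l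
      by (simp add: Z_def ev) (simp add: \<zeta>_def)
    moreover have "wev \<zeta> G = wev \<zeta> F - psum c z - (\<Sum>j\<in>UNIV. psum (pd j c) z * h j)"
      unfolding G_def ev F0 UNIV_option_conv using l
      by (subst sum.insert) (auto simp: sum.reindex F1, auto simp: \<zeta>_def)
    ultimately have "\<bar>psum c (\<lambda>j. z j + h j) - psum c z - (\<Sum>j\<in>UNIV. psum (pd j c) z * h j)\<bar> = \<bar>wev \<zeta> G\<bar>"
      by simp
    also have "\<dots> \<le> 4 * (m / l)\<^sup>2 * norm G"
      by (rule abs_wev_second_order[OF G \<zeta>m ml])
    finally show ?thesis by (simp add: power_divide mult_ac)
  qed
  show ?thesis
    by (rule exI[of _ "4 * norm G / l\<^sup>2"], rule exI[of _ "l / 2"]) (use l main in auto)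
qed

lemma has_derivative_vec:
  fixes g :: "'j::finite \<Rightarrow> 'a::real_normed_vector \<Rightarrow> real"
  assumes "\<And>j. (g j has_derivative g' j) (at x within S)"
  shows "((\<lambda>x. \<chi> j. g j x) has_derivative (\<lambda>h. \<chi> j. g' j h)) (at x within S)"
  unfolding has_derivative_componentwise_within[of "\<lambda>x. \<chi> j. g j x"]
  using assms by (auto simp: Basis_vec_def inner_axis)

lemma has_derivative_psum_vec:
  assumes c: "conv r c" and z: "\<And>j. \<bar>z $ j\<bar> < r / 2"
  shows "((\<lambda>x::real^'j. psum c (\<lambda>j. x $ j)) has_derivative
      (\<lambda>h. \<Sum>j\<in>UNIV. psum (pd j c) (\<lambda>j. z $ j) * h $ j)) (at z)"
  unfolding has_derivative_at_alt
proof (intro conjI allI impI)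
  show "bounded_linear (\<lambda>h. \<Sum>j\<in>UNIV. psum (pd j c) (\<lambda>j. z $ j) * h $ j)"
    by (intro bounded_linear_sum bounded_linear_const_mult bounded_linear_vec_nth)
  fix e :: real assume e: "e > 0"
  obtain K \<delta> where \<delta>: "\<delta> > 0" and K: "\<forall>h m. (\<forall>j. \<bar>h j\<bar> \<le> m) \<longrightarrow> m \<le> \<delta> \<longrightarrow>
      \<bar>psum c (\<lambda>j. z $ j + h j) - psum c (\<lambda>j. z $ j) - (\<Sum>j\<in>UNIV. psum (pd j c) (\<lambda>j. z $ j) * h j)\<bar> \<le> K * m\<^sup>2"
    using psum_second_order[of r c "\<lambda>j. z $ j", OF c z] by blast
  show "\<exists>d>0. \<forall>y. norm (y - z) < d \<longrightarrow>
      norm (psum c (\<lambda>j. y $ j) - psum c (\<lambda>j. z $ j) - (\<Sum>j\<in>UNIV. psum (pd j c) (\<lambda>j. z $ j) * (y - z) $ j))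
      \<le> e * norm (y - z)"
  proof (intro exI[of _ "min \<delta> (e / (\<bar>K\<bar> + 1))"] conjI allI impI)
    show "0 < min \<delta> (e / (\<bar>K\<bar> + 1))" using \<delta> e by simp
    fix y assume y: "norm (y - z) < min \<delta> (e / (\<bar>K\<bar> + 1))"
    have "norm (psum c (\<lambda>j. y $ j) - psum c (\<lambda>j. z $ j) - (\<Sum>j\<in>UNIV. psum (pd j c) (\<lambda>j. z $ j) * (y - z) $ j))
        \<le> K * (norm (y - z))\<^sup>2"
      using K[rule_format, of "\<lambda>j. (y - z) $ j" "norm (y - z)"] y component_le_norm_cart[of "y - z"] by simp
    also have "\<dots> \<le> (\<bar>K\<bar> + 1) * (norm (y - z))\<^sup>2"
      by (intro mult_right_mono) auto
    also have "\<dots> \<le> e * norm (y - z)"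
    proof -
      have "(\<bar>K\<bar> + 1) * norm (y - z) \<le> e"
        using y by (simp add: field_simps)
      then show ?thesis
        using mult_right_mono[OF _ norm_ge_zero[of "y - z"]] by (simp add: power2_eq_square mult.assoc[symmetric])
    qed
    finally show "norm (psum c (\<lambda>j. y $ j) - psum c (\<lambda>j. z $ j) - (\<Sum>j\<in>UNIV. psum (pd j c) (\<lambda>j. z $ j) * (y - z) $ j))
      \<le> e * norm (y - z)" .
  qed
qed

lemma has_derivative_psum:
  fixes g :: "'j::finite \<Rightarrow> 'a::real_normed_vector \<Rightarrow> real"
  assumes "conv r c" "\<And>j. \<bar>g j x\<bar> < r / 2" "\<And>j. (g j has_derivative g' j) (at x within S)"
  shows "((\<lambda>x. psum c (\<lambda>j. g j x)) has_derivative (\<lambda>h. \<Sum>j\<in>UNIV. psum (pd j c) (\<lambda>j. g j x) * g' j h)) (at x within S)"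
  using has_derivative_compose[OF has_derivative_vec[of g g', OF assms(3)]
      has_derivative_psum_vec[of r c "\<chi> j. g j x"]] assms(1,2) by simp

text \<open>Induction on the degree: a function vanishing near 0 has derivatives vanishing near 0,
  so the hypothesis passes to \<open>pd j c\<close> on a smaller polydisc. Hence the series and both
  radii vary in the induction.\<close>

lemma psum_eq_0_imp_eq_0:
  fixes c :: "'j::finite mps"
  assumes "conv r c" "\<delta> > 0" "r > 0" "\<And>z :: 'j \<Rightarrow> real. (\<And>j. \<bar>z j\<bar> < \<delta>) \<Longrightarrow> psum c z = 0"
  shows "c = 0"
proof -
  have "mcoeff c \<alpha> = 0" if "index_degree \<alpha> = n" for n \<alpha>
    using assms that
  proof (induction n arbitrary: c r \<delta> \<alpha>)
    case 0
    then have "psum c (\<lambda>_. 0 :: real) = 0" by simp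
    then have "mcoeff c 0 = 0" by (simp add: psum_at_0)
    moreover have "\<alpha> = 0" using 0 by simp
    ultimately show ?case by (simp only:)
  next
    case (Suc n)
    have "\<alpha> \<noteq> 0" using Suc.prems(5) by (metis index_degree_0 nat.distinct(1))
    then obtain j where "\<alpha> j \<noteq> 0" by (auto simp: fun_eq_iff)
    then obtain \<beta> where \<beta>: "\<alpha> = \<beta> + unit_index j" by (rule index_split)
    define \<epsilon> where "\<epsilon> = min \<delta> (r / 2)"
    have \<epsilon>: "0 < \<epsilon>" using Suc by (simp add: \<epsilon>_def)
    have op: "open {v::real^'j. \<forall>j. \<bar>v $ j\<bar> < \<epsilon>}"
    proof -
      have "open {v::real^'j. \<bar>v $ j\<bar> < \<epsilon>}" for j
        by (intro open_Collect_less continuous_intros)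
      then show ?thesis by (simp add: Collect_all_eq open_INT)
    qed
    have z: "psum (pd j c) z = 0" if zz: "\<And>j. \<bar>z j\<bar> < \<epsilon>" for z :: "'j \<Rightarrow> real"
    proof -
      let ?z = "(\<chi> j. z j) :: real^'j"
      have "((\<lambda>x::real^'j. psum c (\<lambda>j. x $ j)) has_derivative
          (\<lambda>h. \<Sum>j\<in>UNIV. psum (pd j c) (\<lambda>j. ?z $ j) * h $ j)) (at ?z)"
        using zz by (intro has_derivative_psum_vec[OF Suc.prems(1)]) (auto simp: \<epsilon>_def)
      moreover have "((\<lambda>x::real^'j. psum c (\<lambda>j. x $ j)) has_derivative (\<lambda>h. 0)) (at ?z)"
        by (rule has_derivative_transform_within_open[OF has_derivative_const[of 0] op])
           (use zz Suc.prems(4) in \<open>auto simp: \<epsilon>_def\<close>)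
      ultimately have "(\<lambda>h. \<Sum>j\<in>UNIV. psum (pd j c) (\<lambda>j. ?z $ j) * h $ j) = (\<lambda>h. 0)"
        by (rule has_derivative_unique)
      from fun_cong[OF this, of "axis j 1"] show ?thesis
        by (simp add: axis_def if_distrib cong: if_cong)
    qed
    have "index_degree (\<beta> + unit_index j) = Suc n" using Suc.prems(5) \<beta> by (simp only:)
    then have "index_degree \<beta> = n" by simp
    then have "mcoeff (pd j c) \<beta> = 0"
      using Suc.prems(1,3) \<epsilon> z by (intro Suc.IH[of "r / 2" "pd j c" \<epsilon>] conv_pd) simp_all
    then have "mcoeff c (\<beta> + unit_index j) = 0" by (simp add: mcoeff_pd)
    then show ?case using \<beta> by (simp only:)
  qed
  then show ?thesis by (intro mps_eqI) simp
qed

section \<open>Change of the centre of expansion\<close>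

definition drop_None :: "'j::finite wps \<Rightarrow> 'j mps" where
  "drop_None F = Abs_mps (\<lambda>\<alpha>. mcoeff (mps_of F) (case_option 0 \<alpha>))"

lemma index_degree_case_option: "index_degree (case_option n \<alpha>) = n + index_degree (\<alpha>::'j::finite \<Rightarrow> nat)"
  by (simp add: index_degree_option time_degree_def index_degree_def)

lemma range_case_option_0: "range (case_option 0) = {\<beta>::'j option \<Rightarrow> nat. \<beta> None = 0}"
proof (intro set_eqI iffI)
  fix \<beta> :: "'j option \<Rightarrow> nat" assume "\<beta> \<in> {\<beta>. \<beta> None = 0}"
  then have "\<beta> = case_option 0 (\<beta> \<circ> Some)"
    by (auto simp: fun_eq_iff split: option.splits)
  then show "\<beta> \<in> range (case_option 0)" by blast
qed auto

lemma inj_case_option_0: "inj (case_option (0::nat) :: ('j \<Rightarrow> nat) \<Rightarrow> _)"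
proof (rule injI, rule ext)
  fix \<alpha> \<beta> :: "'j \<Rightarrow> nat" and j
  assume "case_option 0 \<alpha> = case_option (0::nat) \<beta>"
  from fun_cong[OF this, of "Some j"] show "\<alpha> j = \<beta> j" by simp
qed

lemma conv_drop_None: "conv (1/2) (drop_None F)"
proof -
  have "(\<lambda>\<alpha>. \<bar>mcoeff (mps_of F) \<alpha>\<bar> * (1/2) ^ index_degree \<alpha>) summable_on range (case_option 0)"
    using conv_half[of F] unfolding conv_def wsummable_def by (rule summable_on_subset_banach) auto
  then show ?thesis
    unfolding summable_on_reindex[OF inj_case_option_0]
    by (simp add: conv_def wsummable_def drop_None_def o_def index_degree_case_option)
qed

lemma zpow_option: "zpow (z :: 'j::finite option \<Rightarrow> 'a::comm_monoid_mult) \<alpha> = z None ^ \<alpha> None * zpow (z \<circ> Some) (\<alpha> \<circ> Some)"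
  unfolding zpow_def UNIV_option_conv by (subst prod.insert) (auto simp: prod.reindex)

lemma psum_drop_None:
  assumes "\<And>j. \<bar>z j\<bar> \<le> 1/2"
  shows "psum (drop_None F) z = wev (case_option 0 z) F"
proof (rule psum_eqI)
  let ?g = "\<lambda>\<beta>. mcoeff (mps_of F) \<beta> * zpow (case_option 0 z) \<beta>"
  have "(?g has_sum wev (case_option 0 z) F) UNIV"
    by (rule wev_has_sum) (use assms in \<open>auto split: option.splits\<close>)
  moreover have "?g \<beta> = 0" if "\<beta> \<notin> range (case_option 0)" for \<beta>
    using that by (simp add: range_case_option_0 zpow_option power_0_left)
  ultimately have "(?g has_sum wev (case_option 0 z) F) (range (case_option 0))"
    by (elim has_sum_cong_neutral[where T = UNIV and g = ?g, THEN iffD2, rotated -1]) simp_all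
  then show "((\<lambda>\<alpha>. mcoeff (drop_None F) \<alpha> *\<^sub>R zpow z \<alpha>) has_sum wev (case_option 0 z) F) UNIV"
    by (simp add: has_sum_reindex[OF inj_case_option_0] o_def drop_None_def zpow_option)
qed

text \<open>Substituting q plus l times the variables in the algebra replaces the binomial
  re-expansion; the new coefficients are read off from the result. The radius l/2 is the evaluation
  radius 1/2 in units of l.\<close>

lemma psum_recenter:
  fixes c :: "'j::finite mps" and q :: "'j \<Rightarrow> real"
  assumes c: "conv r c" and l: "l > 0" and q: "\<And>j. \<bar>q j\<bar> + l \<le> r"
  obtains d where "conv (l / 2) d"
    "\<And>z. (\<And>j. \<bar>z j\<bar> \<le> l / 2) \<Longrightarrow> psum c (\<lambda>j. q j + z j) = psum d z"
proof -
  define Z where "Z = (\<lambda>j. q j *\<^sub>R 1 + l *\<^sub>R wvar (Some j))"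
  have nZ: "norm (Z j) \<le> r" for j
    unfolding Z_def using norm_triangle_ineq[of "q j *\<^sub>R 1" "l *\<^sub>R wvar (Some j)"] q[of j] l by simp
  define F where "F = psum c Z"
  define d where "d = rescale (1 / l) (drop_None F)"
  have "conv (l / 2) d"
    unfolding d_def conv_rescale using conv_drop_None[of F] l by simp
  moreover have "psum c (\<lambda>j. q j + z j) = psum d z" if z: "\<And>j. \<bar>z j\<bar> \<le> l / 2" for z
  proof -
    have "psum d z = psum (drop_None F) (\<lambda>j. (1 / l) *\<^sub>R z j)"
      unfolding d_def by (rule psum_rescale)
    also have "\<dots> = wev (case_option 0 (\<lambda>j. (1 / l) *\<^sub>R z j)) F"
      by (rule psum_drop_None) (use z l in \<open>auto simp: field_simps\<close>)
    also have "\<dots> = psum c (\<lambda>j. q j + z j)"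
    proof -
      have h: "\<bar>case_option 0 (\<lambda>j. (1 / l) *\<^sub>R z j) j\<bar> \<le> 1/2" for j
        using z l by (auto simp: field_simps split: option.splits)
      show ?thesis
        unfolding F_def wev_psum[OF h c nZ] using l
        by (simp add: Z_def wev_add[OF h] wev_scaleR[OF h] wev_1[OF h] wev_wvar[OF h])
    qed
    finally show ?thesis by simp
  qed
  ultimately show ?thesis by (rule that)
qed

section \<open>Real analytic functions\<close>

context
  fixes r :: real and Z :: "'j::finite \<Rightarrow> 'a::{real_normed_algebra_1, comm_ring_1, banach}"
  assumes Z: "\<And>j. norm (Z j) \<le> r"
begin

lemma conv_psum_add: "conv r c \<Longrightarrow> conv r d \<Longrightarrow> psum (c + d) Z = psum c Z + psum d Z"
  and conv_psum_diff: "conv r c \<Longrightarrow> conv r d \<Longrightarrow> psum (c - d) Z = psum c Z - psum d Z"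
  and conv_psum_times: "conv r c \<Longrightarrow> conv r d \<Longrightarrow> psum (c * d) Z = psum c Z * psum d Z"
  and conv_psum_scaleR: "conv r c \<Longrightarrow> psum (s *\<^sub>R c) Z = s *\<^sub>R psum c Z"
  and conv_psum_has_sum: "conv r c \<Longrightarrow> ((\<lambda>\<alpha>. mcoeff c \<alpha> *\<^sub>R zpow Z \<alpha>) has_sum psum c Z) UNIV"
  unfolding conv_def
  by (rule psum_add psum_diff psum_times psum_scaleR psum_has_sum; (rule norm_zpow_le_power[OF Z])?; assumption)+

end

text \<open>Polydiscs in place of balls match the domain of convergence expressed by
  \<open>conv\<close>.\<close>

definition series_at :: "(real ^ 'n \<Rightarrow> real) \<Rightarrow> real ^ 'n \<Rightarrow> real \<Rightarrow> 'n mps \<Rightarrow> bool" where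
  "series_at f p r c \<longleftrightarrow> r > 0 \<and> conv r c \<and> (\<forall>v. (\<forall>j. \<bar>v $ j\<bar> \<le> r) \<longrightarrow> f (p + v) = psum c (\<lambda>j. v $ j))"

definition analytic_at :: "(real ^ 'n \<Rightarrow> real) \<Rightarrow> real ^ 'n \<Rightarrow> bool" where
  "analytic_at f p \<longleftrightarrow> (\<exists>r c. series_at f p r c)"

lemma series_at_mono: "series_at f p r c \<Longrightarrow> 0 < s \<Longrightarrow> s \<le> r \<Longrightarrow> series_at f p s c"
  unfolding series_at_def using conv_mono[of r c s] by (auto dest: order_trans)

text \<open>Monomials indexed by \<open>Basis\<close> become monomials over a finite index type. A
  general b serves both \<open>real ^ 'n\<close> and, with index type \<open>unit\<close>, the
  initial curve; the functional k selects a component.\<close>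

lemma real_analytic_on_expansion:
  fixes f :: "'a::euclidean_space \<Rightarrow> 'b::real_normed_vector" and b :: "'j::finite \<Rightarrow> 'a"
  assumes f: "real_analytic_on f S" and p: "p \<in> S" and k: "bounded_linear k"
    and b: "bij_betw b UNIV Basis"
  obtains r c where "r > 0" "conv r c"
    "\<And>v. (\<And>j. \<bar>v \<bullet> b j\<bar> \<le> r) \<Longrightarrow> k (f (p + v)) = psum c (\<lambda>j. v \<bullet> b j)"
proof -
  obtain R C where R: "R > 0" and C: "\<And>x. x \<in> ball p R \<Longrightarrow>
      ((\<lambda>\<alpha>. (\<Prod>b\<in>Basis. ((x - p) \<bullet> b) ^ \<alpha> b) *\<^sub>R C \<alpha>) has_sum f x) (Basis \<rightarrow>\<^sub>E (UNIV :: nat set))"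
    using f p unfolding real_analytic_on_def by metis
  define T where "T \<alpha> = restrict (\<alpha> \<circ> inv_into UNIV b) Basis" for \<alpha> :: "'j \<Rightarrow> nat"
  have binv: "inv_into UNIV b (b j) = j" for j
    using b by (simp add: bij_betw_def)
  have binv2: "b (inv_into UNIV b x) = x" if "x \<in> Basis" for x
    using b that by (metis bij_betw_def f_inv_into_f)
  have bB: "b j \<in> Basis" for j using b by (auto simp: bij_betw_def)
  define c where "c = Abs_mps (\<lambda>\<alpha>. k (C (T \<alpha>)))"
  have cs: "((\<lambda>\<alpha>. mcoeff c \<alpha> * zpow (\<lambda>j. v \<bullet> b j) \<alpha>) has_sum k (f (p + v))) UNIV" if v: "norm v < R" for v
  proof -
    have "p + v \<in> ball p R" using v by (simp add: dist_norm)
    from has_sum_bounded_linear[OF k C[OF this]]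
    have "((\<lambda>\<alpha>. k ((\<Prod>b\<in>Basis. (v \<bullet> b) ^ \<alpha> b) *\<^sub>R C \<alpha>)) has_sum k (f (p + v))) (Basis \<rightarrow>\<^sub>E UNIV)"
      by simp
    then have "((\<lambda>\<alpha>. k ((\<Prod>b\<in>Basis. (v \<bullet> b) ^ T \<alpha> b) *\<^sub>R C (T \<alpha>))) has_sum k (f (p + v))) UNIV"
      by (subst has_sum_reindex_bij_witness[where j = T and i = "\<lambda>\<beta>. \<beta> \<circ> b" and T = "Basis \<rightarrow>\<^sub>E UNIV"
            and h = "\<lambda>\<alpha>. k ((\<Prod>b\<in>Basis. (v \<bullet> b) ^ \<alpha> b) *\<^sub>R C \<alpha>)" and s' = "k (f (p + v))"])
         (auto simp: T_def fun_eq_iff binv binv2 bB PiE_def extensional_def)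
    moreover have "(\<Prod>b\<in>Basis. (v \<bullet> b) ^ T \<alpha> b) = zpow (\<lambda>j. v \<bullet> b j) \<alpha>" for \<alpha>
      unfolding zpow_def prod.reindex_bij_betw[OF b, symmetric] by (simp add: T_def bB binv)
    ultimately show ?thesis
      by (simp add: c_def linear_scale[OF bounded_linear.linear[OF k]] mult.commute)
  qed
  define r where "r = R / (2 * DIM('a))"
  have r: "r > 0" using R by (simp add: r_def)
  have small: "norm v < R" if "\<And>j. \<bar>v \<bullet> b j\<bar> \<le> r" for v
  proof -
    have "norm v \<le> (\<Sum>x\<in>Basis. \<bar>v \<bullet> x\<bar>)" by (rule norm_le_l1)
    also have "\<dots> \<le> (\<Sum>x\<in>(Basis :: 'a set). r)"
    proof (rule sum_mono)
      fix x :: 'a assume "x \<in> Basis"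
      then show "\<bar>v \<bullet> x\<bar> \<le> r" using that[of "inv_into UNIV b x"] by (simp add: binv2)
    qed
    also have "\<dots> < R" using R by (simp add: r_def)
    finally show ?thesis .
  qed
  have "conv r c"
  proof -
    \<comment> \<open>The corner of the cube of half-width r. Unconditional convergence of real
      numbers at this point is absolute, which is the weighted summability of the
      coefficients.\<close>
    define v where "v = (\<Sum>x\<in>Basis. r *\<^sub>R x :: 'a)"
    have v: "v \<bullet> b j = r" for j
      unfolding v_def using bB[of j] by (simp add: inner_sum_left inner_Basis if_distrib cong: if_cong)
    then have "norm v < R" using r by (intro small) simp
    from has_sum_imp_summable[OF cs[OF this]]
    have "(\<lambda>\<alpha>. mcoeff c \<alpha> * r ^ index_degree \<alpha>) summable_on UNIV"
      by (simp add: v zpow_const)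
    then have "(\<lambda>\<alpha>. norm (mcoeff c \<alpha> * r ^ index_degree \<alpha>)) summable_on UNIV"
      by (rule summable_on_iff_abs_summable_on_real[THEN iffD1])
    then show ?thesis
      using r by (simp add: conv_def wsummable_def abs_mult)
  qed
  moreover have "k (f (p + v)) = psum c (\<lambda>j. v \<bullet> b j)" if "\<And>j. \<bar>v \<bullet> b j\<bar> \<le> r" for v
    by (rule psum_eqI[symmetric]) (use cs[OF small[OF that]] in simp)
  ultimately show ?thesis using that r by blast
qed

lemma bij_betw_axis: "bij_betw (\<lambda>j. axis j (1::real)) UNIV (Basis :: (real^'n) set)"
  by (auto simp: bij_betw_def inj_on_def axis_eq_axis Basis_vec_def)

lemma real_analytic_on_imp_analytic_at:
  fixes f :: "real ^ 'n \<Rightarrow> 'b::real_normed_vector"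
  assumes "real_analytic_on f S" "p \<in> S" "bounded_linear k"
  shows "analytic_at (\<lambda>x. k (f x)) p"
proof -
  obtain r and c :: "'n mps" where "r > 0" "conv r c"
    "\<And>v. (\<And>j. \<bar>v \<bullet> axis j 1\<bar> \<le> r) \<Longrightarrow> k (f (p + v)) = psum c (\<lambda>j. v \<bullet> axis j 1)"
    using real_analytic_on_expansion[OF assms bij_betw_axis] by metis
  then show ?thesis
    by (auto simp: analytic_at_def series_at_def inner_axis)
qed

lemma series_at_recenter:
  assumes "series_at f p r c" "l > 0" "\<And>j. \<bar>(q - p) $ j\<bar> + l \<le> r"
  obtains d where "series_at f q (l / 2) d"
proof -
  obtain d where d: "conv (l / 2) d"
    "\<And>z. (\<And>j. \<bar>z j\<bar> \<le> l / 2) \<Longrightarrow> psum c (\<lambda>j. (q - p) $ j + z j) = psum d z"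
    using psum_recenter[of r c l "\<lambda>j. (q - p) $ j"] assms by (auto simp: series_at_def)
  have "f (q + v) = psum d (\<lambda>j. v $ j)" if v: "\<forall>j. \<bar>v $ j\<bar> \<le> l / 2" for v
  proof -
    have "\<bar>((q - p) + v) $ j\<bar> \<le> r" for j
      using assms(2) assms(3)[of j] v[rule_format, of j] by simp
    then have "f (p + ((q - p) + v)) = psum c (\<lambda>j. ((q - p) + v) $ j)"
      using assms(1) unfolding series_at_def by blast
    then show ?thesis using d(2)[of "\<lambda>j. v $ j"] v by simp
  qed
  then show ?thesis using that[of d] assms(2) d(1) by (simp add: series_at_def)
qed

text \<open>An expansion at p alone suffices, since recentring provides one at every point at
  distance less than r/2.\<close>

lemma real_analytic_on_ballI:
  fixes f :: "real ^ 'n \<Rightarrow> real ^ 'm"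
  assumes "\<And>i. series_at (\<lambda>x. f x $ i) p r (c i)"
  shows "real_analytic_on f (ball p (r / 2))"
  unfolding real_analytic_on_def
proof (intro ballI)
  fix q assume q: "q \<in> ball p (r / 2)"
  have r: "r > 0" using assms[of undefined] by (simp add: series_at_def)
  have "\<bar>(q - p) $ j\<bar> + r / 2 \<le> r" for j
    using component_le_norm_cart[of "q - p" j] q by (simp add: dist_norm norm_minus_commute)
  then have "\<exists>d. series_at (\<lambda>x. f x $ i) q (r / 2 / 2) d" for i
    using series_at_recenter[OF assms[of i], of "r / 2" q] r by auto
  then obtain d where d: "\<And>i. series_at (\<lambda>x. f x $ i) q (r / 4) (d i)"
    by (simp, metis)
  define C where "C \<beta> = (\<chi> i. mcoeff (d i) (\<lambda>j. \<beta> (axis j 1)))" for \<beta> :: "real ^ 'n \<Rightarrow> nat"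
  show "\<exists>s>0. \<exists>c. \<forall>x\<in>ball q s. ((\<lambda>\<alpha>. (\<Prod>b\<in>Basis. ((x - q) \<bullet> b) ^ \<alpha> b) *\<^sub>R c \<alpha>) has_sum f x) (Basis \<rightarrow>\<^sub>E UNIV)"
  proof (intro exI[of _ "r / 4"] exI[of _ C] conjI ballI)
    show "0 < r / 4" using r by simp
    fix x assume x: "x \<in> ball q (r / 4)"
    have xq: "\<bar>(x - q) $ j\<bar> \<le> r / 4" for j
      using component_le_norm_cart[of "x - q" j] x by (simp add: dist_norm norm_minus_commute)
    have "((\<lambda>\<alpha>. (mcoeff (d i) \<alpha> * zpow (\<lambda>j. (x - q) $ j) \<alpha>) *\<^sub>R axis i 1) has_sum (f x $ i) *\<^sub>R axis i (1::real)) UNIV" for i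
    proof (rule has_sum_bounded_linear[where h = "\<lambda>t. t *\<^sub>R axis i 1"])
      have "f x $ i = psum (d i) (\<lambda>j. (x - q) $ j)"
        using d[of i] xq unfolding series_at_def by (metis add.commute diff_add_cancel)
      then show "((\<lambda>\<alpha>. mcoeff (d i) \<alpha> * zpow (\<lambda>j. (x - q) $ j) \<alpha>) has_sum f x $ i) UNIV"
        using conv_psum_has_sum[of "\<lambda>j. (x - q) $ j" "r / 4" "d i"] d[of i] xq
        by (simp add: series_at_def)
    qed (rule bounded_linear_scaleR_left)
    then have "((\<lambda>\<alpha>. \<Sum>i\<in>UNIV. (mcoeff (d i) \<alpha> * zpow (\<lambda>j. (x - q) $ j) \<alpha>) *\<^sub>R axis i 1) has_sum
        (\<Sum>i\<in>UNIV. (f x $ i) *\<^sub>R axis i (1::real))) UNIV"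
      by (intro has_sum_sum)
    moreover have axis_sum: "(\<Sum>i\<in>UNIV. y i *\<^sub>R axis i (1::real)) = (\<chi> i. y i)" for y :: "'m \<Rightarrow> real"
      by (simp add: vec_eq_iff axis_def if_distrib cong: if_cong)
    moreover have "(\<chi> i. mcoeff (d i) \<alpha> * zpow (\<lambda>j. (x - q) $ j) \<alpha>) = zpow (\<lambda>j. (x - q) $ j) \<alpha> *\<^sub>R (\<chi> i. mcoeff (d i) \<alpha>)" for \<alpha>
      by (simp add: vec_eq_iff)
    ultimately have hs: "((\<lambda>\<alpha>. zpow (\<lambda>j. (x - q) $ j) \<alpha> *\<^sub>R (\<chi> i. mcoeff (d i) \<alpha>)) has_sum f x) UNIV"
      by (simp only: axis_sum vec_nth_inverse)
    let ?b = "\<lambda>j. axis j 1 :: real ^ 'n"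
    let ?i = "inv_into UNIV ?b"
    have binv: "?i (?b j) = j" for j
      by (rule inv_into_f_f[OF bij_betw_imp_inj_on[OF bij_betw_axis]]) simp
    have binv2: "?b (?i x) = x" if "x \<in> Basis" for x
      using bij_betw_axis that by (metis bij_betw_def f_inv_into_f)
    have bB: "?b j \<in> Basis" for j by simp
    show "((\<lambda>\<alpha>. (\<Prod>b\<in>Basis. ((x - q) \<bullet> b) ^ \<alpha> b) *\<^sub>R C \<alpha>) has_sum f x) (Basis \<rightarrow>\<^sub>E UNIV)"
    proof (subst has_sum_reindex_bij_witness[where i = "\<lambda>\<alpha>. restrict (\<alpha> \<circ> ?i) Basis" and j = "\<lambda>\<beta> j. \<beta> (?b j)" and T = UNIV
          and h = "\<lambda>\<alpha>. zpow (\<lambda>j. (x - q) $ j) \<alpha> *\<^sub>R (\<chi> i. mcoeff (d i) \<alpha>)" and s' = "f x"])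
      fix \<beta> :: "real ^ 'n \<Rightarrow> nat" assume "\<beta> \<in> Basis \<rightarrow>\<^sub>E UNIV"
      have "(\<Prod>b\<in>Basis. ((x - q) \<bullet> b) ^ \<beta> b) = zpow (\<lambda>j. (x - q) $ j) (\<lambda>j. \<beta> (?b j))"
        unfolding zpow_def prod.reindex_bij_betw[OF bij_betw_axis, symmetric] by (simp add: inner_axis)
      then show "zpow (\<lambda>j. (x - q) $ j) (\<lambda>j. \<beta> (?b j)) *\<^sub>R (\<chi> i. mcoeff (d i) (\<lambda>j. \<beta> (?b j)))
          = (\<Prod>b\<in>Basis. ((x - q) \<bullet> b) ^ \<beta> b) *\<^sub>R C \<beta>"
        by (simp add: C_def)
    qed (use hs binv2 in \<open>auto simp: fun_eq_iff binv bB PiE_def extensional_def simp del: vector_minus_component\<close>)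
  qed
qed

lemma series_at_add:
  assumes "series_at f p r c" "series_at g p r d"
  shows "series_at (\<lambda>x. f x + g x) p r (c + d)"
  using assms by (auto simp: series_at_def conv_add conv_psum_add[where r = r])

lemma series_at_mult:
  assumes "series_at f p r c" "series_at g p r d"
  shows "series_at (\<lambda>x. f x * g x) p r (c * d)"
  using assms by (auto simp: series_at_def conv_times conv_psum_times[where r = r])

lemma analytic_at_common:
  assumes "analytic_at f p" "analytic_at g p"
  obtains r c d where "series_at f p r c" "series_at g p r d"
proof -
  from assms obtain r c s d where "series_at f p r c" "series_at g p s d"
    by (auto simp: analytic_at_def)
  moreover from this have "r > 0" "s > 0" by (auto simp: series_at_def)
  ultimately show ?thesis
    using series_at_mono[of f p r c "min r s"] series_at_mono[of g p s d "min r s"] that by auto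
qed

lemma analytic_at_add: "analytic_at f p \<Longrightarrow> analytic_at g p \<Longrightarrow> analytic_at (\<lambda>x. f x + g x) p"
  and analytic_at_mult: "analytic_at f p \<Longrightarrow> analytic_at g p \<Longrightarrow> analytic_at (\<lambda>x. f x * g x) p"
  using series_at_add series_at_mult by (metis analytic_at_common analytic_at_def)+

lemma analytic_at_const: "analytic_at (\<lambda>_. a) p"
proof -
  have "series_at (\<lambda>_. a) p 1 (a *\<^sub>R 1)"
    by (auto simp: series_at_def conv_scaleR conv_1 conv_psum_scaleR[where r = 1])
  then show ?thesis by (auto simp: analytic_at_def)
qed

lemma analytic_at_diff: "analytic_at f p \<Longrightarrow> analytic_at g p \<Longrightarrow> analytic_at (\<lambda>x. f x - g x) p"
  using analytic_at_add[of f p "\<lambda>x. (-1) * g x"] analytic_at_mult[OF analytic_at_const[of "-1"], of g] by simp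

lemma analytic_at_sum: "(\<And>x. x \<in> A \<Longrightarrow> analytic_at (f x) p) \<Longrightarrow> analytic_at (\<lambda>u. \<Sum>x\<in>A. f x u) p"
  by (induction A rule: infinite_finite_induct) (auto intro: analytic_at_const analytic_at_add)

lemma series_at_has_derivative:
  assumes "series_at f p r c" "\<And>j. \<bar>v $ j\<bar> < r / 2"
  shows "(f has_derivative (\<lambda>h. \<Sum>j\<in>UNIV. psum (pd j c) (\<lambda>j. v $ j) * h $ j)) (at (p + v))"
proof -
  have r: "r > 0" using assms by (simp add: series_at_def)
  have "((\<lambda>x. psum c (\<lambda>j. (x - p) $ j)) has_derivative
      (\<lambda>h. \<Sum>j\<in>UNIV. psum (pd j c) (\<lambda>j. (p + v - p) $ j) * h $ j)) (at (p + v))"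
    using assms
    by (intro has_derivative_psum[where r = r]) (auto simp: series_at_def intro!: derivative_eq_intros bounded_linear_imp_has_derivative bounded_linear_vec_nth)
  then have d: "((\<lambda>x. psum c (\<lambda>j. (x - p) $ j)) has_derivative
      (\<lambda>h. \<Sum>j\<in>UNIV. psum (pd j c) (\<lambda>j. v $ j) * h $ j)) (at (p + v))" by simp
  have op: "open {x. \<forall>j. \<bar>(x - p) $ j\<bar> < r}"
  proof -
    have "open {x. \<bar>(x - p) $ j\<bar> < r}" for j
      by (intro open_Collect_less continuous_intros)
    then show ?thesis by (simp add: Collect_all_eq open_INT)
  qed
  have eq: "f x = psum c (\<lambda>j. (x - p) $ j)" if "\<And>j. \<bar>(x - p) $ j\<bar> < r" for x
  proof -
    have "\<forall>j. \<bar>(x - p) $ j\<bar> \<le> r" using that less_imp_le by blast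
    then have "f (p + (x - p)) = psum c (\<lambda>j. (x - p) $ j)"
      using assms(1) unfolding series_at_def by blast
    then show ?thesis by simp
  qed
  have "p + v \<in> {x. \<forall>j. \<bar>(x - p) $ j\<bar> < r}"
  proof (clarsimp)
    fix j show "\<bar>v $ j\<bar> < r" using assms(2)[of j] r by linarith
  qed
  then show ?thesis
    by (rule has_derivative_transform_within_open[OF d op]) (use eq in auto)
qed

lemma analytic_at_differentiable:
  assumes "analytic_at f p" shows "f differentiable (at p)"
proof -
  from assms obtain r c where "series_at f p r c" by (auto simp: analytic_at_def)
  from series_at_has_derivative[OF this, of 0] this show ?thesis
    by (auto simp: series_at_def differentiable_def)
qed

text \<open>The set of points near which f vanishes is open. It is relatively closed in S: a point
  of its closure is covered by the polydisc of an expansion centred at a nearby point of the set,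
  and that expansion is zero.\<close>

lemma analytic_identity:
  fixes f :: "real ^ 'n \<Rightarrow> real"
  assumes S: "open S" "connected S" and f: "\<And>x. x \<in> S \<Longrightarrow> analytic_at f x"
    and a: "a \<in> S" "eventually (\<lambda>x. f x = 0) (nhds a)" and x: "x \<in> S"
  shows "f x = 0"
proof -
  define Z where "Z = {x. eventually (\<lambda>x. f x = 0) (nhds x)}"
  have oZ: "open Z"
    unfolding Z_def open_subopen[of "{x. _ x}"] by (auto simp: eventually_nhds)
  have cl: "q \<in> Z" if q: "q \<in> S" "q \<in> closure Z" for q
  proof -
    obtain r c where c: "series_at f q r c" using f[OF q(1)] by (auto simp: analytic_at_def)
    have r: "r > 0" using c by (simp add: series_at_def)
    \<comment> \<open>The distance r/8 ensures that the polydisc of radius r/4 around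
      \<open>q1\<close> contains the ball of radius r/8 around q.\<close>
    obtain q1 where q1: "q1 \<in> Z" "dist q1 q < r / 8"
      using q(2) r unfolding closure_approachable by (metis divide_pos_pos zero_less_numeral)
    have near: "\<bar>(q1 - q) $ j\<bar> < r / 8" for j
      using component_le_norm_cart[of "q1 - q" j] q1(2) by (simp add: dist_norm)
    have le: "\<bar>(q1 - q) $ j\<bar> + r / 2 \<le> r" for j using near[of j] r by simp
    have r2: "r / 2 > 0" using r by simp
    obtain d where d: "series_at f q1 (r / 2 / 2) d"
      using series_at_recenter[OF c r2 le] by auto
    have "d = 0"
    proof -
      from q1(1) obtain e where e: "e > 0" "\<And>x. dist x q1 < e \<Longrightarrow> f x = 0"
        unfolding Z_def eventually_nhds_metric by auto
      define \<delta> where "\<delta> = min (r / 4) (e / (real CARD('n) + 1))"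
      show ?thesis
      proof (rule psum_eq_0_imp_eq_0)
        show "conv (r / 2 / 2) d" using d by (simp add: series_at_def)
        show "\<delta> > 0" "r / 2 / 2 > 0" using r e by (auto simp: \<delta>_def)
        fix z :: "'n \<Rightarrow> real" assume z: "\<And>j. \<bar>z j\<bar> < \<delta>"
        let ?v = "\<chi> j. z j"
        have "norm ?v \<le> (\<Sum>j\<in>UNIV. \<bar>z j\<bar>)" using norm_le_l1_cart[of ?v] by simp
        also have "\<dots> \<le> (\<Sum>j\<in>(UNIV::'n set). e / (real CARD('n) + 1))"
          by (intro sum_mono) (use z in \<open>auto simp: \<delta>_def intro: less_imp_le\<close>)
        also have "\<dots> < e" using e by (simp add: field_simps)
        finally have "f (q1 + ?v) = 0" by (intro e) (simp add: dist_norm)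
        moreover have "\<forall>j. \<bar>?v $ j\<bar> \<le> r / 2 / 2"
          using z by (auto simp: \<delta>_def intro: less_imp_le)
        then have "f (q1 + ?v) = psum d (\<lambda>j. ?v $ j)"
          using d unfolding series_at_def by blast
        ultimately show "psum d z = 0" by simp
      qed
    qed
    have "f x = 0" if "dist x q < r / 8" for x
    proof -
      have "\<bar>(x - q1) $ j\<bar> \<le> r / 2 / 2" for j
        using component_le_norm_cart[of "x - q" j] that near[of j] unfolding dist_norm vector_minus_component
        by linarith
      then have "f (q1 + (x - q1)) = psum d (\<lambda>j. (x - q1) $ j)"
        using d unfolding series_at_def by blast
      then show ?thesis using \<open>d = 0\<close> by simp
    qed
    then show ?thesis unfolding Z_def eventually_nhds_metric using r by (auto intro!: exI[of _ "r / 8"])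
  qed
  have "S \<subseteq> Z"
  proof (rule ccontr)
    assume "\<not> S \<subseteq> Z"
    have "open (- closure Z)" by (simp add: open_closed)
    moreover have "S \<subseteq> Z \<union> - closure Z" using cl by auto
    moreover have "Z \<inter> - closure Z \<inter> S = {}" using closure_subset[of Z] by auto
    moreover have "Z \<inter> S \<noteq> {}" using a by (auto simp: Z_def)
    moreover have "- closure Z \<inter> S \<noteq> {}" using \<open>\<not> S \<subseteq> Z\<close> cl by auto
    ultimately show False using S(2) oZ unfolding connected_def by metis
  qed
  with x have "x \<in> Z" by auto
  then show ?thesis unfolding Z_def by (auto dest: eventually_nhds_x_imp_x)
qed

section \<open>The Euler operator and series vanishing to a given time order\<close>

definition euler :: "'i::finite option mps \<Rightarrow> 'i option mps" where
  "euler F = (\<Sum>i\<in>UNIV. mvar (Some i) * pd (Some i) F)"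

lemma mcoeff_euler: "mcoeff (euler F) \<gamma> = real (time_degree \<gamma>) * mcoeff F \<gamma>"
  by (simp add: euler_def mcoeff_mvar_times_pd time_degree_def sum_distrib_right)

lemma euler_mult: "euler (F * G) = euler F * G + F * euler G"
  by (simp add: euler_def pd_mult algebra_simps sum.distrib sum_distrib_left sum_distrib_right)

lemma euler_sum: "euler (sum F A) = (\<Sum>x\<in>A. euler (F x))"
  by (rule mps_eqI) (simp add: mcoeff_euler sum_distrib_left)

lemma euler_pd_None: "euler (pd None F) = pd None (euler F)"
  by (simp add: euler_def pd_mult pd_mvar pd_commute[of None])

text \<open>The additional term is the commutator of \<open>pd (Some k)\<close> with the Euler
  operator, coming from the derivative of \<open>mvar (Some k)\<close>. It shifts the eigenvalues of
  the Euler operator from the time degree to the time degree plus 1, so that none of them is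
  0.\<close>

lemma euler_pd_Some: "euler (pd (Some k) F) + pd (Some k) F = pd (Some k) (euler F)"
proof -
  have "pd (Some k) (euler F) = (\<Sum>i\<in>UNIV. (if k = i then pd (Some i) F else 0)
      + mvar (Some i) * pd (Some k) (pd (Some i) F))"
    unfolding euler_def by (auto simp: pd_mult pd_mvar intro!: sum.cong)
  then show ?thesis
    by (simp add: euler_def sum.distrib pd_commute[of "Some k"])
qed

text \<open>The filtration by powers of the ideal generated by the time variables.\<close>

definition vanish :: "nat \<Rightarrow> 'i::finite option mps \<Rightarrow> bool" where
  "vanish n F \<longleftrightarrow> (\<forall>\<gamma>. time_degree \<gamma> < n \<longrightarrow> mcoeff F \<gamma> = 0)"

lemma vanish_0: "vanish n 0"
  and vanish_add: "vanish n F \<Longrightarrow> vanish n G \<Longrightarrow> vanish n (F + G)"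
  and vanish_pd_None: "vanish n F \<Longrightarrow> vanish n (pd None F)"
  by (auto simp: vanish_def mcoeff_pd)

lemma vanish_sum: "(\<And>x. x \<in> A \<Longrightarrow> vanish n (F x)) \<Longrightarrow> vanish n (sum F A)"
  by (induction A rule: infinite_finite_induct) (auto intro: vanish_0 vanish_add)

lemma vanish_times:
  assumes "vanish n F" shows "vanish n (F * G)"
  unfolding vanish_def mcoeff_times
proof (intro allI impI sum.neutral ballI)
  fix \<gamma> :: "'a option \<Rightarrow> nat" and x
  assume g: "time_degree \<gamma> < n" and x: "x \<in> adiag \<gamma>"
  obtain \<alpha> \<beta> where ab: "x = (\<alpha>, \<beta>)" by (cases x)
  then have "time_degree \<alpha> + time_degree \<beta> < n" using g x by auto
  then have "mcoeff F \<alpha> = 0" using assms by (simp add: vanish_def)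
  then show "(case x of (\<alpha>, \<beta>) \<Rightarrow> mcoeff F \<alpha> * mcoeff G \<beta>) = 0" by (simp add: ab)
qed

lemma vanish_mvar_times:
  assumes "vanish n F" shows "vanish (Suc n) (mvar (Some i) * F)"
  unfolding vanish_def
proof (intro allI impI)
  fix \<gamma> :: "'a option \<Rightarrow> nat" assume g: "time_degree \<gamma> < Suc n"
  show "mcoeff (mvar (Some i) * F) \<gamma> = 0"
  proof (cases "\<gamma> (Some i) = 0")
    case False
    then obtain \<beta> where \<beta>: "\<gamma> = \<beta> + unit_index (Some i)" by (rule index_split)
    then have "time_degree \<beta> < n" using g by simp
    then show ?thesis using assms unfolding \<beta> mcoeff_mvar_times_shift vanish_def by blast
  qed (rule mcoeff_mvar_times_0)
qed

section \<open>Compatibility implies integrability\<close>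

text \<open>Contraction of the last index: if d holds the partial derivatives of a matrix, this is
  the directional derivative along x.\<close>

definition matd :: "'a::comm_ring_1 ^ 'n ^ 'n ^ 'n \<Rightarrow> 'a ^ 'n \<Rightarrow> 'a ^ 'n ^ 'n" where
  "matd d x = (\<chi> m p. \<Sum>q\<in>UNIV. d $ m $ p $ q * x $ q)"

definition vmap :: "('a \<Rightarrow> 'b) \<Rightarrow> 'a ^ 'n \<Rightarrow> 'b ^ 'n" where
  "vmap f x = (\<chi> m. f (x $ m))"

lemma vmap_nth [simp]: "vmap f x $ m = f (x $ m)"
  by (simp add: vmap_def)

lemma matd_add: "matd d (x + y) = matd d x + matd d y"
  by (simp add: matd_def vec_eq_iff distrib_left sum.distrib)

lemma matd_sum: "matd d (sum x A) = (\<Sum>i\<in>A. matd d (x i))"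
  by (simp add: matd_def vec_eq_iff sum_distrib_left sum.swap[of _ A])

lemma matd_smult: "matd d (c *s x) *v y = c *s (matd d x *v y)"
  by (simp add: matd_def matrix_vector_mult_def vec_eq_iff sum_distrib_left mult_ac)

lemma mat_smult: "A *v (c *s x) = c *s (A *v (x :: 'a::comm_ring_1 ^ 'n))"
  by (simp add: matrix_vector_mult_def vec_eq_iff sum_distrib_left mult_ac)

lemma mat_sum_left: "(sum A S) *v x = (\<Sum>i\<in>S. A i *v (x :: 'a::comm_ring_1 ^ 'n))"
  by (induction S rule: infinite_finite_induct) (auto simp: matrix_vector_mult_add_rdistrib)

lemma mat_sum_right: "A *v (sum x S) = (\<Sum>i\<in>S. A *v (x i :: 'a::comm_ring_1 ^ 'n))"
  by (induction S rule: infinite_finite_induct) (auto simp: matrix_vector_right_distrib)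

lemma vmap_pd_mat: "vmap (pd j) (A *v x) = vmap (vmap (pd j)) A *v x + A *v vmap (pd j) (x :: 'k::finite mps ^ 'n)"
  by (simp add: vec_eq_iff matrix_vector_mult_def pd_mult sum.distrib)

lemma vmap_euler_mat: "vmap euler (A *v x) = vmap (vmap euler) A *v x + A *v vmap euler x"
  by (simp add: vec_eq_iff matrix_vector_mult_def euler_mult euler_sum sum.distrib)

text \<open>
  Here \<open>a i\<close> is the matrix of the \<open>i\<close>-th equation along a formal solution \<open>W\<close> of the Euler form, and
  \<open>d i $ m $ p $ q\<close> is the derivative of its entry \<open>(m, p)\<close> in the direction \<open>q\<close>. By compatibility, the
  defect \<open>r k\<close> of the \<open>k\<close>-th equation satisfies a linear homogeneous equation of the same kind, hence
  vanishes to every order in time.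
\<close>

lemma integrability:
  fixes W :: "'i::finite option mps ^ 'n" and a :: "'i \<Rightarrow> 'i option mps ^ 'n ^ 'n"
    and d :: "'i \<Rightarrow> 'i option mps ^ 'n ^ 'n ^ 'n"
  defines "v \<equiv> vmap (pd None) W"
  assumes chain: "\<And>i j. vmap (vmap (pd j)) (a i) = matd (d i) (vmap (pd j) W)"
    and comm: "\<And>i k. a i ** a k = a k ** a i"
    and compat: "\<And>i k. matd (d i) (a k *v v) *v v - matd (d k) (a i *v v) *v v
        + a i *v (matd (d k) v *v v) - a k *v (matd (d i) v *v v) = 0"
    and eq: "vmap euler W = (\<Sum>i\<in>UNIV. mvar (Some i) *s (a i *v v))"
  shows "vmap (pd (Some k)) W = a k *v v"
proof -
  define r where "r k = vmap (pd (Some k)) W - a k *v v" for k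
  have pdk: "vmap (pd (Some k)) W = r k + a k *v v" for k
    by (simp add: r_def)
  have pdv: "vmap (pd (Some k)) v = vmap (pd None) (r k) + vmap (pd None) (a k *v v)" for k
  proof -
    have "vmap (pd (Some k)) v = vmap (pd None) (vmap (pd (Some k)) W)"
      by (simp add: v_def vec_eq_iff pd_commute[of None])
    then show ?thesis by (simp add: pdk vec_eq_iff)
  qed
  \<comment> \<open>\<open>euler\<close> is a combination of the derivations
    \<open>pd (Some i)\<close>, so the chain rule assumed for these holds for it as well.\<close>
  have euler_a: "vmap (vmap euler) (a k) = (\<Sum>i\<in>UNIV. matd (d k) (mvar (Some i) *s (a i *v v)))" for k
  proof -
    have "vmap (vmap euler) (a k) = matd (d k) (vmap euler W)"
    proof -
      have c: "pd j (a k $ m $ p) = (\<Sum>q\<in>UNIV. d k $ m $ p $ q * pd j (W $ q))" for j m p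
        using chain[of j k] by (simp add: vec_eq_iff matd_def)
      show ?thesis
        by (simp add: vec_eq_iff matd_def euler_def c sum_distrib_left mult_ac sum.swap[of _ "UNIV::'n set"])
    qed
    then show ?thesis by (simp add: eq matd_sum)
  qed
  have euler_v: "vmap euler v = (\<Sum>i\<in>UNIV. mvar (Some i) *s vmap (pd None) (a i *v v))"
  proof -
    have "vmap euler v = vmap (pd None) (vmap euler W)"
      by (simp add: v_def vec_eq_iff euler_pd_None)
    then show ?thesis by (simp add: eq vec_eq_iff pd_mult pd_mvar)
  qed
  have main: "vmap euler (r k) + r k = (\<Sum>i\<in>UNIV. mvar (Some i) *s (matd (d i) (r k) *v v + a i *v vmap (pd None) (r k)))" for k
  proof -
    have "vmap euler (vmap (pd (Some k)) W) + vmap (pd (Some k)) W = vmap (pd (Some k)) (vmap euler W)"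
      by (simp add: vec_eq_iff euler_pd_Some)
    also have "\<dots> = (\<Sum>i\<in>UNIV. (if k = i then a i *v v else 0) + mvar (Some i) *s vmap (pd (Some k)) (a i *v v))"
      unfolding eq by (auto simp: vec_eq_iff pd_mult pd_mvar intro!: sum.cong)
    also have "\<dots> = a k *v v + (\<Sum>i\<in>UNIV. mvar (Some i) *s vmap (pd (Some k)) (a i *v v))"
      by (simp add: sum.distrib)
    finally have 1: "vmap euler (vmap (pd (Some k)) W) + vmap (pd (Some k)) W
        = a k *v v + (\<Sum>i\<in>UNIV. mvar (Some i) *s vmap (pd (Some k)) (a i *v v))" .
    have 2: "vmap euler (a k *v v) = (\<Sum>i\<in>UNIV. mvar (Some i) *s (matd (d k) (a i *v v) *v v + a k *v vmap (pd None) (a i *v v)))"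
      unfolding vmap_euler_mat euler_a euler_v
      by (simp add: mat_sum_left mat_sum_right matd_smult mat_smult sum.distrib vector_add_ldistrib)
    \<comment> \<open>All terms free of \<open>r k\<close> cancel: those with second x-derivatives
      of \<open>W\<close> because the matrices commute, those quadratic in v by
      compatibility.\<close>
    have 3: "vmap (pd (Some k)) (a i *v v) - (matd (d k) (a i *v v) *v v + a k *v vmap (pd None) (a i *v v))
        = matd (d i) (r k) *v v + a i *v vmap (pd None) (r k)" for i
    proof -
      have pn: "vmap (pd None) (a i *v v) = matd (d i) v *v v + a i *v vmap (pd None) v" for i
        unfolding vmap_pd_mat chain v_def ..
      have cm: "a i *v (a k *v x) = a k *v (a i *v x)" for x
        by (simp add: matrix_vector_mul_assoc comm[of i k])
      have "vmap (pd (Some k)) (a i *v v) = matd (d i) (r k + a k *v v) *v v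
          + a i *v (vmap (pd None) (r k) + (matd (d k) v *v v + a k *v vmap (pd None) v))"
        unfolding vmap_pd_mat[of "Some k"] chain[of "Some k"] pdv pdk pn ..
      moreover have "matd (d i) (a k *v v) *v v + a i *v (matd (d k) v *v v)
          = matd (d k) (a i *v v) *v v + a k *v (matd (d i) v *v v)"
        using compat[of i k] by (simp add: algebra_simps)
      ultimately show ?thesis
        unfolding pn[of i]
        using compat[of i k]
        by (simp add: matd_add matrix_vector_right_distrib matrix_vector_mult_add_rdistrib cm)
           (simp add: add_diff_eq diff_diff_eq2 diff_diff_eq add.assoc)
    qed
    have "vmap euler (r k) + r k = (vmap euler (vmap (pd (Some k)) W) + vmap (pd (Some k)) W) - vmap euler (a k *v v) - a k *v v"
      by (simp add: r_def vec_eq_iff) (simp add: euler_def algebra_simps sum_subtractf)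
    also have "\<dots> = (\<Sum>i\<in>UNIV. mvar (Some i) *s (vmap (pd (Some k)) (a i *v v) - (matd (d k) (a i *v v) *v v + a k *v vmap (pd None) (a i *v v))))"
      unfolding 1 2 by (simp add: sum_subtractf vector_ssub_ldistrib)
    finally show ?thesis unfolding 3 .
  qed
  \<comment> \<open>Every term on the right of \<open>main\<close> contains \<open>r k\<close> and a
    factor \<open>mvar (Some i)\<close>, hence vanishes to one order more than \<open>r k\<close>;
    on the left the coefficients of \<open>r k\<close> are multiplied by the time degree plus 1,
    which is positive. So vanishing of order n implies order n + 1.\<close>
  have "vanish n (r k $ m)" for n m
  proof (induction n arbitrary: m)
    case (Suc n)
    have "vanish (Suc n) ((\<Sum>i\<in>UNIV. mvar (Some i) *s (matd (d i) (r k) *v v + a i *v vmap (pd None) (r k))) $ m)"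
      unfolding sum_component vector_smult_component vector_add_component
    proof (rule vanish_sum, rule vanish_mvar_times, rule vanish_add)
      fix i
      show "vanish n ((matd (d i) (r k) *v v) $ m)"
        unfolding matd_def matrix_vector_mult_def
        by (auto intro!: vanish_sum vanish_times simp: Suc mult.commute[of "d i $ _ $ _ $ _"] sum_distrib_right mult.assoc)
      show "vanish n ((a i *v vmap (pd None) (r k)) $ m)"
        unfolding matrix_vector_mult_def
        by (auto intro!: vanish_sum vanish_times vanish_pd_None simp: Suc mult.commute[of "a i $ _ $ _"])
    qed
    then have "vanish (Suc n) ((vmap euler (r k) + r k) $ m)"
      by (simp only: main)
    then have v: "vanish (Suc n) (euler (r k $ m) + r k $ m)"
      by (simp only: vector_add_component vmap_nth)
    show ?case
      unfolding vanish_def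
    proof (intro allI impI)
      fix \<gamma> :: "'i option \<Rightarrow> nat" assume "time_degree \<gamma> < Suc n"
      with v have "(real (time_degree \<gamma>) + 1) * mcoeff (r k $ m) \<gamma> = 0"
        by (simp add: vanish_def mcoeff_euler distrib_right)
      then show "mcoeff (r k $ m) \<gamma> = 0"
        by (simp add: add_nonneg_eq_0_iff)
    qed
  qed (simp add: vanish_def)
  then have "r k $ m = 0" for m
    unfolding vanish_def by (intro mps_eqI) (metis lessI mcoeff_simps(1))
  then have "r k = 0" by (simp add: vec_eq_iff)
  then show ?thesis by (simp add: r_def)
qed

section \<open>Solving the Cauchy problem by contraction\<close>

text \<open>The value at time 0, kept as an element of the same algebra.\<close>

definition space_part :: "'i::finite wps \<Rightarrow> 'i wps" where
  "space_part F = Abs_wps (Abs_mps (\<lambda>\<gamma>. if time_degree \<gamma> = 0 then mcoeff (mps_of F) \<gamma> else 0))"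

lemma mcoeff_space_part:
  "mcoeff (mps_of (space_part F)) \<gamma> = (if time_degree \<gamma> = 0 then mcoeff (mps_of F) \<gamma> else 0)"
proof -
  let ?G = "Abs_mps (\<lambda>\<gamma>. if time_degree \<gamma> = 0 then mcoeff (mps_of F) \<gamma> else 0)"
  have "wsummable cwt ?G"
    by (rule wsummable_comparison(1)[OF wsummable_mps_of[of F, unfolded wsummable_def]]) auto
  then show ?thesis by (simp add: space_part_def Abs_wps_inverse)
qed

text \<open>The radius 2 is the one for which \<open>psum_lipschitz\<close> controls substitution on
  the unit ball of the algebra.\<close>

definition total_norm :: "('i::finite \<Rightarrow> 'n::finite \<Rightarrow> 'n \<Rightarrow> 'n mps) \<Rightarrow> real" where
  "total_norm A = (\<Sum>m\<in>UNIV. \<Sum>i\<in>UNIV. \<Sum>p\<in>UNIV. wnorm (\<lambda>\<alpha>. 2 ^ index_degree \<alpha>) (A i m p))"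

text \<open>The Picard map of the Euler equation: the initial datum \<open>H\<close> plus the
  integrated right-hand side, the entries of the matrices being power series in the unknown
  itself.\<close>

definition cauchy_map ::
  "('i::finite \<Rightarrow> 'n::finite \<Rightarrow> 'n \<Rightarrow> 'n mps) \<Rightarrow> 'i wps ^ 'n \<Rightarrow> 'i wps ^ 'n \<Rightarrow> 'i wps ^ 'n" where
  "cauchy_map A H w = (\<chi> m. H $ m + (\<Sum>i\<in>UNIV. \<Sum>p\<in>UNIV. cauchy_op i (psum (A i m p) (\<lambda>q. w $ q)) (w $ p)))"

lemma norm_vec_le_sum: "norm (x :: 'a::real_normed_vector ^ 'n) \<le> (\<Sum>m\<in>UNIV. norm (x $ m))"
  unfolding norm_vec_def by (rule L2_set_le_sum) simp

lemma wnorm_nonneg: "(\<And>\<alpha>. 0 \<le> w \<alpha>) \<Longrightarrow> 0 \<le> wnorm w F"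
  unfolding wnorm_def by (intro infsum_nonneg) auto

text \<open>In the constant, \<open>CARD('n)\<close> comes from varying the argument of the matrices
  in all components, and 1 from varying the differentiated factor.\<close>

lemma cauchy_map_lipschitz:
  fixes A :: "'i::finite \<Rightarrow> 'n::finite \<Rightarrow> 'n \<Rightarrow> 'n mps" and w w' :: "'i wps ^ 'n"
  assumes A: "\<And>i m p. conv 2 (A i m p)" and w: "norm w \<le> 1" and w': "norm w' \<le> 1"
  shows "norm (cauchy_map A H w - cauchy_map A H w') \<le> (real CARD('n) + 1) * total_norm A * norm (w - w')"
proof -
  let ?N = "\<lambda>i m p. wnorm (\<lambda>\<alpha>. 2 ^ index_degree \<alpha>) (A i m p)"
  let ?a = "\<lambda>i m p w. psum (A i m p) (\<lambda>q. w $ q)"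
  let ?D = "norm (w - w')"
  have wq: "norm (w $ q) \<le> 1" and w'q: "norm (w' $ q) \<le> 1" for q
    using Finite_Cartesian_Product.norm_nth_le[of w q] Finite_Cartesian_Product.norm_nth_le[of w' q] w w' by auto
  have A1: "conv 1 (A i m p)" for i m p using conv_mono[OF A] by simp
  have step: "norm (cauchy_op i (?a i m p w) (w $ p) - cauchy_op i (?a i m p w') (w' $ p))
      \<le> (real CARD('n) + 1) * ?N i m p * ?D" for i m p
  proof -
    have N0: "0 \<le> ?N i m p" by (rule wnorm_nonneg) simp
    have "norm (?a i m p w - ?a i m p w') \<le> ?N i m p * (\<Sum>j\<in>UNIV. norm (w $ j - w' $ j))"
      by (rule psum_lipschitz[OF A wq w'q])
    also have "\<dots> \<le> ?N i m p * (\<Sum>j\<in>(UNIV::'n set). ?D)"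
      using Finite_Cartesian_Product.norm_nth_le[of "w - w'"] by (intro mult_left_mono sum_mono N0) auto
    finally have l: "norm (?a i m p w - ?a i m p w') \<le> real CARD('n) * ?N i m p * ?D" by (simp add: mult_ac)
    have b: "norm (?a i m p w') \<le> ?N i m p"
    proof -
      have "norm (zpow (\<lambda>q. w' $ q) \<alpha>) \<le> 2 ^ index_degree \<alpha>" for \<alpha>
        by (rule norm_zpow_le_power) (rule order_trans[OF w'q], simp)
      then show ?thesis by (rule norm_psum_le[OF A[unfolded conv_def]])
    qed
    have "cauchy_op i (?a i m p w) (w $ p) - cauchy_op i (?a i m p w') (w' $ p)
        = cauchy_op i (?a i m p w - ?a i m p w') (w $ p) + cauchy_op i (?a i m p w') ((w - w') $ p)"
      by (simp add: cauchy_op_diff_left cauchy_op_diff_right)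
    also have "norm \<dots> \<le> norm (?a i m p w - ?a i m p w') * norm (w $ p) + norm (?a i m p w') * norm ((w - w') $ p)"
      by (rule order_trans[OF norm_triangle_ineq add_mono[OF norm_cauchy_op norm_cauchy_op]])
    also have "\<dots> \<le> real CARD('n) * ?N i m p * ?D * 1 + ?N i m p * ?D"
      using l b wq Finite_Cartesian_Product.norm_nth_le[of "w - w'" p] N0 by (intro add_mono mult_mono) auto
    finally show ?thesis by (simp add: algebra_simps)
  qed
  have "norm (cauchy_map A H w - cauchy_map A H w') \<le> (\<Sum>m\<in>UNIV. norm ((cauchy_map A H w - cauchy_map A H w') $ m))"
    by (rule norm_vec_le_sum)
  also have "\<dots> \<le> (\<Sum>m\<in>UNIV. \<Sum>i\<in>UNIV. \<Sum>p\<in>UNIV. (real CARD('n) + 1) * ?N i m p * ?D)"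
  proof (rule sum_mono)
    fix m
    have "(cauchy_map A H w - cauchy_map A H w') $ m
        = (\<Sum>i\<in>UNIV. \<Sum>p\<in>UNIV. cauchy_op i (?a i m p w) (w $ p) - cauchy_op i (?a i m p w') (w' $ p))"
      by (simp add: cauchy_map_def sum_subtractf)
    also have "norm \<dots> \<le> (\<Sum>i\<in>UNIV. \<Sum>p\<in>UNIV. (real CARD('n) + 1) * ?N i m p * ?D)"
      by (intro sum_norm_le step)
    finally show "norm ((cauchy_map A H w - cauchy_map A H w') $ m)
        \<le> (\<Sum>i\<in>UNIV. \<Sum>p\<in>UNIV. (real CARD('n) + 1) * ?N i m p * ?D)" .
  qed
  also have "\<dots> = (real CARD('n) + 1) * total_norm A * ?D"
    by (simp add: total_norm_def sum_distrib_left sum_distrib_right mult.assoc)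
  finally show ?thesis .
qed

text \<open>Multiplication by a time variable leaves no terms of time degree 0, so that the division
  by zero in \<open>time_integral\<close> is harmless.\<close>

lemma mcoeff_time_integral_mvar:
  "real (time_degree \<gamma>) * mcoeff (time_integral (mvar (Some i) * F)) \<gamma> = mcoeff (mvar (Some i) * F) \<gamma>"
proof (cases "time_degree \<gamma> = 0")
  case True
  then have "\<gamma> (Some i) = 0" by (simp add: time_degree_def)
  then show ?thesis by (simp add: time_integral_def mcoeff_mvar_times_0)
qed (simp add: time_integral_def)

text \<open>In time degree 0 the fixed point equation is the hypothesis on
  \<open>space_part\<close>, and the Euler equation reads 0 = 0; in positive time degree the two
  differ by the factor \<open>time_degree \<gamma>\<close>.\<close>

lemma cauchy_map_fixed_iff:
  fixes A :: "'i::finite \<Rightarrow> 'n::finite \<Rightarrow> 'n \<Rightarrow> 'n mps"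
  assumes H: "\<And>m. space_part (w $ m) = H $ m"
  shows "cauchy_map A H w = w \<longleftrightarrow>
    (\<forall>m. euler (mps_of (w $ m)) = (\<Sum>i\<in>UNIV. mvar (Some i) *
      (\<Sum>p\<in>UNIV. mps_of (psum (A i m p) (\<lambda>q. w $ q)) * pd None (mps_of (w $ p)))))"
proof -
  have "cauchy_map A H w $ m = w $ m \<longleftrightarrow>
    euler (mps_of (w $ m)) = (\<Sum>i\<in>UNIV. mvar (Some i) *
      (\<Sum>p\<in>UNIV. mps_of (psum (A i m p) (\<lambda>q. w $ q)) * pd None (mps_of (w $ p))))" for m
  proof -
    let ?c = "\<lambda>i p. mps_of (psum (A i m p) (\<lambda>q. w $ q)) * pd None (mps_of (w $ p))"
    let ?S = "\<lambda>\<gamma>. \<Sum>i\<in>UNIV. \<Sum>p\<in>UNIV. mcoeff (time_integral (mvar (Some i) * ?c i p)) \<gamma>"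
    have L: "cauchy_map A H w $ m = w $ m \<longleftrightarrow>
        (\<forall>\<gamma>. mcoeff (mps_of (H $ m)) \<gamma> + ?S \<gamma> = mcoeff (mps_of (w $ m)) \<gamma>)"
      by (auto simp: cauchy_map_def mps_of_inject[symmetric] mcoeff_inject[symmetric] fun_eq_iff mps_of_cauchy_op)
    have R: "euler (mps_of (w $ m)) = (\<Sum>i\<in>UNIV. mvar (Some i) * (\<Sum>p\<in>UNIV. ?c i p)) \<longleftrightarrow>
        (\<forall>\<gamma>. real (time_degree \<gamma>) * mcoeff (mps_of (w $ m)) \<gamma> = real (time_degree \<gamma>) * ?S \<gamma>)"
      unfolding mcoeff_inject[symmetric] fun_eq_iff mcoeff_euler mcoeff_sum sum_distrib_left
        mcoeff_time_integral_mvar ..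
    have "mcoeff (mps_of (H $ m)) \<gamma> + ?S \<gamma> = mcoeff (mps_of (w $ m)) \<gamma> \<longleftrightarrow>
      real (time_degree \<gamma>) * mcoeff (mps_of (w $ m)) \<gamma> = real (time_degree \<gamma>) * ?S \<gamma>" for \<gamma>
      using mcoeff_space_part[of "w $ m" \<gamma>] H[of m] by (auto simp: time_integral_def)
    then show ?thesis unfolding L R by blast
  qed
  then show ?thesis by (simp add: vec_eq_iff)
qed

lemma cauchy_map_fixed_unique:
  fixes A :: "'i::finite \<Rightarrow> 'n::finite \<Rightarrow> 'n \<Rightarrow> 'n mps"
  assumes A: "\<And>i m p. conv 2 (A i m p)" and small: "(real CARD('n) + 1) * total_norm A \<le> 1/2"
    and w: "norm w \<le> 1" "cauchy_map A H w = w" and w': "norm w' \<le> 1" "cauchy_map A H w' = w'"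
  shows "w = w'"
proof -
  have "norm (w - w') \<le> (real CARD('n) + 1) * total_norm A * norm (w - w')"
    using cauchy_map_lipschitz[where A = A and H = H, OF A w(1) w'(1)] w w' by simp
  also have "\<dots> \<le> 1/2 * norm (w - w')" using small by (rule mult_right_mono) simp
  finally show ?thesis by simp
qed

lemma cauchy_map_fixed_exists:
  fixes A :: "'i::finite \<Rightarrow> 'n::finite \<Rightarrow> 'n \<Rightarrow> 'n mps"
  assumes A: "\<And>i m p. conv 2 (A i m p)" and small: "(real CARD('n) + 1) * total_norm A \<le> 1/2"
    and H: "norm H \<le> 1/2"
  obtains w where "norm w \<le> 1" "cauchy_map A H w = w"
proof -
  have lip: "norm (cauchy_map A H w - cauchy_map A H w') \<le> 1/2 * norm (w - w')"
    if "norm w \<le> 1" "norm w' \<le> 1" for w w'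
    using cauchy_map_lipschitz[where A = A and H = H, OF A that] mult_right_mono[OF small norm_ge_zero[of "w - w'"]] by simp
  \<comment> \<open>The Lipschitz bound is applied against 0, where the map takes the value
    \<open>H\<close>; this gives 1/2 + 1/2 as the bound on the image of the unit ball.\<close>
  have H0: "cauchy_map A H 0 = H"
    by (simp add: cauchy_map_def vec_eq_iff cauchy_op_def time_integral_def zero_wps_def[symmetric] zero_mps_def[symmetric])
  have "\<exists>!w\<in>cball 0 1. cauchy_map A H w = w"
  proof (rule Banach_fix[where c = "1/2"])
    show "cauchy_map A H ` cball 0 1 \<subseteq> cball 0 1"
    proof clarsimp
      fix w :: "'i wps ^ 'n" assume w: "norm w \<le> 1"
      have "norm (cauchy_map A H w) \<le> norm (cauchy_map A H w - H) + norm H"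
        by (metis diff_add_cancel norm_triangle_ineq)
      also have "norm (cauchy_map A H w - H) \<le> 1/2 * norm w"
        using lip[OF w, of 0] H0 by simp
      finally show "norm (cauchy_map A H w) \<le> 1" using w H by simp
    qed
  qed (use lip in \<open>auto simp: dist_norm complete_eq_closed\<close>)
  then show ?thesis using that by auto
qed

section \<open>Transfer of pointwise identities to the algebra\<close>

lemma wps_eq_0I:
  assumes "\<delta> > 0" and "\<And>z. (\<And>j. \<bar>z j\<bar> < \<delta>) \<Longrightarrow> wev z F = 0"
  shows "F = 0"
proof -
  have "mps_of F = 0"
    by (rule psum_eq_0_imp_eq_0[OF conv_half[of F] assms(1)]) (use assms(2) in \<open>auto simp: wev_def\<close>)
  then show ?thesis by (intro mps_of_eqI) simp
qed

definition series_mat :: "('n::finite \<Rightarrow> 'n \<Rightarrow> 'n mps) \<Rightarrow> ('n \<Rightarrow> real) \<Rightarrow> real ^ 'n ^ 'n" where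
  "series_mat C \<omega> = (\<chi> m p. psum (C m p) \<omega>)"

definition series_dmat :: "('n::finite \<Rightarrow> 'n \<Rightarrow> 'n mps) \<Rightarrow> ('n \<Rightarrow> real) \<Rightarrow> real ^ 'n ^ 'n ^ 'n" where
  "series_dmat C \<omega> = (\<chi> m p q. psum (pd q (C m p)) \<omega>)"

text \<open>Property (B), restricted to the polydisc on which the Taylor series of the matrices converge.\<close>

definition compatible :: "('i::finite \<Rightarrow> 'n::finite \<Rightarrow> 'n \<Rightarrow> 'n mps) \<Rightarrow> bool" where
  "compatible A \<longleftrightarrow> (\<forall>\<omega>. (\<forall>q. \<bar>\<omega> q\<bar> \<le> 1) \<longrightarrow> (\<forall>i k.
     series_mat (A i) \<omega> ** series_mat (A k) \<omega> = series_mat (A k) \<omega> ** series_mat (A i) \<omega> \<and>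
     (\<forall>v. matd (series_dmat (A i) \<omega>) (series_mat (A k) \<omega> *v v) *v v
         - matd (series_dmat (A k) \<omega>) (series_mat (A i) \<omega> *v v) *v v
         + series_mat (A i) \<omega> *v (matd (series_dmat (A k) \<omega>) v *v v)
         - series_mat (A k) \<omega> *v (matd (series_dmat (A i) \<omega>) v *v v) = 0)))"

text \<open>Written as a quadratic form in v, the expression has coefficients that do not involve v.
  This matters because v will be the x-derivative of a solution, a formal series to which
  \<open>wev\<close> does not apply.\<close>

lemma compat_expand:
  fixes d d' :: "'a::comm_ring_1 ^ 'n ^ 'n ^ 'n" and a a' :: "'a ^ 'n ^ 'n"
  shows "(matd d (a' *v v) *v v - matd d' (a *v v) *v v + a *v (matd d' v *v v) - a' *v (matd d v *v v)) $ m
    = (\<Sum>p\<in>UNIV. \<Sum>s\<in>UNIV. (\<Sum>q\<in>UNIV. d $ m $ p $ q * a' $ q $ s - d' $ m $ p $ q * a $ q $ s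
        + a $ m $ q * d' $ q $ p $ s - a' $ m $ q * d $ q $ p $ s) * v $ s * v $ p)"
proof -
  have e1: "(matd d (a *v v) *v v) $ m
      = (\<Sum>p\<in>UNIV. \<Sum>s\<in>UNIV. \<Sum>q\<in>UNIV. d $ m $ p $ q * a $ q $ s * v $ s * v $ p)"
    for d :: "'a ^ 'n ^ 'n ^ 'n" and a
    by (simp add: matd_def matrix_vector_mult_def sum_distrib_left sum_distrib_right mult_ac)
       (subst sum.swap[of _ "UNIV::'n set"], simp)
  have e2: "(a *v (matd d v *v v)) $ m
      = (\<Sum>p\<in>UNIV. \<Sum>s\<in>UNIV. \<Sum>q\<in>UNIV. a $ m $ q * d $ q $ p $ s * v $ s * v $ p)"
    for d :: "'a ^ 'n ^ 'n ^ 'n" and a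
  proof -
    have "(a *v (matd d v *v v)) $ m
        = (\<Sum>q\<in>UNIV. \<Sum>p\<in>UNIV. \<Sum>s\<in>UNIV. a $ m $ q * d $ q $ p $ s * v $ s * v $ p)"
      by (simp add: matd_def matrix_vector_mult_def sum_distrib_left sum_distrib_right mult_ac)
    also have "\<dots> = (\<Sum>p\<in>UNIV. \<Sum>q\<in>UNIV. \<Sum>s\<in>UNIV. a $ m $ q * d $ q $ p $ s * v $ s * v $ p)"
      by (rule sum.swap)
    also have "\<dots> = (\<Sum>p\<in>UNIV. \<Sum>s\<in>UNIV. \<Sum>q\<in>UNIV. a $ m $ q * d $ q $ p $ s * v $ s * v $ p)"
      by (intro sum.cong refl sum.swap)
    finally show ?thesis .
  qed
  show ?thesis
    unfolding vector_minus_component vector_add_component e1 e2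
    by (simp add: sum.distrib sum_subtractf algebra_simps sum_distrib_left)
qed

text \<open>Polarisation: the form is evaluated at two unit vectors and at their sum.\<close>

lemma quadratic_form_eq_0:
  fixes T :: "'n::finite \<Rightarrow> 'n \<Rightarrow> real"
  assumes "\<And>v. (\<Sum>p\<in>UNIV. \<Sum>s\<in>UNIV. T p s * v s * v p) = 0"
  shows "T p s + T s p = 0"
proof -
  let ?Q = "\<lambda>v. \<Sum>p\<in>UNIV. \<Sum>s\<in>UNIV. T p s * v s * v p"
  let ?e = "\<lambda>p j. if j = p then 1 else (0::real)"
  have B: "(\<Sum>p\<in>UNIV. \<Sum>s\<in>UNIV. T p s * ?e b s * ?e a p) = T a b" for a b
  proof -
    have "(\<Sum>p\<in>UNIV. \<Sum>s\<in>UNIV. T p s * ?e b s * ?e a p) = (\<Sum>p\<in>UNIV. \<Sum>s\<in>UNIV. if s = b then (if p = a then T p s else 0) else 0)"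
      by (intro sum.cong refl) simp
    then show ?thesis by simp
  qed
  have "?Q (\<lambda>j. ?e p j + ?e s j) = T p p + T p s + T s p + T s s"
    by (simp only: distrib_left distrib_right sum.distrib B)
  moreover have "T p p = 0" "T s s = 0"
    using assms[of "?e p"] assms[of "?e s"] unfolding B .
  ultimately show ?thesis using assms[of "\<lambda>j. ?e p j + ?e s j"] by simp
qed

lemma sum_symmetrize_eq_0:
  fixes T :: "'n::finite \<Rightarrow> 'n \<Rightarrow> 'a::{comm_ring_1, real_algebra_1}"
  assumes "\<And>p s. T p s + T s p = 0"
  shows "(\<Sum>p\<in>UNIV. \<Sum>s\<in>UNIV. T p s * v s * v p) = 0"
proof -
  let ?S = "\<Sum>p\<in>UNIV. \<Sum>s\<in>UNIV. T p s * v s * v p"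
  have "?S + ?S = ?S + (\<Sum>p\<in>UNIV. \<Sum>s\<in>UNIV. T s p * v p * v s)"
    by (subst (2) sum.swap) simp
  also have "\<dots> = (\<Sum>p\<in>UNIV. \<Sum>s\<in>UNIV. (T p s + T s p) * v s * v p)"
    by (simp add: sum.distrib algebra_simps)
  finally have "?S + ?S = 0" by (simp add: assms)
  then have "2 *\<^sub>R ?S = 0" by (simp add: scaleR_2)
  then show ?thesis by simp
qed

text \<open>Compatibility speaks of real points, \<open>integrability\<close> of formal series. The
  entries of the commutators and the symmetrised coefficients of the quadratic identity are elements
  of \<open>wps\<close> that vanish at all small real points, hence are 0; only afterwards is the
  formal series v inserted.\<close>

lemma solution_of_euler:
  fixes A :: "'i::finite \<Rightarrow> 'n::finite \<Rightarrow> 'n \<Rightarrow> 'n mps" and w :: "'i wps ^ 'n"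
  assumes A: "\<And>i m p. conv 2 (A i m p)" and compat: "compatible A" and w: "norm w \<le> 1"
    and eul: "\<And>m. euler (mps_of (w $ m)) = (\<Sum>i\<in>UNIV. mvar (Some i) *
      (\<Sum>p\<in>UNIV. mps_of (psum (A i m p) (\<lambda>q. w $ q)) * pd None (mps_of (w $ p))))"
  shows "pd (Some k) (mps_of (w $ m)) = (\<Sum>p\<in>UNIV. mps_of (psum (A k m p) (\<lambda>q. w $ q)) * pd None (mps_of (w $ p)))"
proof -
  define a where "a i m p = psum (A i m p) (\<lambda>q. w $ q)" for i m p
  define d where "d i m p q = psum (pd q (A i m p)) (\<lambda>q. w $ q)" for i m p q
  have wq: "norm (w $ q) \<le> 1" for q using Finite_Cartesian_Product.norm_nth_le[of w q] w by auto
  have A1: "conv 1 (A i m p)" and dA: "conv 1 (pd q (A i m p))" for i m p q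
    using conv_mono[OF A] conv_pd[of 1 "A i m p" q] A by simp_all
  have ev: "wev z (a i m p) = psum (A i m p) (\<lambda>q. wev z (w $ q))"
      "wev z (d i m p q) = psum (pd q (A i m p)) (\<lambda>q. wev z (w $ q))" if "\<And>j. \<bar>z j\<bar> < 1/2" for z i m p q
    unfolding a_def d_def using that
    by (auto intro!: wev_psum[OF _ A1] wev_psum[OF _ dA] wq less_imp_le)
  have ev1: "\<bar>wev z (w $ q)\<bar> \<le> 1" if "\<And>j. \<bar>z j\<bar> < 1/2" for z q
    using abs_wev_le[of z "w $ q"] that wq[of q] by (force intro: less_imp_le order_trans)
  define Wv where "Wv = (\<chi> m. mps_of (w $ m))"
  define av where "av i = (\<chi> m p. mps_of (a i m p))" for i
  define dv where "dv i = (\<chi> m p q. mps_of (d i m p q))" for i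
  have comm: "av i ** av k = av k ** av i" for i k
  proof -
    have "(\<Sum>q\<in>UNIV. a i m q * a k q p) - (\<Sum>q\<in>UNIV. a k m q * a i q p) = 0" for m p
    proof (rule wps_eq_0I[of "1/2"])
      fix z :: "'i option \<Rightarrow> real" assume z: "\<And>j. \<bar>z j\<bar> < 1/2"
      then have z': "\<And>j. \<bar>z j\<bar> \<le> 1/2" by (simp add: less_imp_le)
      show "wev z ((\<Sum>q\<in>UNIV. a i m q * a k q p) - (\<Sum>q\<in>UNIV. a k m q * a i q p)) = 0"
        using compat ev1[OF z]
        by (simp add: wev_diff[OF z'] wev_sum[OF z'] wev_times[OF z'] ev[OF z] compatible_def
            series_mat_def matrix_matrix_mult_def vec_eq_iff)
    qed simp
    then have "mps_of (\<Sum>q\<in>UNIV. a i m q * a k q p) = mps_of (\<Sum>q\<in>UNIV. a k m q * a i q p)" for m p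
      by simp
    then show ?thesis by (simp add: av_def vec_eq_iff matrix_matrix_mult_def)
  qed
  define T where "T i k m p s = (\<Sum>q\<in>UNIV. d i m p q * a k q s - d k m p q * a i q s
        + a i m q * d k q p s - a k m q * d i q p s)" for i k m p s
  have T: "T i k m p s + T i k m s p = 0" for i k m p s
  proof (rule wps_eq_0I[of "1/2"])
    fix z :: "'i option \<Rightarrow> real" assume z: "\<And>j. \<bar>z j\<bar> < 1/2"
    then have z': "\<And>j. \<bar>z j\<bar> \<le> 1/2" by (simp add: less_imp_le)
    have "(\<Sum>p\<in>UNIV. \<Sum>s\<in>UNIV. wev z (T i k m p s) * v s * v p) = 0" for v
    proof -
      let ?\<omega> = "\<lambda>q. wev z (w $ q)"
      have "(matd (series_dmat (A i) ?\<omega>) (series_mat (A k) ?\<omega> *v vec_lambda v) *v vec_lambda v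
          - matd (series_dmat (A k) ?\<omega>) (series_mat (A i) ?\<omega> *v vec_lambda v) *v vec_lambda v
          + series_mat (A i) ?\<omega> *v (matd (series_dmat (A k) ?\<omega>) (vec_lambda v) *v vec_lambda v)
          - series_mat (A k) ?\<omega> *v (matd (series_dmat (A i) ?\<omega>) (vec_lambda v) *v vec_lambda v)) $ m = 0"
        by (subst compat[unfolded compatible_def, rule_format, THEN conjunct2, rule_format, OF ev1[OF z]]) simp
      then show ?thesis
        unfolding compat_expand
        by (simp add: T_def wev_diff[OF z'] wev_add[OF z'] wev_sum[OF z'] wev_times[OF z'] ev[OF z]
            series_mat_def series_dmat_def)
    qed
    then have "wev z (T i k m p s) + wev z (T i k m s p) = 0"
      by (rule quadratic_form_eq_0)
    then show "wev z (T i k m p s + T i k m s p) = 0" by (simp add: wev_add[OF z'])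
  qed simp
  define v where "v = vmap (pd None) Wv"
  have "vmap (pd (Some k)) Wv = av k *v v"
    unfolding v_def
  proof (rule integrability[where d = dv], unfold v_def[symmetric])
    show "vmap (vmap (pd j)) (av i) = matd (dv i) (vmap (pd j) Wv)" for i j
      unfolding vec_eq_iff
      by (simp add: av_def dv_def matd_def Wv_def a_def d_def pd_psum[where r = 1, OF _ _ wq] A)
    show "av i ** av k = av k ** av i" for i k by (rule comm)
    show "vmap euler Wv = (\<Sum>i\<in>UNIV. mvar (Some i) *s (av i *v v))"
      using eul by (simp add: vec_eq_iff Wv_def av_def v_def a_def matrix_vector_mult_def)
    show "matd (dv i) (av k *v v) *v v - matd (dv k) (av i *v v) *v v
        + av i *v (matd (dv k) v *v v) - av k *v (matd (dv i) v *v v) = 0" for i k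
    proof -
      have M: "mps_of (T i k m p s) + mps_of (T i k m s p) = 0" for m p s
        using arg_cong[OF T, of mps_of] by simp
      have "(matd (dv i) (av k *v v) *v v - matd (dv k) (av i *v v) *v v
        + av i *v (matd (dv k) v *v v) - av k *v (matd (dv i) v *v v)) $ m
          = (\<Sum>p\<in>UNIV. \<Sum>s\<in>UNIV. mps_of (T i k m p s) * v $ s * v $ p)" for m
        unfolding compat_expand by (simp add: T_def dv_def av_def)
      then show ?thesis
        by (simp add: vec_eq_iff sum_symmetrize_eq_0[OF M])
    qed
  qed
  then show ?thesis
    by (simp add: vec_eq_iff Wv_def av_def v_def a_def matrix_vector_mult_def)
qed

section \<open>Auxiliary facts on derivatives and on initial data\<close>

lemma partial_derivative_eq:
  assumes "(f has_derivative f') (at x)"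
  shows "partial_derivative i f x = f' (axis i 1)"
proof -
  have "((\<lambda>t. x + t *\<^sub>R axis i 1) has_derivative (\<lambda>t. t *\<^sub>R axis i 1)) (at 0)"
    by (auto intro!: derivative_eq_intros)
  moreover have "(f has_derivative f') (at (x + 0 *\<^sub>R axis i 1))"
    using assms by simp
  ultimately have "((\<lambda>t. f (x + t *\<^sub>R axis i 1)) has_derivative (\<lambda>t. f' (t *\<^sub>R axis i 1))) (at 0)"
    by (rule has_derivative_compose)
  then have "((\<lambda>t. f (x + t *\<^sub>R axis i 1)) has_vector_derivative f' (axis i 1)) (at 0)"
    using has_derivative_linear[OF assms] by (simp add: has_vector_derivative_def linear_scale)
  then show ?thesis
    unfolding partial_derivative_def by (rule vector_derivative_at)
qed

lemma has_derivative_matrix: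
  fixes f :: "'n::finite \<Rightarrow> 'm::finite \<Rightarrow> 'a::real_normed_vector \<Rightarrow> real"
  assumes "\<And>i j. (f i j has_derivative f' i j) (at x within S)"
  shows "((\<lambda>x. \<chi> i j. f i j x) has_derivative (\<lambda>h. \<chi> i j. f' i j h)) (at x within S)"
  unfolding has_derivative_componentwise_within[of "\<lambda>x. \<chi> i j. f i j x"]
  using assms by (auto simp: Basis_vec_def inner_axis)

lemma differentiable_matrix:
  fixes A :: "'a::real_normed_vector \<Rightarrow> real ^ 'm ^ 'n"
  assumes "\<And>i j. (\<lambda>x. A x $ i $ j) differentiable (at x)"
  shows "A differentiable (at x)"
proof -
  from assms obtain f' where "\<And>i j. ((\<lambda>x. A x $ i $ j) has_derivative f' i j) (at x)"
    unfolding differentiable_def by metis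
  from has_derivative_matrix[of "\<lambda>i j x. A x $ i $ j", OF this] show ?thesis
    unfolding differentiable_def by auto
qed

text \<open>Without constant term every monomial has a factor to spare: s^d \<le> (s/r) r^d for d
  \<ge> 1. Shrinking s thereby makes the normalised initial data small.\<close>

lemma norm_psum_small:
  fixes Z :: "'j::finite \<Rightarrow> 'a::{real_normed_algebra_1, comm_ring_1, banach}"
  assumes c: "conv r c" "mcoeff c 0 = 0" and Z: "\<And>j. norm (Z j) \<le> s" and s: "0 \<le> s" "s \<le> r" "0 < r"
  shows "norm (psum c Z) \<le> s / r * wnorm (\<lambda>\<alpha>. r ^ index_degree \<alpha>) c"
proof -
  let ?w = "\<lambda>\<alpha>. s ^ index_degree \<alpha>"
  have cs: "wsummable ?w c"
    using conv_mono[OF c(1) s(1,2)] by (simp add: conv_def)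
  have "norm (psum c Z) \<le> wnorm ?w c"
    by (rule norm_psum_le[OF cs norm_zpow_le_power[OF Z]])
  also have "\<dots> \<le> s / r * wnorm (\<lambda>\<alpha>. r ^ index_degree \<alpha>) c"
  proof (rule has_sum_mono[OF wsummable_has_sum[OF cs] has_sum_cmult_right[OF wsummable_has_sum]])
    show "wsummable (\<lambda>\<alpha>. r ^ index_degree \<alpha>) c" using c by (simp add: conv_def)
    fix \<alpha> :: "'j \<Rightarrow> nat"
    show "\<bar>mcoeff c \<alpha>\<bar> * ?w \<alpha> \<le> s / r * (\<bar>mcoeff c \<alpha>\<bar> * r ^ index_degree \<alpha>)"
    proof (cases "index_degree \<alpha>")
      case 0
      then have "\<alpha> = 0" by simp
      then have "mcoeff c \<alpha> = 0" using c(2) by (simp only:)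
      then show ?thesis by simp
    next
      case (Suc n)
      have "?w \<alpha> = s * s ^ n" by (simp add: Suc)
      also have "\<dots> \<le> s * r ^ n" using s by (intro mult_left_mono power_mono) auto
      also have "\<dots> = s / r * r ^ index_degree \<alpha>" using s by (simp add: Suc)
      finally have "\<bar>mcoeff c \<alpha>\<bar> * ?w \<alpha> \<le> \<bar>mcoeff c \<alpha>\<bar> * (s / r * r ^ index_degree \<alpha>)"
        by (intro mult_left_mono) auto
      then show ?thesis by (simp add: mult_ac)
    qed
  qed
  finally show ?thesis .
qed

lemma wev_space_part:
  assumes z: "\<And>j. \<bar>z j\<bar> \<le> 1/2"
  shows "wev z (space_part F) = wev (case_option (z None) (\<lambda>_. 0)) F"
proof -
  have z': "\<bar>case_option (z None) (\<lambda>_. 0) j\<bar> \<le> 1/2" for j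
    using z[of None] by (simp split: option.splits)
  have "mcoeff (mps_of (space_part F)) \<gamma> * zpow z \<gamma>
      = mcoeff (mps_of F) \<gamma> * zpow (case_option (z None) (\<lambda>_. 0)) \<gamma>" for \<gamma>
  proof (cases "time_degree \<gamma> = 0")
    case True
    then have "\<gamma> (Some i) = 0" for i by (simp add: time_degree_def)
    then have "zpow (z' \<circ> Some) (\<gamma> \<circ> Some) = 1" for z' :: "'a option \<Rightarrow> real"
      by (simp add: zpow_def)
    with True show ?thesis by (simp add: mcoeff_space_part zpow_option)
  next
    case False
    then have "index_degree (\<gamma> \<circ> Some) \<noteq> 0"
      unfolding index_degree_def time_degree_def by (simp only: o_def not_False_eq_True)
    then have "zpow (case_option (z None) (\<lambda>_. 0) \<circ> Some) (\<gamma> \<circ> Some) = (0::real)"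
      by (simp add: o_def zpow_const power_0_left del: index_degree_eq_0)
    with False show ?thesis by (simp add: mcoeff_space_part zpow_option)
  qed
  then show ?thesis
    using wev_has_sum[where z = z, OF z, of "space_part F"]
      wev_has_sum[where z = "case_option (z None) (\<lambda>_. 0)", OF z', of F]
    by (simp add: has_sum_unique)
qed

lemma space_part_eqI:
  assumes "\<And>x. \<bar>x\<bar> < \<delta> \<Longrightarrow> wev (case_option x (\<lambda>_. 0)) F = wev (case_option x (\<lambda>_. 0)) G" "\<delta> > 0"
  shows "space_part F = space_part G"
proof -
  have "space_part F - space_part G = 0"
  proof (rule wps_eq_0I[of "min \<delta> (1/2)"])
    fix z :: "'a option \<Rightarrow> real" assume z: "\<And>j. \<bar>z j\<bar> < min \<delta> (1/2)"
    then have z': "\<And>j. \<bar>z j\<bar> \<le> 1/2" by (simp add: less_imp_le)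
    show "wev z (space_part F - space_part G) = 0"
      using assms(1)[of "z None"] z[of None] by (simp add: wev_diff[OF z'] wev_space_part[OF z'])
  qed (use assms in auto)
  then show ?thesis by simp
qed

lemma space_part_psum:
  assumes c: "conv r c" and s: "\<bar>s\<bar> \<le> r"
  shows "space_part (psum c (\<lambda>_::'k::finite. s *\<^sub>R wvar None)) = psum c (\<lambda>_. s *\<^sub>R wvar None)" (is "space_part ?F = ?F")
proof -
  have nZ: "norm (s *\<^sub>R wvar None :: 'a wps) \<le> r" using s by simp
  have "space_part ?F - ?F = 0"
  proof (rule wps_eq_0I[of "1/2"])
    fix z :: "'a option \<Rightarrow> real" assume z: "\<And>j. \<bar>z j\<bar> < 1/2"
    then have z': "\<And>j. \<bar>z j\<bar> \<le> 1/2" by (simp add: less_imp_le)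
    have z'': "\<bar>case_option (z None) (\<lambda>_. 0) j\<bar> \<le> 1/2" for j
      using z'[of None] by (simp split: option.splits)
    show "wev z (space_part ?F - ?F) = 0"
      unfolding wev_diff[OF z'] wev_space_part[OF z'] wev_psum[OF z' c nZ] wev_psum[OF z'' c nZ]
      by (simp add: wev_scaleR[OF z'] wev_scaleR[OF z''] wev_wvar[OF z'] wev_wvar[OF z''])
  qed simp
  then show ?thesis by simp
qed

lemma space_part_cauchy_map:
  assumes "cauchy_map A H w = w" "\<And>m. space_part (H $ m) = H $ m"
  shows "space_part (w $ m) = H $ m"
proof (intro mps_of_eqI mps_eqI)
  fix \<gamma>
  have "mcoeff (mps_of (H $ m)) \<gamma> = 0" if "time_degree \<gamma> \<noteq> 0"
    using mcoeff_space_part[of "H $ m" \<gamma>] assms(2)[of m] that by simp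
  moreover have "mcoeff (mps_of (w $ m)) \<gamma> = mcoeff (mps_of (H $ m)) \<gamma>" if "time_degree \<gamma> = 0"
  proof -
    have "mcoeff (mps_of (w $ m)) \<gamma> = mcoeff (mps_of (cauchy_map A H w $ m)) \<gamma>"
      by (simp add: assms(1))
    also have "\<dots> = mcoeff (mps_of (H $ m)) \<gamma>"
      using that by (simp add: cauchy_map_def mps_of_cauchy_op time_integral_def)
    finally show ?thesis .
  qed
  ultimately show "mcoeff (mps_of (space_part (w $ m))) \<gamma> = mcoeff (mps_of (H $ m)) \<gamma>"
    by (simp add: mcoeff_space_part)
qed

section \<open>Quasilinear systems with compatible matrices\<close>

text \<open>All coordinates, including the distinguished one \<open>e0\<close>, act as times:
  \<open>A i\<close> is the matrix for the derivative in direction i, and the equation in direction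
  \<open>e0\<close> is trivial by \<open>A_e0\<close>. The assumption \<open>compat\<close> is
  Property (B) at the point u for the vector v, in the form to which \<open>op_bracket_eq\<close>
  reduces it.\<close>

locale quasilinear =
  fixes U :: "(real ^ 'n) set" and A :: "'n \<Rightarrow> real ^ 'n \<Rightarrow> real ^ 'n ^ 'n" and e0 :: 'n
  assumes U: "open U"
    and analytic: "u \<in> U \<Longrightarrow> analytic_at (\<lambda>u. A i u $ m $ p) u"
    and comm: "u \<in> U \<Longrightarrow> A i u ** A k u = A k u ** A i u"
    and A_e0: "u \<in> U \<Longrightarrow> A e0 u = mat 1"
    and compat: "u \<in> U \<Longrightarrow>
        frechet_derivative (A i) (at u) (A k u *v v) *v v - frechet_derivative (A k) (at u) (A i u *v v) *v v
        + A i u *v (frechet_derivative (A k) (at u) v *v v) - A k u *v (frechet_derivative (A i) (at u) v *v v) = 0"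
begin

text \<open>Taylor series of all matrices in the rescaled variable \<omega>, where u = u0 + \<rho>
  \<omega>. Solutions will have |\<omega> q| \<le> 1; the radii 4 and 2 leave room for
  differentiating the series at such \<omega>.\<close>

definition expansion :: "real ^ 'n \<Rightarrow> real \<Rightarrow> ('n \<Rightarrow> 'n \<Rightarrow> 'n \<Rightarrow> 'n mps) \<Rightarrow> bool" where
  "expansion u0 \<rho> C \<longleftrightarrow> \<rho> > 0 \<and> (\<forall>i m p. conv 4 (C i m p)) \<and>
     (\<forall>\<omega>. (\<forall>q. \<bar>\<omega> q\<bar> \<le> 2) \<longrightarrow> u0 + \<rho> *\<^sub>R vec_lambda \<omega> \<in> U \<and> (\<forall>i. series_mat (C i) \<omega> = A i (u0 + \<rho> *\<^sub>R vec_lambda \<omega>)))"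

lemma expansion_exists:
  assumes u0: "u0 \<in> U"
  obtains \<rho> C where "expansion u0 \<rho> C"
proof -
  have "\<forall>i m p. \<exists>r c. series_at (\<lambda>u. A i u $ m $ p) u0 r c"
    using analytic[OF u0] by (simp add: analytic_at_def)
  then obtain r c where rc: "\<And>i m p. series_at (\<lambda>u. A i u $ m $ p) u0 (r i m p) (c i m p)"
    by metis
  obtain e where e: "e > 0" "ball u0 e \<subseteq> U"
    using U u0 by (meson open_contains_ball)
  define R where "R = Min (range (\<lambda>(i, m, p). r i m p))"
  have Rle: "R \<le> r i m p" for i m p
  proof -
    have "R \<le> (\<lambda>(i, m, p). r i m p) (i, m, p)" unfolding R_def by (intro Min_le rangeI) auto
    then show ?thesis by simp
  qed
  have R: "R > 0"
    unfolding R_def using rc by (subst Min_gr_iff) (auto simp: series_at_def)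
  \<comment> \<open>R/4 brings the polydisc of radius 4 in \<omega> into the common domain of
    convergence. If |\<omega> q| \<le> 2 for all q, the l1 norm of \<omega> is at most 2
    \<open>CARD('n)\<close>, so the second bound keeps the point in the ball inside
    \<open>U\<close>.\<close>
  define \<rho> where "\<rho> = min (R / 4) (e / (4 * real CARD('n)))"
  have \<rho>: "\<rho> > 0" "4 * \<rho> \<le> R" "4 * \<rho> * real CARD('n) \<le> e"
    using R e(1) by (auto simp: \<rho>_def min_def field_simps)
  have rc\<rho>: "series_at (\<lambda>u. A i u $ m $ p) u0 (4 * \<rho>) (c i m p)" for i m p
    using series_at_mono[OF rc] \<rho> Rle[of i m p] by simp
  have inU: "u0 + \<rho> *\<^sub>R vec_lambda \<omega> \<in> U" if "\<forall>q. \<bar>\<omega> q\<bar> \<le> 2" for \<omega>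
  proof -
    have "norm (\<rho> *\<^sub>R vec_lambda \<omega>) \<le> \<rho> * (\<Sum>q\<in>UNIV. \<bar>\<omega> q\<bar>)"
      using norm_le_l1_cart[of "vec_lambda \<omega>"] \<rho> by simp
    also have "\<dots> \<le> \<rho> * (\<Sum>q\<in>(UNIV :: 'n set). 2)"
      using that \<rho> by (intro mult_left_mono sum_mono) auto
    also have "\<dots> < e" using \<rho> e by simp
    finally show ?thesis using e(2) by (auto simp: dist_norm subset_iff)
  qed
  have "expansion u0 \<rho> (\<lambda>i m p. rescale \<rho> (c i m p))"
    unfolding expansion_def
  proof (intro conjI allI impI)
    show "conv 4 (rescale \<rho> (c i m p))" for i m p
      using rc\<rho>[of i m p] \<rho> by (simp add: conv_rescale series_at_def)
    fix \<omega> :: "'n \<Rightarrow> real" and i assume \<omega>: "\<forall>q. \<bar>\<omega> q\<bar> \<le> 2"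
    have "\<bar>(\<rho> *\<^sub>R vec_lambda \<omega>) $ j\<bar> \<le> 4 * \<rho>" for j
      using \<omega>[rule_format, of j] \<rho> by (simp add: abs_mult)
    then have "A i (u0 + \<rho> *\<^sub>R vec_lambda \<omega>) $ m $ p = psum (c i m p) (\<lambda>j. (\<rho> *\<^sub>R vec_lambda \<omega>) $ j)" for m p
      using rc\<rho>[of i m p] unfolding series_at_def by blast
    then show "series_mat (\<lambda>m p. rescale \<rho> (c i m p)) \<omega> = A i (u0 + \<rho> *\<^sub>R vec_lambda \<omega>)"
      by (simp add: vec_eq_iff series_mat_def psum_rescale)
  qed (use \<rho> inU in auto)
  then show ?thesis by (rule that)
qed

lemma A_differentiable: "u \<in> U \<Longrightarrow> A i differentiable (at u)"
  by (intro differentiable_matrix analytic_at_differentiable analytic)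

text \<open>The dependence of the matrix on \<omega> is differentiated in two ways, by the chain
  rule and through its series; uniqueness of the derivative identifies the results. The factor
  \<rho> stems from the substitution.\<close>

lemma expansion_derivative:
  assumes E: "expansion u0 \<rho> C" and \<omega>: "\<And>q. \<bar>\<omega> q\<bar> \<le> 1"
  shows "matd (series_dmat (C i) \<omega>) v = \<rho> *\<^sub>R frechet_derivative (A i) (at (u0 + \<rho> *\<^sub>R vec_lambda \<omega>)) v"
proof -
  let ?u = "u0 + \<rho> *\<^sub>R vec_lambda \<omega>"
  let ?F = "frechet_derivative (A i) (at ?u)"
  have \<omega>2: "\<forall>q. \<bar>\<omega> q\<bar> \<le> 2" using \<omega> by (meson one_le_numeral order_trans)
  then have u: "?u \<in> U" using E by (simp add: expansion_def)
  have F: "(A i has_derivative ?F) (at ?u)"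
    using A_differentiable[OF u] by (simp add: frechet_derivative_works)
  have "((\<lambda>x. u0 + \<rho> *\<^sub>R x) has_derivative (\<lambda>h. \<rho> *\<^sub>R h)) (at (vec_lambda \<omega>))"
    by (auto intro!: derivative_eq_intros)
  then have "((\<lambda>x. A i (u0 + \<rho> *\<^sub>R x)) has_derivative (\<lambda>h. ?F (\<rho> *\<^sub>R h))) (at (vec_lambda \<omega>))"
    by (rule has_derivative_compose[where f = "\<lambda>x. u0 + \<rho> *\<^sub>R x" and g = "A i"]) (rule F)
  then have "((\<lambda>x. A i (u0 + \<rho> *\<^sub>R x) $ m $ p) has_derivative (\<lambda>h. ?F (\<rho> *\<^sub>R h) $ m $ p)) (at (vec_lambda \<omega>))" for m p
    by (intro bounded_linear.has_derivative[OF bounded_linear_vec_nth])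
  moreover have "((\<lambda>x. A i (u0 + \<rho> *\<^sub>R x) $ m $ p) has_derivative
      (\<lambda>h. \<Sum>q\<in>UNIV. psum (pd q (C i m p)) (\<lambda>j. vec_lambda \<omega> $ j) * h $ q)) (at (vec_lambda \<omega>))" for m p
  proof -
    have c: "conv 4 (C i m p)" using E by (simp add: expansion_def)
    have b: "\<bar>vec_lambda \<omega> $ j\<bar> < 4 / 2" for j using \<omega>[of j] by simp
    have op: "open {x::real^'n. \<forall>j. \<bar>x $ j\<bar> < 2}"
    proof -
      have "open {x::real^'n. \<bar>x $ j\<bar> < 2}" for j
        by (intro open_Collect_less continuous_intros)
      then show ?thesis by (simp add: Collect_all_eq open_INT)
    qed
    show ?thesis
    proof (rule has_derivative_transform_within_open[OF has_derivative_psum_vec[OF c b] op])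
      show "vec_lambda \<omega> \<in> {x. \<forall>j. \<bar>x $ j\<bar> < 2}" using b by simp
      fix x :: "real ^ 'n" assume "x \<in> {x. \<forall>j. \<bar>x $ j\<bar> < 2}"
      then have "\<forall>j. \<bar>x $ j\<bar> \<le> 2" by (auto intro: less_imp_le)
      then have "series_mat (C i) (\<lambda>j. x $ j) = A i (u0 + \<rho> *\<^sub>R x)"
        using E unfolding expansion_def by (metis vec_nth_inverse)
      from arg_cong[OF this, of "\<lambda>M. M $ m $ p"]
      show "psum (C i m p) (\<lambda>j. x $ j) = A i (u0 + \<rho> *\<^sub>R x) $ m $ p"
        by (simp add: series_mat_def)
    qed
  qed
  ultimately have "(\<lambda>h. ?F (\<rho> *\<^sub>R h) $ m $ p) = (\<lambda>h. \<Sum>q\<in>UNIV. psum (pd q (C i m p)) (\<lambda>j. vec_lambda \<omega> $ j) * h $ q)" for m p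
    by (rule has_derivative_unique)
  from fun_cong[OF this, of v]
  have "?F (\<rho> *\<^sub>R v) $ m $ p = (\<Sum>q\<in>UNIV. psum (pd q (C i m p)) \<omega> * v $ q)" for m p by simp
  then have "?F (\<rho> *\<^sub>R v) = matd (series_dmat (C i) \<omega>) v"
    by (simp add: vec_eq_iff matd_def series_dmat_def)
  then show ?thesis
    using has_derivative_linear[OF F] by (simp add: linear_scale)
qed

text \<open>Compatibility is homogeneous: every term contains two matrices, one of them
  differentiated, and acquires the common factor \<epsilon>^2 \<rho>. Hence the times may be
  rescaled freely.\<close>

lemma expansion_compatible:
  assumes E: "expansion u0 \<rho> C"
  shows "compatible (\<lambda>i m p. \<epsilon> *\<^sub>R C i m p)"
  unfolding compatible_def
proof (intro allI impI conjI)
  fix \<omega> :: "'n \<Rightarrow> real" and i k v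
  assume \<omega>: "\<forall>q. \<bar>\<omega> q\<bar> \<le> 1"
  let ?u = "u0 + \<rho> *\<^sub>R vec_lambda \<omega>"
  have \<omega>2: "\<forall>q. \<bar>\<omega> q\<bar> \<le> 2" using \<omega> by (meson one_le_numeral order_trans)
  then have u: "?u \<in> U" using E by (simp add: expansion_def)
  have \<omega>4: "norm (\<omega> j) \<le> 4" and \<omega>1: "norm (\<omega> j) \<le> 1" for j using \<omega>[rule_format, of j] by auto
  have c: "conv 4 (C i m p)" for i m p using E by (simp add: expansion_def)
  have cd: "conv 1 (pd q (C i m p))" for i m p q
    using conv_pd[of 1 "C i m p" q] conv_mono[OF c, of 2] by simp
  have S: "series_mat (\<lambda>m p. \<epsilon> *\<^sub>R C i m p) \<omega> = \<epsilon> *\<^sub>R A i ?u" for i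
  proof -
    have "series_mat (C i) \<omega> = A i ?u" using E \<omega>2 by (simp add: expansion_def)
    then show ?thesis
      by (simp add: vec_eq_iff series_mat_def conv_psum_scaleR[OF \<omega>4 c])
  qed
  have D: "matd (series_dmat (\<lambda>m p. \<epsilon> *\<^sub>R C i m p) \<omega>) x = (\<epsilon> * \<rho>) *\<^sub>R frechet_derivative (A i) (at ?u) x" for i x
  proof -
    have "matd (series_dmat (\<lambda>m p. \<epsilon> *\<^sub>R C i m p) \<omega>) x = \<epsilon> *\<^sub>R matd (series_dmat (C i) \<omega>) x"
      by (simp add: vec_eq_iff matd_def series_dmat_def conv_psum_scaleR[OF \<omega>1 cd] sum_distrib_left mult_ac)
    then show ?thesis using expansion_derivative[OF E] \<omega> by simp
  qed
  have lin: "linear (frechet_derivative (A i) (at ?u))" for i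
    using A_differentiable[OF u] by (rule linear_frechet_derivative)
  show "series_mat (\<lambda>m p. \<epsilon> *\<^sub>R C i m p) \<omega> ** series_mat (\<lambda>m p. \<epsilon> *\<^sub>R C k m p) \<omega>
      = series_mat (\<lambda>m p. \<epsilon> *\<^sub>R C k m p) \<omega> ** series_mat (\<lambda>m p. \<epsilon> *\<^sub>R C i m p) \<omega>"
    unfolding S by (simp add: scalar_matrix_assoc[symmetric] matrix_scalar_ac comm[OF u])
  let ?F = "\<lambda>i. frechet_derivative (A i) (at ?u)"
  have "(\<epsilon> * \<rho>) *\<^sub>R ?F i ((\<epsilon> *\<^sub>R A k ?u) *v v) *v v = (\<epsilon> * \<epsilon> * \<rho>) *\<^sub>R (?F i (A k ?u *v v) *v v)"
    "(\<epsilon> *\<^sub>R A i ?u) *v ((\<epsilon> * \<rho>) *\<^sub>R ?F k v *v v) = (\<epsilon> * \<epsilon> * \<rho>) *\<^sub>R (A i ?u *v (?F k v *v v))" for i k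
    by (simp_all add: scaleR_matrix_vector_assoc[symmetric] linear_scale[OF lin] matrix_vector_mult_scaleR mult_ac)
  note this[of i k] this[of k i]
  note r = this
  show "matd (series_dmat (\<lambda>m p. \<epsilon> *\<^sub>R C i m p) \<omega>) (series_mat (\<lambda>m p. \<epsilon> *\<^sub>R C k m p) \<omega> *v v) *v v
         - matd (series_dmat (\<lambda>m p. \<epsilon> *\<^sub>R C k m p) \<omega>) (series_mat (\<lambda>m p. \<epsilon> *\<^sub>R C i m p) \<omega> *v v) *v v
         + series_mat (\<lambda>m p. \<epsilon> *\<^sub>R C i m p) \<omega> *v (matd (series_dmat (\<lambda>m p. \<epsilon> *\<^sub>R C k m p) \<omega>) v *v v)
         - series_mat (\<lambda>m p. \<epsilon> *\<^sub>R C k m p) \<omega> *v (matd (series_dmat (\<lambda>m p. \<epsilon> *\<^sub>R C i m p) \<omega>) v *v v) = 0"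
    unfolding S D r
    by (simp only: scaleR_diff_right[symmetric] scaleR_add_right[symmetric] compat[OF u] scaleR_zero_right)
qed

end

lemma conv_sum: "(\<And>x. x \<in> S \<Longrightarrow> conv r (c x)) \<Longrightarrow> 0 \<le> r \<Longrightarrow> conv r (sum c S)"
  by (induction S rule: infinite_finite_induct) (auto intro: conv_0 conv_add)

lemma conv_psum_sum:
  fixes Z :: "'j::finite \<Rightarrow> 'a::{real_normed_algebra_1, comm_ring_1, banach}"
  assumes Z: "\<And>j. norm (Z j) \<le> r" and r: "0 \<le> r" and c: "\<And>x. x \<in> S \<Longrightarrow> conv r (c x)"
  shows "psum (sum c S) Z = (\<Sum>x\<in>S. psum (c x) Z)"
  using c
proof (induction S rule: infinite_finite_induct)
  case (insert x S)
  have "psum (c x + sum c S) Z = psum (c x) Z + psum (sum c S) Z"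
    using insert r by (intro conv_psum_add[OF Z] conv_sum) auto
  then show ?case using insert by simp
qed auto

lemma total_norm_scaleR:
  assumes "\<And>i m p. conv 2 (C i m p)"
  shows "total_norm (\<lambda>i m p. \<epsilon> *\<^sub>R C i m p) = \<bar>\<epsilon>\<bar> * total_norm C"
proof -
  have "wnorm (\<lambda>\<alpha>. 2 ^ index_degree \<alpha>) (\<epsilon> *\<^sub>R C i m p) = \<bar>\<epsilon>\<bar> * wnorm (\<lambda>\<alpha>. 2 ^ index_degree \<alpha>) (C i m p)" for i m p
    by (rule wsummable_scaleR(2)) (use assms in \<open>simp add: conv_def\<close>)
  then show ?thesis by (simp add: total_norm_def sum_distrib_left)
qed

lemma total_norm_nonneg: "0 \<le> total_norm C"
  unfolding total_norm_def by (intro sum_nonneg wnorm_nonneg) auto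

text \<open>\<open>total_norm\<close> is homogeneous, so scaling the matrices, that is, slowing down
  time, produces the contraction constant 1/2.\<close>

lemma small_scale:
  fixes C :: "'i::finite \<Rightarrow> 'n::finite \<Rightarrow> 'n \<Rightarrow> 'n mps"
  assumes "\<And>i m p. conv 2 (C i m p)"
  obtains \<epsilon> where "0 < \<epsilon>" "\<epsilon> \<le> 1" "(real CARD('n) + 1) * total_norm (\<lambda>i m p. \<epsilon> *\<^sub>R C i m p) \<le> 1/2"
proof -
  define K where "K = (real CARD('n) + 1) * total_norm C"
  have K: "0 \<le> K" by (simp add: K_def total_norm_nonneg)
  define \<epsilon> where "\<epsilon> = 1 / (2 * (K + 1))"
  have \<epsilon>: "0 < \<epsilon>" "\<epsilon> \<le> 1" "\<epsilon> * K \<le> 1/2"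
    using K by (auto simp: \<epsilon>_def field_simps)
  have "(real CARD('n) + 1) * total_norm (\<lambda>i m p. \<epsilon> *\<^sub>R C i m p) = \<epsilon> * K"
    using \<epsilon> by (simp add: total_norm_scaleR[OF assms] K_def)
  with \<epsilon> show ?thesis using that by simp
qed

lemma uniform_small:
  fixes K r :: real
  assumes "0 \<le> K" "0 < r"
  obtains s where "0 < s" "s \<le> r" "s / r * K \<le> 1/2"
proof -
  define s where "s = r / (2 * (K + 1))"
  have "s \<le> r"
  proof -
    have "r * 1 \<le> r * (2 * (K + 1))" using assms by (intro mult_left_mono) auto
    then show ?thesis using assms by (simp add: s_def field_simps)
  qed
  moreover have "s / r * K = K / (2 * (K + 1))" using assms by (simp add: s_def)
  then have "s / r * K \<le> 1/2" using assms by (simp add: divide_le_eq)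
  moreover have "0 < s" using assms by (simp add: s_def)
  ultimately show ?thesis using that by blast
qed

context quasilinear
begin

definition solution :: "(real ^ 'n) set \<Rightarrow> (real ^ 'n \<Rightarrow> real ^ 'n) \<Rightarrow> bool" where
  "solution N f \<longleftrightarrow> f ` N \<subseteq> U \<and>
     (\<forall>X\<in>N. \<forall>i. partial_derivative i f X = A i (f X) *v partial_derivative e0 f X)"

lemma expansion_eval:
  assumes E: "expansion u0 \<rho> C" and \<omega>: "\<And>q. \<bar>\<omega> q\<bar> \<le> 1"
  shows "psum (\<epsilon> *\<^sub>R C i m p) \<omega> = \<epsilon> * A i (u0 + \<rho> *\<^sub>R vec_lambda \<omega>) $ m $ p" "u0 + \<rho> *\<^sub>R vec_lambda \<omega> \<in> U"
proof -
  have \<omega>2: "\<forall>q. \<bar>\<omega> q\<bar> \<le> 2" and \<omega>4: "\<And>q. norm (\<omega> q) \<le> 4"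
    using \<omega> by (auto intro: order_trans[of _ 1])
  have "series_mat (C i) \<omega> = A i (u0 + \<rho> *\<^sub>R vec_lambda \<omega>)"
    using E \<omega>2 by (simp add: expansion_def)
  from arg_cong[OF this, of "\<lambda>M. M $ m $ p"]
  have "psum (C i m p) \<omega> = A i (u0 + \<rho> *\<^sub>R vec_lambda \<omega>) $ m $ p" by (simp add: series_mat_def)
  moreover have "conv 4 (C i m p)" using E by (simp add: expansion_def)
  ultimately show "psum (\<epsilon> *\<^sub>R C i m p) \<omega> = \<epsilon> * A i (u0 + \<rho> *\<^sub>R vec_lambda \<omega>) $ m $ p"
    by (simp add: conv_psum_scaleR[OF \<omega>4])
  show "u0 + \<rho> *\<^sub>R vec_lambda \<omega> \<in> U" using E \<omega>2 by (simp add: expansion_def)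
qed

text \<open>The unknown is written as u0 + \<rho> w. Smallness is reached in two independent ways: s
  shrinks the space variable until the initial datum has norm at most 1/2, and \<epsilon> shrinks
  the matrices until the Picard map contracts by 1/2.\<close>

lemma local_solution:
  assumes u0: "h t0 \<in> U"
    and h: "\<And>m. \<exists>r>0. \<exists>c :: unit mps. conv r c \<and> (\<forall>x. \<bar>x\<bar> \<le> r \<longrightarrow> h (t0 + x) $ m = psum c (\<lambda>_. x))"
  obtains R f where "R > 0" "real_analytic_on f (ball (axis e0 t0) R)" "solution (ball (axis e0 t0) R) f"
    "\<And>t. \<bar>t - t0\<bar> < R \<Longrightarrow> f (axis e0 t) = h t"
proof -
  define u0 where "u0 = h t0"
  define p where "p = (axis e0 t0 :: real ^ 'n)"
  have u0U: "u0 \<in> U" using assms by (simp add: u0_def)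
  obtain \<rho> C where E: "expansion u0 \<rho> C" using expansion_exists[OF u0U] .
  have \<rho>: "\<rho> > 0" and C4: "\<And>i m p. conv 4 (C i m p)" using E by (auto simp: expansion_def)
  have C2: "conv 2 (C i m p)" for i m p using conv_mono[OF C4] by simp
  from h obtain r c where rc: "\<And>m. r m > 0" "\<And>m. conv (r m) (c m :: unit mps)"
    "\<And>m x. \<bar>x\<bar> \<le> r m \<Longrightarrow> h (t0 + x) $ m = psum (c m) (\<lambda>_. x)"
    by metis
  define r0 where "r0 = Min (range r)"
  have r0: "r0 > 0" and r0le: "\<And>m. r0 \<le> r m"
    using rc(1) by (auto simp: r0_def)
  \<comment> \<open>The initial curve in the normalised unknown; its constant term vanishes because
    \<open>u0\<close> is the initial value at \<open>t0\<close>.\<close>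
  define \<eta> where "\<eta> m = (1 / \<rho>) *\<^sub>R (c m - (u0 $ m) *\<^sub>R 1)" for m
  have c0: "conv r0 (c m)" for m using conv_mono[OF rc(2)] r0 r0le by (simp add: less_imp_le)
  have \<eta>: "conv r0 (\<eta> m)" for m
    unfolding \<eta>_def using c0 r0 by (intro conv_scaleR conv_diff conv_1) auto
  have \<eta>x: "psum (\<eta> m) (\<lambda>_. x) = (h (t0 + x) $ m - u0 $ m) / \<rho>" if "\<bar>x\<bar> \<le> r0" for m x
  proof -
    have n: "norm x \<le> r0" using that by simp
    have "psum (\<eta> m) (\<lambda>_. x) = (1 / \<rho>) * (psum (c m) (\<lambda>_. x) - u0 $ m)"
      unfolding \<eta>_def using c0 r0
      by (subst conv_psum_scaleR[OF n], intro conv_diff conv_scaleR conv_1)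
         (auto simp: conv_psum_diff[OF n] conv_psum_scaleR[OF n] conv_scaleR conv_1)
    then show ?thesis using rc(3)[of x m] that r0le[of m] by simp
  qed
  have \<eta>0: "mcoeff (\<eta> m) 0 = 0" for m
    using \<eta>x[of 0 m] r0 by (simp add: u0_def psum_at_0)
  define K where "K = (\<Sum>m\<in>UNIV. wnorm (\<lambda>\<alpha>. r0 ^ index_degree \<alpha>) (\<eta> m))"
  have "0 \<le> K" unfolding K_def using r0 by (intro sum_nonneg wnorm_nonneg) auto
  then obtain s where s: "0 < s" "s \<le> r0" "s / r0 * K \<le> 1/2" using uniform_small r0 by metis
  define H where "H = (\<chi> m. (psum (\<eta> m) (\<lambda>_. s *\<^sub>R wvar None) :: 'n wps))"
  have H: "norm H \<le> 1/2"
  proof -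
    have "norm H \<le> (\<Sum>m\<in>UNIV. norm (H $ m))" by (rule norm_vec_le_sum)
    also have "\<dots> \<le> (\<Sum>m\<in>UNIV. s / r0 * wnorm (\<lambda>\<alpha>. r0 ^ index_degree \<alpha>) (\<eta> m))"
    proof (rule sum_mono)
      fix m
      show "norm (H $ m) \<le> s / r0 * wnorm (\<lambda>\<alpha>. r0 ^ index_degree \<alpha>) (\<eta> m)"
        unfolding H_def vec_lambda_beta by (rule norm_psum_small[OF \<eta> \<eta>0]) (use s r0 in auto)
    qed
    also have "\<dots> = s / r0 * K" by (simp add: K_def sum_distrib_left)
    also have "\<dots> \<le> 1/2" by (rule s(3))
    finally show ?thesis .
  qed
  have Hs: "space_part (H $ m) = H $ m" for m
    unfolding H_def using s by (simp add: space_part_psum[OF \<eta>])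
  obtain \<epsilon> where \<epsilon>: "0 < \<epsilon>" "\<epsilon> \<le> 1" "(real CARD('n) + 1) * total_norm (\<lambda>i m p. \<epsilon> *\<^sub>R C i m p) \<le> 1/2"
    using small_scale[of C, OF C2] by metis
  define B where "B = (\<lambda>i m p. \<epsilon> *\<^sub>R C i m p)"
  have B2: "conv 2 (B i m p)" for i m p unfolding B_def by (intro conv_scaleR C2)
  obtain w where w: "norm w \<le> 1" "cauchy_map B H w = w"
    using cauchy_map_fixed_exists[of B H, OF B2 _ H] \<epsilon>(3) unfolding B_def by metis
  have wH: "space_part (w $ m) = H $ m" for m
    by (rule space_part_cauchy_map[OF w(2) Hs])
  have wq: "norm (w $ q) \<le> 1" for q
    using Finite_Cartesian_Product.norm_nth_le[of w q] w by simp
  define W where "W m = mps_of (w $ m)" for m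
  have pde: "pd (Some k) (W m) = (\<Sum>p\<in>UNIV. mps_of (psum (B k m p) (\<lambda>q. w $ q)) * pd None (W p))" for k m
    unfolding W_def
  proof (rule solution_of_euler[OF B2 _ w(1)])
    show "compatible B" unfolding B_def by (rule expansion_compatible[OF E])
    show "euler (mps_of (w $ m)) = (\<Sum>i\<in>UNIV. mvar (Some i) *
        (\<Sum>p\<in>UNIV. mps_of (psum (B i m p) (\<lambda>q. w $ q)) * pd None (mps_of (w $ p))))" for m
      using w(2) unfolding cauchy_map_fixed_iff[of w H B, OF wH] by blast
  qed
  \<comment> \<open>Back to the original unknown. Evaluation points are restricted to radius 1/4
    because \<open>conv_pd\<close> halves the radius 1/2 when the series are differentiated.\<close>
  define G where "G z = u0 + \<rho> *\<^sub>R (\<chi> m. wev z (w $ m))" for z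
  have GU: "G z \<in> U" and pde_eval: "psum (pd (Some k) (W m)) z = \<epsilon> * (\<Sum>p\<in>UNIV. A k (G z) $ m $ p * psum (pd None (W p)) z)"
    if z: "\<And>j. \<bar>z j\<bar> \<le> 1/4" for z k m
  proof -
    have z4: "norm (z j) \<le> 1/4" for j using z[of j] by simp
    have z2: "\<bar>z j\<bar> \<le> 1/2" for j using z[of j] by simp
    have \<omega>: "\<bar>wev z (w $ q)\<bar> \<le> 1" for q
      using abs_wev_le[of z "w $ q", OF z2] wq[of q] by simp
    show "G z \<in> U" unfolding G_def by (rule expansion_eval(2)[OF E \<omega>])
    have cW: "conv (1/4) (mps_of F)" for F :: "'n wps" using conv_mono[OF conv_half[of F]] by simp
    have cpd: "conv (1/4) (pd j (W p))" for j p
      using conv_pd[of "1/4" "W p" j] conv_half[of "w $ p"] by (simp add: W_def)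
    have "psum (pd (Some k) (W m)) z = (\<Sum>p\<in>UNIV. wev z (psum (B k m p) (\<lambda>q. w $ q)) * psum (pd None (W p)) z)"
      unfolding pde wev_def
      by (subst conv_psum_sum[OF z4]) (auto intro!: conv_times cW cpd sum.cong conv_psum_times[OF z4])
    also have "\<dots> = (\<Sum>p\<in>UNIV. \<epsilon> * A k (G z) $ m $ p * psum (pd None (W p)) z)"
    proof (intro sum.cong refl, rule arg_cong2[of _ _ _ _ "(*)"])
      fix p
      have nw: "norm (w $ q) \<le> 2" for q using wq[of q] by simp
      have "wev z (psum (B k m p) (\<lambda>q. w $ q)) = psum (B k m p) (\<lambda>q. wev z (w $ q))"
        by (rule wev_psum[OF z2 B2 nw])
      then show "wev z (psum (B k m p) (\<lambda>q. w $ q)) = \<epsilon> * A k (G z) $ m $ p"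
        unfolding B_def G_def by (simp add: expansion_eval(1)[OF E \<omega>])
    qed simp
    finally show "psum (pd (Some k) (W m)) z = \<epsilon> * (\<Sum>p\<in>UNIV. A k (G z) $ m $ p * psum (pd None (W p)) z)"
      by (simp add: sum_distrib_left mult.assoc)
  qed
  \<comment> \<open>This relation makes shifts in x and in the coordinate \<open>e0\<close>
    interchangeable: as \<open>A e0\<close> is the identity, the \<open>e0\<close>-derivative of w
    is \<epsilon> times its x-derivative, and 1/s = \<epsilon>/R.\<close>
  define R where "R = \<epsilon> * s"
  have R: "R > 0" "R \<le> s" using \<epsilon> s by (auto simp: R_def mult_le_cancel_right1)
  \<comment> \<open>The auxiliary space variable is set to 0; only the times remain as coordinates
    of the solution.\<close>
  define z where "z X = case_option 0 (\<lambda>i. (X - p) $ i / R)" for X :: "real ^ 'n"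
  define f where "f X = G (z X)" for X
  have an: "real_analytic_on f (ball p (R / 2 / 2))"
  proof (rule real_analytic_on_ballI)
    fix m
    let ?d = "(u0 $ m) *\<^sub>R 1 + \<rho> *\<^sub>R rescale (1 / R) (drop_None (w $ m))"
    have cd: "conv (R / 2) (rescale (1 / R) (drop_None (w $ m)))"
      unfolding conv_rescale using R conv_drop_None[of "w $ m"] by simp
    show "series_at (\<lambda>X. f X $ m) p (R / 2) ?d"
      unfolding series_at_def
    proof (intro conjI allI impI)
      show "conv (R / 2) ?d" using R by (intro conv_add conv_scaleR conv_1 cd) auto
      fix v :: "real ^ 'n" assume v: "\<forall>j. \<bar>v $ j\<bar> \<le> R / 2"
      then have n: "norm (v $ j) \<le> R / 2" for j by simp
      have "psum ?d (\<lambda>j. v $ j) = u0 $ m + \<rho> * psum (rescale (1 / R) (drop_None (w $ m))) (\<lambda>j. v $ j)"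
        by (subst conv_psum_add[where r = "R / 2", OF n])
           (auto simp: conv_psum_scaleR[where r = "R / 2", OF n] conv_scaleR conv_1 cd)
      also have "psum (rescale (1 / R) (drop_None (w $ m))) (\<lambda>j. v $ j) = wev (case_option 0 (\<lambda>j. v $ j / R)) (w $ m)"
        using R v by (simp add: psum_rescale psum_drop_None field_simps)
      finally show "f (p + v) $ m = psum ?d (\<lambda>j. v $ j)"
        by (simp add: f_def G_def z_def)
    qed (use R in auto)
  qed
  have sol: "solution (ball p (R / 4)) f"
    unfolding solution_def
  proof (intro conjI ballI allI)
    have z4: "\<bar>z X j\<bar> < 1/4" if X: "X \<in> ball p (R / 4)" for X j
    proof (cases j)
      case (Some i)
      have "\<bar>(X - p) $ i\<bar> < R / 4"
        using component_le_norm_cart[of "X - p" i] X by (simp add: dist_norm norm_minus_commute)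
      then show ?thesis using R Some by (simp add: z_def field_simps)
    qed (simp add: z_def)
    then show "f ` ball p (R / 4) \<subseteq> U" using GU by (auto simp: f_def less_imp_le)
    fix X i assume X: "X \<in> ball p (R / 4)"
    have D: "((\<lambda>X. wev (z X) (w $ m)) has_derivative
        (\<lambda>h. \<Sum>j\<in>UNIV. psum (pd j (W m)) (z X) * case_option 0 (\<lambda>i. h $ i / R) j)) (at X)" for m
      unfolding wev_def W_def
    proof (rule has_derivative_psum[where g = "\<lambda>j X. z X j" and r = "1/2"])
      show "((\<lambda>X. z X j) has_derivative (\<lambda>h. case_option 0 (\<lambda>i. h $ i / R) j)) (at X)" for j
        using R by (cases j) (auto simp: z_def intro!: derivative_eq_intros bounded_linear_imp_has_derivative bounded_linear_vec_nth)
      show "\<bar>z X j\<bar> < 1 / 2 / 2" for j using z4[OF X, of j] by simp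
    qed (rule conv_half)
    have D': "(f has_derivative (\<lambda>h. \<rho> *\<^sub>R (\<chi> m. \<Sum>j\<in>UNIV. psum (pd j (W m)) (z X) * case_option 0 (\<lambda>i. h $ i / R) j))) (at X)"
      unfolding f_def G_def
      using has_derivative_add[OF has_derivative_const[of u0] has_derivative_scaleR_right[OF has_derivative_vec[OF D], of \<rho>]] by simp
    have ax: "axis i 1 $ x / R = (if x = i then 1 / R else 0)" for i x
      by (simp add: axis_def)
    have P: "partial_derivative i f X = (\<rho> / R) *\<^sub>R (\<chi> m. psum (pd (Some i) (W m)) (z X))" for i
      unfolding partial_derivative_eq[OF D'] UNIV_option_conv
      by (subst sum.insert) (auto simp: vec_eq_iff sum.reindex ax if_distrib cong: if_cong)
    have P': "partial_derivative i f X = (\<rho> * \<epsilon> / R) *\<^sub>R (A i (f X) *v (\<chi> p. psum (pd None (W p)) (z X)))" for i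
      unfolding P using pde_eval[of "z X", OF less_imp_le[OF z4[OF X]]]
      by (simp add: vec_eq_iff matrix_vector_mult_def f_def)
    have "A e0 (f X) = mat 1"
      using GU[of "z X", OF less_imp_le[OF z4[OF X]]] by (simp add: f_def A_e0)
    then show "partial_derivative i f X = A i (f X) *v partial_derivative e0 f X"
      unfolding P'[of i] P'[of e0] by (simp add: matrix_vector_mult_scaleR)
  qed
  have init: "f (axis e0 (t0 + t)) = h (t0 + t)" if t: "\<bar>t\<bar> < R / 8" for t
  proof -
    \<comment> \<open>A path from x = t/s at time 0, where w is the initial datum, to x = 0 with
      \<open>e0\<close>-coordinate t/R, where \<open>f\<close> is read off. Along it w is constant,
      because the contributions of x and \<open>e0\<close> to the derivative cancel. The bound R/8
      on t keeps the path within radius 1/4.\<close>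
    define \<zeta> where "\<zeta> \<tau> = case_option ((t - \<tau>) / s) (\<lambda>i. if i = e0 then \<tau> / R else 0)" for \<tau>
    have \<zeta>4: "\<bar>\<zeta> \<tau> j\<bar> < 1/4" if \<tau>: "\<tau> \<in> {-\<bar>t\<bar>..\<bar>t\<bar>}" for \<tau> j
    proof (cases j)
      case None
      have "\<bar>t - \<tau>\<bar> \<le> 2 * \<bar>t\<bar>" using \<tau> unfolding atLeastAtMost_iff by linarith
      then have "\<bar>t - \<tau>\<bar> < s / 4" using t R by simp
      then show ?thesis using s None by (simp add: \<zeta>_def field_simps)
    next
      case (Some i)
      have "\<bar>\<tau>\<bar> \<le> \<bar>t\<bar>" using \<tau> unfolding atLeastAtMost_iff by linarith
      then have "\<bar>\<tau>\<bar> < R / 4" using t R by simp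
      then show ?thesis using R Some by (simp add: \<zeta>_def field_simps)
    qed
    have "f (axis e0 (t0 + t)) $ m = h (t0 + t) $ m" for m
    proof -
      have "((\<lambda>\<tau>. wev (\<zeta> \<tau>) (w $ m)) has_derivative (\<lambda>h. 0)) (at \<tau> within {-\<bar>t\<bar>..\<bar>t\<bar>})"
        if \<tau>: "\<tau> \<in> {-\<bar>t\<bar>..\<bar>t\<bar>}" for \<tau>
      proof -
        have "((\<lambda>\<tau>. wev (\<zeta> \<tau>) (w $ m)) has_derivative
          (\<lambda>h. \<Sum>j\<in>UNIV. psum (pd j (W m)) (\<zeta> \<tau>) * case_option (- h / s) (\<lambda>i. if i = e0 then h / R else 0) j)) (at \<tau> within {-\<bar>t\<bar>..\<bar>t\<bar>})"
          unfolding wev_def W_def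
        proof (rule has_derivative_psum[where g = "\<lambda>j X. \<zeta> X j" and r = "1/2"])
          show "((\<lambda>X. \<zeta> X j) has_derivative (\<lambda>h. case_option (- h / s) (\<lambda>i. if i = e0 then h / R else 0) j)) (at \<tau> within {-\<bar>t\<bar>..\<bar>t\<bar>})" for j
          proof (cases j)
            case (Some i)
            then show ?thesis using R by (cases "i = e0") (auto simp: \<zeta>_def intro!: derivative_eq_intros)
          qed (use s in \<open>auto simp: \<zeta>_def intro!: derivative_eq_intros\<close>)
          show "\<bar>\<zeta> \<tau> j\<bar> < 1 / 2 / 2" for j using \<zeta>4[OF \<tau>, of j] by simp
        qed (rule conv_half)
        moreover have "(\<Sum>j\<in>UNIV. psum (pd j (W m)) (\<zeta> \<tau>) * case_option (- h / s) (\<lambda>i. if i = e0 then h / R else 0) j) = 0" for h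
        proof -
          have z': "\<bar>\<zeta> \<tau> j\<bar> \<le> 1/4" for j using \<zeta>4[OF \<tau>, of j] by simp
          have "psum (pd (Some e0) (W m)) (\<zeta> \<tau>) = \<epsilon> * psum (pd None (W m)) (\<zeta> \<tau>)"
          proof -
            have m1: "(mat 1 :: real ^ 'n ^ 'n) $ m $ p * y = (if p = m then y else 0)" for p y
              by (simp add: mat_def)
            show ?thesis
              unfolding pde_eval[OF z'] A_e0[OF GU[OF z']] m1 by simp
          qed
          then show ?thesis
            unfolding UNIV_option_conv using s \<epsilon>
            by (subst sum.insert) (auto simp: sum.reindex R_def if_distrib[of "\<lambda>x. _ * x"] cong: if_cong)
        qed
        ultimately show ?thesis by simp
      qed
      then obtain k where k: "\<forall>\<tau>\<in>{-\<bar>t\<bar>..\<bar>t\<bar>}. wev (\<zeta> \<tau>) (w $ m) = k"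
        using has_derivative_zero_constant[of "{-\<bar>t\<bar>..\<bar>t\<bar>}" "\<lambda>\<tau>. wev (\<zeta> \<tau>) (w $ m)"] by auto
      have "t \<in> {-\<bar>t\<bar>..\<bar>t\<bar>}" "0 \<in> {-\<bar>t\<bar>..\<bar>t\<bar>}"
        unfolding atLeastAtMost_iff by linarith+
      then have "wev (\<zeta> t) (w $ m) = wev (\<zeta> 0) (w $ m)" using k by metis
      also have "\<zeta> 0 = case_option (\<zeta> 0 None) (\<lambda>_. 0)" by (auto simp: \<zeta>_def fun_eq_iff split: option.splits)
      also have "wev (case_option (\<zeta> 0 None) (\<lambda>_. 0)) (w $ m) = wev (\<zeta> 0) (H $ m)"
      proof -
        have z': "\<bar>\<zeta> 0 j\<bar> \<le> 1/2" for j using \<zeta>4[of 0 j] by simp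
        show ?thesis unfolding wH[symmetric] by (rule wev_space_part[OF z', symmetric])
      qed
      also have "\<dots> = psum (\<eta> m) (\<lambda>_. t)"
      proof -
        have z': "\<bar>\<zeta> 0 j\<bar> \<le> 1/2" for j using \<zeta>4[of 0 j] by simp
        have n: "norm (s *\<^sub>R wvar None :: 'n wps) \<le> r0" using s by simp
        have "wev (\<zeta> 0) (H $ m) = psum (\<eta> m) (\<lambda>_. s * \<zeta> 0 None)"
          unfolding H_def using wev_psum[OF z' \<eta> n]
          by (simp add: wev_scaleR[OF z'] wev_wvar[OF z'])
        then show ?thesis using s by (simp add: \<zeta>_def)
      qed
      also have "\<dots> = (h (t0 + t) $ m - u0 $ m) / \<rho>"
        using t R s by (intro \<eta>x) simp
      finally have "wev (\<zeta> t) (w $ m) = (h (t0 + t) $ m - u0 $ m) / \<rho>" .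
      moreover have "\<zeta> t = z (axis e0 (t0 + t))"
        by (auto simp: \<zeta>_def z_def p_def axis_def fun_eq_iff split: option.splits)
      ultimately show ?thesis using \<rho> by (simp add: f_def G_def)
    qed
    then show ?thesis by (simp add: vec_eq_iff)
  qed
  show ?thesis
  proof (rule that[of "R / 8" f])
    show "R / 8 > 0" using R by simp
    have sub: "ball p (R / 8) \<subseteq> ball p (R / 4)" using R by (intro subset_ball) simp
    show "real_analytic_on f (ball (axis e0 t0) (R / 8))"
      using an sub by (auto simp: real_analytic_on_def p_def)
    show "solution (ball (axis e0 t0) (R / 8)) f"
      using sol sub unfolding solution_def p_def by blast
    show "f (axis e0 t) = h t" if "\<bar>t - t0\<bar> < R / 8" for t
      using init[OF that] by simp
  qed
qed

end

section \<open>Uniqueness near a point of the initial curve\<close>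

context quasilinear
begin

text \<open>
  A solution near \<open>p\<close>, in rescaled coordinates and with an additional space variable along which it is
  translated in the direction \<open>e0\<close>, is a fixed point in the Banach algebra.
\<close>

lemma solution_pullback:
  assumes E: "expansion u0 \<rho> C" and an: "\<And>m. analytic_at (\<lambda>X. f X $ m) p" and fp: "f p = u0"
    and N: "open N" "p \<in> N" and sol: "solution N f"
  shows "\<exists>s0>0. \<forall>s \<epsilon>. 0 < s \<longrightarrow> s \<le> s0 \<longrightarrow> 0 < \<epsilon> \<longrightarrow> \<epsilon> \<le> 1 \<longrightarrow> (\<exists>v :: 'n wps ^ 'n. norm v \<le> 1 \<and>
    (\<forall>z m. (\<forall>j. \<bar>z j\<bar> \<le> 1/2) \<longrightarrow>
      f (p + (\<chi> i. \<epsilon> * s * z (Some i) + (if i = e0 then s * z None else 0))) $ m = u0 $ m + \<rho> * wev z (v $ m)) \<and>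
    (\<forall>m. euler (mps_of (v $ m)) = (\<Sum>i\<in>UNIV. mvar (Some i) *
      (\<Sum>p\<in>UNIV. mps_of (psum (\<epsilon> *\<^sub>R C i m p) (\<lambda>q. v $ q)) * pd None (mps_of (v $ p))))))"
proof -
  have \<rho>: "\<rho> > 0" using E by (simp add: expansion_def)
  have C4: "conv 4 (C i m p)" for i m p using E by (simp add: expansion_def)
  obtain r c where rc: "\<And>m. series_at (\<lambda>X. f X $ m) p (r m) (c m)"
    using an unfolding analytic_at_def by metis
  define r0 where "r0 = Min (range r)"
  have r0: "r0 > 0" and r0le: "\<And>m. r0 \<le> r m"
    using rc by (auto simp: r0_def series_at_def)
  have sr: "series_at (\<lambda>X. f X $ m) p r0 (c m)" for m
    using series_at_mono[OF rc r0 r0le] .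
  have cr: "conv r0 (c m)" for m using sr[of m] by (simp add: series_at_def)
  define c' where "c' m = (1 / \<rho>) *\<^sub>R (c m - (u0 $ m) *\<^sub>R 1)" for m
  have c': "conv r0 (c' m)" for m
    unfolding c'_def using cr r0 by (intro conv_scaleR conv_diff conv_1) auto
  have cx: "f (p + vec_lambda x) $ m = psum (c m) x" if "\<And>j. \<bar>x j\<bar> \<le> r0" for x m
  proof -
    have "\<forall>j. \<bar>vec_lambda x $ j\<bar> \<le> r0" using that by simp
    then have "f (p + vec_lambda x) $ m = psum (c m) (\<lambda>j. vec_lambda x $ j)"
      using sr[of m] unfolding series_at_def by blast
    then show ?thesis by simp
  qed
  have c'x: "psum (c' m) x = (f (p + vec_lambda x) $ m - u0 $ m) / \<rho>" if x: "\<And>j. \<bar>x j\<bar> \<le> r0" for x m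
  proof -
    have n: "norm (x j) \<le> r0" for j using x[of j] by simp
    have "psum (c' m) x = (1 / \<rho>) * (psum (c m) x - u0 $ m)"
      unfolding c'_def using cr r0
      by (subst conv_psum_scaleR[OF n], intro conv_diff conv_scaleR conv_1)
         (auto simp: conv_psum_diff[OF n] conv_psum_scaleR[OF n] conv_scaleR conv_1)
    then show ?thesis using cx[of x, OF x] by simp
  qed
  have "(vec_lambda (\<lambda>_. 0) :: real ^ 'n) = 0" by (simp add: vec_eq_iff)
  then have c'0: "mcoeff (c' m) 0 = 0" for m
    using c'x[of "\<lambda>_. 0" m] r0 by (simp add: psum_at_0 fp)
  \<comment> \<open>The factor 2 anticipates the bound 2 s for \<open>norm (Z i)\<close>.\<close>
  define K where "K = 2 * (\<Sum>m\<in>UNIV. wnorm (\<lambda>\<alpha>. r0 ^ index_degree \<alpha>) (c' m))"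
  have "0 \<le> K" unfolding K_def using r0 by (auto intro!: sum_nonneg wnorm_nonneg)
  then obtain s1 where s1: "0 < s1" "s1 \<le> r0" "s1 / r0 * K \<le> 1/2" using uniform_small r0 by metis
  obtain e where e: "e > 0" "ball p e \<subseteq> N" using N by (meson open_contains_ball)
  define s0 where "s0 = min s1 (min (r0 / 8) (e / (2 * real CARD('n))))"
  have s0: "0 < s0" "s0 \<le> s1" "s0 \<le> r0 / 8" "s0 * real CARD('n) < e"
  proof -
    have "s0 \<le> e / (2 * real CARD('n))" by (simp add: s0_def)
    then have "s0 * real CARD('n) \<le> e / 2" by (simp add: field_simps)
    then show "s0 * real CARD('n) < e" using e by simp
  qed (use s1 r0 e in \<open>auto simp: s0_def\<close>)
  show ?thesis
  proof (intro exI[of _ s0] conjI s0(1) allI impI)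
    fix s \<epsilon> :: real
    assume s: "0 < s" "s \<le> s0" and \<epsilon>: "0 < \<epsilon>" "\<epsilon> \<le> 1"
    have \<epsilon>s: "0 \<le> \<epsilon> * s" "\<epsilon> * s \<le> s" using s \<epsilon> by (auto simp: mult_le_cancel_right1)
    \<comment> \<open>The coordinates of X - p as elements of the algebra: \<epsilon> s times the
      i-th time, and in direction \<open>e0\<close> additionally s times the space variable.\<close>
    define Z where "Z i = (\<epsilon> * s) *\<^sub>R wvar (Some i) + (if i = e0 then s *\<^sub>R wvar None else 0)" for i
    have nZ: "norm (Z i) \<le> 2 * s" for i
    proof -
      have "norm (Z i) \<le> norm ((\<epsilon> * s) *\<^sub>R wvar (Some i)) + norm (if i = e0 then s *\<^sub>R wvar None else 0 :: 'n wps)"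
        unfolding Z_def by (rule norm_triangle_ineq)
      also have "norm ((\<epsilon> * s) *\<^sub>R wvar (Some i)) = \<epsilon> * s"
        using \<epsilon>s(1) by (simp only: norm_scaleR norm_wvar abs_of_nonneg mult_1_right)
      also have "norm (if i = e0 then s *\<^sub>R wvar None else 0 :: 'n wps) \<le> s" using s by simp
      finally show ?thesis using \<epsilon>s(2) by linarith
    qed
    have nZ0: "norm (Z i) \<le> r0 / 2" and nZ1: "norm (Z i) \<le> r0" for i
      using nZ[of i] s s0 r0 by auto
    define v where "v = (\<chi> m. psum (c' m) Z)"
    have nv: "norm v \<le> 1"
    proof -
      have "norm v \<le> (\<Sum>m\<in>UNIV. norm (v $ m))" by (rule norm_vec_le_sum)
      also have "\<dots> \<le> (\<Sum>m\<in>UNIV. (2 * s) / r0 * wnorm (\<lambda>\<alpha>. r0 ^ index_degree \<alpha>) (c' m))"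
      proof (rule sum_mono)
        fix m
        show "norm (v $ m) \<le> (2 * s) / r0 * wnorm (\<lambda>\<alpha>. r0 ^ index_degree \<alpha>) (c' m)"
          unfolding v_def vec_lambda_beta by (rule norm_psum_small[OF c' c'0 nZ]) (use s s0 r0 in auto)
      qed
      also have "\<dots> = s / r0 * K" by (simp add: K_def sum_distrib_left mult_ac)
      also have "\<dots> \<le> s1 / r0 * K"
        using s s0 r0 \<open>0 \<le> K\<close> by (intro mult_right_mono divide_right_mono) auto
      finally show ?thesis using s1(3) by linarith
    qed
    define x where "x z i = \<epsilon> * s * z (Some i) + (if i = e0 then s * z None else 0)" for z :: "'n option \<Rightarrow> real" and i
    have xs: "\<bar>x z i\<bar> \<le> s" if z: "\<And>j. \<bar>z j\<bar> \<le> 1/2" for z i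
    proof -
      have "\<bar>\<epsilon> * s * z (Some i)\<bar> \<le> s * (1/2)"
        unfolding abs_mult using \<epsilon>s z[of "Some i"] by (intro mult_mono) auto
      moreover have "\<bar>if i = e0 then s * z None else 0\<bar> \<le> s * (1/2)"
        using s z[of None] by (auto simp: abs_mult)
      ultimately show ?thesis
        unfolding x_def using abs_triangle_ineq[of "\<epsilon> * s * z (Some i)" "if i = e0 then s * z None else 0"] by linarith
    qed
    have xr: "\<bar>x z i\<bar> \<le> r0" and xr2: "\<bar>x z i\<bar> < r0 / 2" if z: "\<And>j. \<bar>z j\<bar> \<le> 1/2" for z i
      using xs[of z i, OF z] s s0 r0 by auto
    have wZ: "wev z (Z i) = x z i" if z: "\<And>j. \<bar>z j\<bar> \<le> 1/2" for z i
      by (simp add: Z_def x_def wev_add[OF z] wev_scaleR[OF z] wev_wvar[OF z] wev_0[OF z])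
    have wv: "wev z (v $ m) = (f (p + vec_lambda (x z)) $ m - u0 $ m) / \<rho>" if z: "\<And>j. \<bar>z j\<bar> \<le> 1/2" for z m
      unfolding v_def using wev_psum[OF z c' nZ1] c'x[of "x z", OF xr[of z, OF z]] by (simp add: wZ[of z, OF z])
    have c2: "conv (2 * (r0 / 2)) (c' m)" for m using c' by simp
    have cpd: "conv (r0 / 2) (pd j (c' m))" and cpd': "conv (r0 / 2) (pd j (c m))" for j m
      using conv_pd[of "r0 / 2"] c'[of m] cr[of m] r0 by auto
    have pdZ: "pd (Some i) (mps_of (Z j)) = (if i = j then (\<epsilon> * s) *\<^sub>R 1 else 0)"
      "pd None (mps_of (Z j)) = (if j = e0 then s *\<^sub>R 1 else 0)" for i j
      by (auto simp: Z_def pd_mvar)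
    have pdv: "pd (Some i) (mps_of (v $ m)) = mps_of ((\<epsilon> * s) *\<^sub>R psum (pd i (c' m)) Z)"
      "pd None (mps_of (v $ m)) = mps_of (s *\<^sub>R psum (pd e0 (c' m)) Z)" for i m
      using r0 unfolding v_def vec_lambda_beta
      by (simp_all add: pd_psum[OF c2 _ nZ0] pdZ if_distrib cong: if_cong)
    have nvq: "norm (v $ q) \<le> 1" for q using Finite_Cartesian_Product.norm_nth_le[of v q] nv by simp
    \<comment> \<open>An equation in the algebra, checked by evaluation at small real points: there
      it is the system satisfied by \<open>f\<close>, up to the factors \<epsilon>, s and
      \<rho>.\<close>
    have key: "(\<epsilon> * s) *\<^sub>R psum (pd i (c' m)) Z = (\<Sum>p\<in>UNIV. psum (\<epsilon> *\<^sub>R C i m p) (\<lambda>q. v $ q) * (s *\<^sub>R psum (pd e0 (c' p)) Z))" for i m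
    proof -
      have "(\<epsilon> * s) *\<^sub>R psum (pd i (c' m)) Z - (\<Sum>p\<in>UNIV. psum (\<epsilon> *\<^sub>R C i m p) (\<lambda>q. v $ q) * (s *\<^sub>R psum (pd e0 (c' p)) Z)) = 0"
      proof (rule wps_eq_0I[of "1/2"])
        fix z :: "'n option \<Rightarrow> real" assume "\<And>j. \<bar>z j\<bar> < 1/2"
        then have z: "\<And>j. \<bar>z j\<bar> \<le> 1/2" by (simp add: less_imp_le)
        let ?X = "p + vec_lambda (x z)"
        have XN: "?X \<in> N"
        proof -
          have "norm (vec_lambda (x z)) \<le> (\<Sum>i\<in>UNIV. \<bar>x z i\<bar>)"
            using norm_le_l1_cart[of "vec_lambda (x z)"] by simp
          also have "\<dots> \<le> (\<Sum>i\<in>(UNIV::'n set). s)" by (intro sum_mono xs[of z, OF z])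
          also have "\<dots> = s * real CARD('n)" by simp
          also have "\<dots> \<le> s0 * real CARD('n)" using s by (intro mult_right_mono) auto
          finally have "norm (vec_lambda (x z)) < e" using s0 by simp
          then show ?thesis using e by (auto simp: dist_norm subset_iff)
        qed
        have "((\<lambda>X. f X $ m) has_derivative (\<lambda>h. \<Sum>j\<in>UNIV. psum (pd j (c m)) (x z) * h $ j)) (at ?X)" for m
          using series_at_has_derivative[OF sr, of "vec_lambda (x z)" m] xr2[of z, OF z] by simp
        then have "((\<lambda>X. \<chi> m. f X $ m) has_derivative (\<lambda>h. \<chi> m. \<Sum>j\<in>UNIV. psum (pd j (c m)) (x z) * h $ j)) (at ?X)"
          by (rule has_derivative_vec)
        then have "(f has_derivative (\<lambda>h. \<chi> m. \<Sum>j\<in>UNIV. psum (pd j (c m)) (x z) * h $ j)) (at ?X)"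
          by simp
        then have pf: "partial_derivative i f ?X = (\<chi> m. psum (pd i (c m)) (x z))" for i
          by (simp add: partial_derivative_eq axis_def if_distrib cong: if_cong)
        have nx: "norm (x z j) \<le> r0 / 2" for j using xr2[of z j, OF z] by simp
        have pc: "psum (pd i (c' m)) (x z) = psum (pd i (c m)) (x z) / \<rho>" for i m
          unfolding c'_def by (simp add: conv_psum_scaleR[OF nx cpd'])
        have "partial_derivative i f ?X = A i (f ?X) *v partial_derivative e0 f ?X"
          using sol XN unfolding solution_def by blast
        then have eq: "psum (pd i (c m)) (x z) = (\<Sum>p\<in>UNIV. A i (f ?X) $ m $ p * psum (pd e0 (c p)) (x z))"
          unfolding pf by (simp add: vec_eq_iff matrix_vector_mult_def)
        have \<omega>: "\<bar>wev z (v $ q)\<bar> \<le> 1" for q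
          using abs_wev_le[of z "v $ q", OF z] nvq[of q] by simp
        have fX: "u0 + \<rho> *\<^sub>R (\<chi> q. wev z (v $ q)) = f ?X"
          using \<rho> by (simp add: vec_eq_iff wv[of z, OF z])
        have nv2: "norm (v $ q) \<le> 4" for q using nvq[of q] by simp
        have wC: "wev z (psum (\<epsilon> *\<^sub>R C i m p) (\<lambda>q. v $ q)) = \<epsilon> * A i (f ?X) $ m $ p" for p
        proof -
          have "wev z (psum (\<epsilon> *\<^sub>R C i m p) (\<lambda>q. v $ q)) = psum (\<epsilon> *\<^sub>R C i m p) (\<lambda>q. wev z (v $ q))"
            by (rule wev_psum[OF z conv_scaleR[OF C4] nv2])
          then show ?thesis using expansion_eval(1)[OF E \<omega>, of \<epsilon> i m p] fX by simp
        qed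
        have wP: "wev z (psum (pd i (c' m)) Z) = psum (pd i (c m)) (x z) / \<rho>" for i m
          using wev_psum[OF z cpd nZ0] by (simp add: wZ[of z, OF z] pc)
        show "wev z ((\<epsilon> * s) *\<^sub>R psum (pd i (c' m)) Z - (\<Sum>p\<in>UNIV. psum (\<epsilon> *\<^sub>R C i m p) (\<lambda>q. v $ q) * (s *\<^sub>R psum (pd e0 (c' p)) Z))) = 0"
          unfolding wev_diff[OF z] wev_sum[OF z] wev_times[OF z] wev_scaleR[OF z] wC wP eq
          by (simp add: sum_distrib_left sum_divide_distrib mult_ac)
      qed simp
      then show ?thesis by simp
    qed
    show "\<exists>v :: 'n wps ^ 'n. norm v \<le> 1 \<and>
      (\<forall>z m. (\<forall>j. \<bar>z j\<bar> \<le> 1/2) \<longrightarrow>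
        f (p + (\<chi> i. \<epsilon> * s * z (Some i) + (if i = e0 then s * z None else 0))) $ m = u0 $ m + \<rho> * wev z (v $ m)) \<and>
      (\<forall>m. euler (mps_of (v $ m)) = (\<Sum>i\<in>UNIV. mvar (Some i) *
        (\<Sum>p\<in>UNIV. mps_of (psum (\<epsilon> *\<^sub>R C i m p) (\<lambda>q. v $ q)) * pd None (mps_of (v $ p)))))"
    proof (intro exI[of _ v] conjI nv allI impI)
      fix z :: "'n option \<Rightarrow> real" and m assume "\<forall>j. \<bar>z j\<bar> \<le> 1/2"
      then have z: "\<And>j. \<bar>z j\<bar> \<le> 1/2" by simp
      have "(\<chi> i. \<epsilon> * s * z (Some i) + (if i = e0 then s * z None else 0)) = vec_lambda (x z)"
        by (simp add: x_def vec_eq_iff)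
      then show "f (p + (\<chi> i. \<epsilon> * s * z (Some i) + (if i = e0 then s * z None else 0))) $ m = u0 $ m + \<rho> * wev z (v $ m)"
        using wv[of z m, OF z] \<rho> by simp
    next
      fix m
      show "euler (mps_of (v $ m)) = (\<Sum>i\<in>UNIV. mvar (Some i) *
        (\<Sum>p\<in>UNIV. mps_of (psum (\<epsilon> *\<^sub>R C i m p) (\<lambda>q. v $ q)) * pd None (mps_of (v $ p))))"
        unfolding euler_def pdv key by simp
    qed
  qed
qed

text \<open>Both solutions are pulled back with the same scales \<rho>, s and \<epsilon>. Agreement
  on the initial curve means equal space parts, so both are fixed points of one contraction.
  Returning with x = 0 covers a full neighbourhood of the point.\<close>

lemma local_unique:
  assumes an: "\<And>m. analytic_at (\<lambda>X. f X $ m) (axis e0 t0)" "\<And>m. analytic_at (\<lambda>X. g X $ m) (axis e0 t0)"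
    and N: "open N" "axis e0 t0 \<in> N" and sol: "solution N f" "solution N g"
    and \<delta>: "\<delta> > 0" "\<And>t. \<bar>t - t0\<bar> < \<delta> \<Longrightarrow> f (axis e0 t) = g (axis e0 t)"
  shows "eventually (\<lambda>X. f X = g X) (nhds (axis e0 t0))"
proof -
  define p where "p = (axis e0 t0 :: real ^ 'n)"
  define u0 where "u0 = f p"
  have gp: "g p = u0" using \<delta>(2)[of t0] \<delta>(1) by (simp add: u0_def p_def)
  have "u0 \<in> U" using sol(1) N by (auto simp: solution_def u0_def p_def)
  then obtain \<rho> C where E: "expansion u0 \<rho> C" using expansion_exists by metis
  have \<rho>: "\<rho> > 0" and C4: "\<And>i m p. conv 4 (C i m p)" using E by (auto simp: expansion_def)
  have C2: "conv 2 (C i m p)" for i m p using conv_mono[OF C4] by simp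
  obtain \<epsilon> where \<epsilon>: "0 < \<epsilon>" "\<epsilon> \<le> 1" "(real CARD('n) + 1) * total_norm (\<lambda>i m p. \<epsilon> *\<^sub>R C i m p) \<le> 1/2"
    using small_scale[of C, OF C2] by metis
  define B where "B = (\<lambda>i m p. \<epsilon> *\<^sub>R C i m p)"
  have B2: "conv 2 (B i m p)" for i m p unfolding B_def by (intro conv_scaleR C2)
  let ?x = "\<lambda>s z. (\<chi> i. \<epsilon> * s * z (Some i) + (if i = e0 then s * z None else 0))"
  let ?P = "\<lambda>f s v. norm v \<le> 1 \<and>
    (\<forall>z m. (\<forall>j. \<bar>z j\<bar> \<le> 1/2) \<longrightarrow> f (p + ?x s z) $ m = u0 $ m + \<rho> * wev z (v $ m)) \<and>
    (\<forall>m. euler (mps_of (v $ m)) = (\<Sum>i\<in>UNIV. mvar (Some i) *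
      (\<Sum>p\<in>UNIV. mps_of (psum (B i m p) (\<lambda>q. v $ q)) * pd None (mps_of (v $ p)))))"
  have pull: "\<exists>s1>0. \<forall>s. 0 < s \<longrightarrow> s \<le> s1 \<longrightarrow> (\<exists>v :: 'n wps ^ 'n. ?P F s v)"
    if "\<And>m. analytic_at (\<lambda>X. F X $ m) p" "F p = u0" "solution N F" for F
    using solution_pullback[OF E that(1,2) N(1) N(2)[folded p_def] that(3)] \<epsilon>(1,2)
    unfolding B_def by blast
  obtain s1 where s1: "s1 > 0" "\<forall>s. 0 < s \<longrightarrow> s \<le> s1 \<longrightarrow> (\<exists>v :: 'n wps ^ 'n. ?P f s v)"
    using pull[OF an(1)[folded p_def] u0_def[symmetric] sol(1)] by (elim exE conjE) rule
  obtain s2 where s2: "s2 > 0" "\<forall>s. 0 < s \<longrightarrow> s \<le> s2 \<longrightarrow> (\<exists>v :: 'n wps ^ 'n. ?P g s v)"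
    using pull[OF an(2)[folded p_def] gp sol(2)] by (elim exE conjE) rule
  \<comment> \<open>The contraction is the same for both solutions only with a common s; for this
    reason the pullback is available for all sufficiently small s.\<close>
  define s where "s = min s1 s2"
  have s: "s > 0" using s1 s2 by (simp add: s_def)
  obtain v where v: "norm v \<le> 1"
      "\<And>z m. (\<And>j. \<bar>z j\<bar> \<le> 1/2) \<Longrightarrow> f (p + ?x s z) $ m = u0 $ m + \<rho> * wev z (v $ m)"
      "\<forall>m. euler (mps_of (v $ m)) = (\<Sum>i\<in>UNIV. mvar (Some i) *
        (\<Sum>p\<in>UNIV. mps_of (psum (B i m p) (\<lambda>q. v $ q)) * pd None (mps_of (v $ p))))"
    using s1(2)[rule_format, of s] s by (auto simp: s_def)
  obtain v' where v': "norm v' \<le> 1"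
      "\<And>z m. (\<And>j. \<bar>z j\<bar> \<le> 1/2) \<Longrightarrow> g (p + ?x s z) $ m = u0 $ m + \<rho> * wev z (v' $ m)"
      "\<forall>m. euler (mps_of (v' $ m)) = (\<Sum>i\<in>UNIV. mvar (Some i) *
        (\<Sum>p\<in>UNIV. mps_of (psum (B i m p) (\<lambda>q. v' $ q)) * pd None (mps_of (v' $ p))))"
    using s2(2)[rule_format, of s] s by (auto simp: s_def)
  have sp: "space_part (v $ m) = space_part (v' $ m)" for m
  proof (rule space_part_eqI[of "min (1/2) (\<delta> / s)"])
    fix x assume x: "\<bar>x\<bar> < min (1/2) (\<delta> / s)"
    let ?z = "case_option x (\<lambda>_. 0)"
    have z: "\<bar>?z j\<bar> \<le> 1/2" for j using x by (simp split: option.splits)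
    \<comment> \<open>At time 0 the evaluated point runs along the initial curve, where the two
      solutions agree.\<close>
    have "p + ?x s ?z = axis e0 (t0 + s * x)"
      by (simp add: p_def vec_eq_iff axis_def)
    moreover have "\<bar>(t0 + s * x) - t0\<bar> < \<delta>"
      using x s by (simp add: abs_mult field_simps)
    ultimately have "f (p + ?x s ?z) = g (p + ?x s ?z)" using \<delta>(2) by metis
    then show "wev ?z (v $ m) = wev ?z (v' $ m)"
      using v(2)[of ?z m, OF z] v'(2)[of ?z m, OF z] \<rho> by simp
  qed (use \<delta> s in auto)
  define H where "H = (\<chi> m. space_part (v $ m))"
  have fix_v: "cauchy_map B H v = v"
    by (subst cauchy_map_fixed_iff) (simp_all add: H_def v(3))
  have fix_v': "cauchy_map B H v' = v'"
    by (subst cauchy_map_fixed_iff) (simp_all add: H_def v'(3) sp)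
  have vv: "v = v'"
  proof (rule cauchy_map_fixed_unique[where A = B and H = H])
    show "conv 2 (B i m p)" for i m p by (rule B2)
    show "(real CARD('n) + 1) * total_norm B \<le> 1/2" using \<epsilon>(3) by (simp only: B_def)
  qed (fact v(1) fix_v v'(1) fix_v')+
  show ?thesis
    unfolding eventually_nhds_metric p_def[symmetric]
  proof (intro exI[of _ "\<epsilon> * s / 2"] conjI allI impI)
    show "0 < \<epsilon> * s / 2" using s \<epsilon> by simp
    fix X assume X: "dist X p < \<epsilon> * s / 2"
    let ?z = "case_option 0 (\<lambda>i. (X - p) $ i / (\<epsilon> * s))"
    have z: "\<bar>?z j\<bar> \<le> 1/2" for j
    proof (cases j)
      case (Some i)
      have "\<bar>(X - p) $ i\<bar> < \<epsilon> * s / 2"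
        using component_le_norm_cart[of "X - p" i] X by (simp add: dist_norm)
      then show ?thesis using Some s \<epsilon> by (simp add: field_simps)
    qed simp
    have eX: "p + ?x s ?z = X" using s \<epsilon> by (simp add: vec_eq_iff)
    have "f X $ m = g X $ m" for m
      using v(2)[of ?z m, OF z] v'(2)[of ?z m, OF z] unfolding eX vv by simp
    then show "f X = g X" by (simp add: vec_eq_iff)
  qed
qed

end

section \<open>Gluing local solutions along the initial curve\<close>

lemma real_analytic_on_cong_open:
  assumes f: "real_analytic_on f S" and S: "open S" and eq: "\<And>x. x \<in> S \<Longrightarrow> g x = f x"
  shows "real_analytic_on g S"
  unfolding real_analytic_on_def
proof
  fix p assume p: "p \<in> S"
  obtain r c where r: "r > 0" and c: "\<forall>x\<in>ball p r.
      ((\<lambda>\<alpha>. (\<Prod>b\<in>Basis. ((x - p) \<bullet> b) ^ \<alpha> b) *\<^sub>R c \<alpha>) has_sum f x) (Basis \<rightarrow>\<^sub>E UNIV)"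
    using f p unfolding real_analytic_on_def by blast
  obtain e where e: "e > 0" "ball p e \<subseteq> S" using S p by (meson open_contains_ball)
  have "\<forall>x\<in>ball p (min r e).
      ((\<lambda>\<alpha>. (\<Prod>b\<in>Basis. ((x - p) \<bullet> b) ^ \<alpha> b) *\<^sub>R c \<alpha>) has_sum g x) (Basis \<rightarrow>\<^sub>E UNIV)"
  proof
    fix x assume "x \<in> ball p (min r e)"
    then have "x \<in> ball p r" "x \<in> S" using e by auto
    then show "((\<lambda>\<alpha>. (\<Prod>b\<in>Basis. ((x - p) \<bullet> b) ^ \<alpha> b) *\<^sub>R c \<alpha>) has_sum g x) (Basis \<rightarrow>\<^sub>E UNIV)"
      using c eq by metis
  qed
  moreover have "min r e > 0" using r e by simp
  ultimately show "\<exists>r>0. \<exists>c. \<forall>x\<in>ball p r.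
      ((\<lambda>\<alpha>. (\<Prod>b\<in>Basis. ((x - p) \<bullet> b) ^ \<alpha> b) *\<^sub>R c \<alpha>) has_sum g x) (Basis \<rightarrow>\<^sub>E UNIV)"
    by blast
qed

lemma real_analytic_on_UN: "(\<And>i. i \<in> I \<Longrightarrow> real_analytic_on f (S i)) \<Longrightarrow> real_analytic_on f (\<Union>i\<in>I. S i)"
  unfolding real_analytic_on_def by blast

lemma partial_derivative_cong_open:
  assumes "open N" "x \<in> N" "\<And>y. y \<in> N \<Longrightarrow> f y = g y"
  shows "partial_derivative i f x = partial_derivative i g x"
  unfolding partial_derivative_def
proof (rule vector_derivative_cong_eq)
  have "((\<lambda>t::real. x + t *\<^sub>R axis i 1) \<longlongrightarrow> x + 0 *\<^sub>R axis i 1) (nhds 0)"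
    by (intro tendsto_intros filterlim_ident)
  then have "eventually (\<lambda>t::real. x + t *\<^sub>R axis i 1 \<in> N) (nhds 0)"
    using assms(1,2) by (intro topological_tendstoD[where S = N]) auto
  then show "\<forall>\<^sub>F t in nhds 0. t \<in> UNIV \<longrightarrow> f (x + t *\<^sub>R axis i 1) = g (x + t *\<^sub>R axis i 1)"
    by (rule eventually_mono) (use assms(3) in auto)
qed auto

text \<open>Orthogonal projection to the initial line does not increase the distance from a centre
  on that line. Hence two intersecting balls centred on it already meet on the line.\<close>

lemma axis_in_ball:
  assumes "X \<in> ball (axis e0 t) r"
  shows "axis e0 (X $ e0) \<in> ball (axis e0 t :: real ^ 'n) r" "\<bar>X $ e0 - t\<bar> < r"
proof -
  have "\<bar>(X - axis e0 t) $ e0\<bar> < r"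
    using component_le_norm_cart[of "X - axis e0 t" e0] assms by (simp add: dist_norm norm_minus_commute)
  then show t: "\<bar>X $ e0 - t\<bar> < r" by (simp add: axis_def)
  have "axis e0 t - axis e0 (X $ e0) = (t - X $ e0) *\<^sub>R axis e0 1"
    by (simp add: vec_eq_iff axis_def)
  then show "axis e0 (X $ e0) \<in> ball (axis e0 t :: real ^ 'n) r"
    using t by (simp add: dist_norm norm_axis_1 abs_minus_commute)
qed

lemma bij_betw_unit_Basis: "bij_betw (\<lambda>_::unit. 1::real) UNIV Basis"
  by (auto simp: bij_betw_def inj_on_def UNIV_unit)

context quasilinear
begin

lemma real_analytic_components:
  assumes "real_analytic_on f W" "X \<in> W"
  shows "analytic_at (\<lambda>X. (f X :: real ^ 'm) $ m) X"
  by (rule real_analytic_on_imp_analytic_at[OF assms bounded_linear_vec_nth])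

lemma solution_mono: "solution N f \<Longrightarrow> M \<subseteq> N \<Longrightarrow> solution M f"
  unfolding solution_def by blast

lemma local_unique_open:
  assumes I: "open I" "t0 \<in> I" and eq: "\<And>t. t \<in> I \<Longrightarrow> f (axis e0 t) = g (axis e0 t)"
    and N: "open N" "axis e0 t0 \<in> N"
    and f: "real_analytic_on f N" "solution N f" and g: "real_analytic_on g N" "solution N g"
  shows "eventually (\<lambda>X. f X = g X) (nhds (axis e0 t0))"
proof -
  obtain \<delta> where \<delta>: "\<delta> > 0" "ball t0 \<delta> \<subseteq> I" using I by (meson open_contains_ball)
  show ?thesis
  proof (rule local_unique[OF _ _ N f(2) g(2) \<delta>(1)])
    show "analytic_at (\<lambda>X. f X $ m) (axis e0 t0)" "analytic_at (\<lambda>X. g X $ m) (axis e0 t0)" for m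
      using real_analytic_components f(1) g(1) N(2) by blast+
    show "f (axis e0 t) = g (axis e0 t)" if "\<bar>t - t0\<bar> < \<delta>" for t
      using that \<delta>(2) by (intro eq) (auto simp: dist_norm abs_minus_commute subset_iff)
  qed
qed

text \<open>The intersection of the balls is convex, hence connected, and contains the projection of
  \<open>X\<close> to the initial line. Local uniqueness applies there, and the identity theorem
  carries the equality to \<open>X\<close>.\<close>

lemma solutions_agree_on_balls:
  assumes f: "real_analytic_on f (ball (axis e0 t) r)" "solution (ball (axis e0 t) r) f" "\<And>\<tau>. \<bar>\<tau> - t\<bar> < r \<Longrightarrow> f (axis e0 \<tau>) = h \<tau>"
    and g: "real_analytic_on g (ball (axis e0 t') r')" "solution (ball (axis e0 t') r') g" "\<And>\<tau>. \<bar>\<tau> - t'\<bar> < r' \<Longrightarrow> g (axis e0 \<tau>) = h \<tau>"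
    and X: "X \<in> ball (axis e0 t) r" "X \<in> ball (axis e0 t') r'"
  shows "f X = g X"
proof -
  define S where "S = ball (axis e0 t) r \<inter> ball (axis e0 t') r'"
  define t0 where "t0 = X $ e0"
  have a: "axis e0 t0 \<in> S" using axis_in_ball X by (auto simp: S_def t0_def)
  have S: "open S" "connected S" by (auto simp: S_def intro!: convex_connected convex_Int)
  have fS: "real_analytic_on f S" "solution S f" and gS: "real_analytic_on g S" "solution S g"
    using f(1,2) g(1,2) by (auto simp: S_def real_analytic_on_def intro: solution_mono)
  have ev: "eventually (\<lambda>X. f X = g X) (nhds (axis e0 t0))"
  proof (rule local_unique_open[where I = "{t - r<..<t + r} \<inter> {t' - r'<..<t' + r'}", OF _ _ _ S(1) a fS gS])
    show "open ({t - r<..<t + r} \<inter> {t' - r'<..<t' + r'})" by auto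
    show "t0 \<in> {t - r<..<t + r} \<inter> {t' - r'<..<t' + r'}"
      using axis_in_ball(2)[OF X(1)] axis_in_ball(2)[OF X(2)] by (auto simp: t0_def abs_less_iff)
    fix \<tau> assume "\<tau> \<in> {t - r<..<t + r} \<inter> {t' - r'<..<t' + r'}"
    then have "\<bar>\<tau> - t\<bar> < r" "\<bar>\<tau> - t'\<bar> < r'" by (auto simp: abs_less_iff)
    then show "f (axis e0 \<tau>) = g (axis e0 \<tau>)" using f(3) g(3) by simp
  qed
  have "f X $ m - g X $ m = 0" for m
  proof (rule analytic_identity[where f = "\<lambda>X. f X $ m - g X $ m" and x = X, OF S _ a])
    show "analytic_at (\<lambda>X. f X $ m - g X $ m) Y" if "Y \<in> S" for Y
      using real_analytic_components fS(1) gS(1) that by (intro analytic_at_diff) blast+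
    show "eventually (\<lambda>X. f X $ m - g X $ m = 0) (nhds (axis e0 t0))"
      using ev by (rule eventually_mono) simp
    show "X \<in> S" using X by (simp add: S_def)
  qed
  then show ?thesis by (simp add: vec_eq_iff)
qed

lemma property_A:
  assumes e: "bij_betw e {1..CARD('n)} UNIV" "e CARD('n) = e0"
    and F: "\<And>k. k \<in> {1..CARD('n) - 1} \<Longrightarrow> A (e (CARD('n) - k)) = F k"
  shows "property_A e U F"
proof -
  \<comment> \<open>The system runs over the indices other than \<open>e0\<close>; adding the
    trivial equation for \<open>e0\<close> turns it into \<open>solution\<close>.\<close>
  have solves: "solves_on e U F W u \<longleftrightarrow> solution W u" for W u
  proof -
    have "(\<forall>k\<in>{1..CARD('n) - 1}. partial_derivative (e (CARD('n) - k)) u x = F k (u x) *v partial_derivative (e CARD('n)) u x)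
        \<longleftrightarrow> (\<forall>i. partial_derivative i u x = A i (u x) *v partial_derivative e0 u x)" (is "?L \<longleftrightarrow> ?R")
      if "u x \<in> U" for x
    proof
      assume L: ?L
      show ?R
      proof
        fix i
        obtain j where j: "j \<in> {1..CARD('n)}" "i = e j" using e(1) by (metis UNIV_I bij_betw_imp_surj_on imageE)
        show "partial_derivative i u x = A i (u x) *v partial_derivative e0 u x"
        proof (cases "j = CARD('n)")
          case True
          then show ?thesis using j e(2) A_e0[OF that] by simp
        next
          case False
          define k where "k = CARD('n) - j"
          have k: "k \<in> {1..CARD('n) - 1}" and jk: "j = CARD('n) - k" using j False by (auto simp: k_def)
          show ?thesis using L[rule_format, OF k] F[OF k] j(2) e(2) unfolding jk by simp
        qed
      qed
    next
      assume R: ?R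
      show ?L using R F e(2) by metis
    qed
    then show ?thesis unfolding solves_on_def solution_def by blast
  qed
  have cauchy: "cauchy_solution e U F I h W u \<longleftrightarrow> open W \<and> axis e0 ` I \<subseteq> W \<and> real_analytic_on u W \<and> solution W u \<and>
      (\<forall>t\<in>I. u (axis e0 t) = h t)" for I h W u
    unfolding cauchy_solution_def e(2) solves ..
  show ?thesis
    unfolding property_A_def e(2)
  proof (intro allI impI conjI)
    fix I :: "real set" and h :: "real \<Rightarrow> real ^ 'n"
    assume "open I \<and> is_interval I \<and> real_analytic_on h I \<and> h ` I \<subseteq> U"
    then have I: "open I" and h: "real_analytic_on h I" "h ` I \<subseteq> U" by auto
    have "\<forall>t\<in>I. \<exists>R f. R > 0 \<and> ball t R \<subseteq> I \<and> real_analytic_on f (ball (axis e0 t) R) \<and> solution (ball (axis e0 t) R) f \<and>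
        (\<forall>\<tau>. \<bar>\<tau> - t\<bar> < R \<longrightarrow> f (axis e0 \<tau>) = h \<tau>)"
    proof
      fix t assume t: "t \<in> I"
      have "\<exists>r>0. \<exists>c :: unit mps. conv r c \<and> (\<forall>x. \<bar>x\<bar> \<le> r \<longrightarrow> h (t + x) $ m = psum c (\<lambda>_. x))" for m
      proof -
        obtain r c where rc: "r > 0" "conv r (c :: unit mps)"
          "\<And>v. (\<And>j::unit. \<bar>v \<bullet> (1::real)\<bar> \<le> r) \<Longrightarrow> h (t + v) $ m = psum c (\<lambda>j. v \<bullet> 1)"
          using real_analytic_on_expansion[OF h(1) t bounded_linear_vec_nth[of m] bij_betw_unit_Basis] by metis
        then show ?thesis by (intro exI[of _ r] conjI exI[of _ c]) auto
      qed
      moreover have "h t \<in> U" using h(2) t by auto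
      ultimately obtain R f where R: "R > 0" "real_analytic_on f (ball (axis e0 t) R)" "solution (ball (axis e0 t) R) f"
          "\<And>\<tau>. \<bar>\<tau> - t\<bar> < R \<Longrightarrow> f (axis e0 \<tau>) = h \<tau>"
        using local_solution[of h t] by blast
      obtain d where d: "d > 0" "ball t d \<subseteq> I" using I t by (meson open_contains_ball)
      have sub: "ball (axis e0 t) (min R d) \<subseteq> ball (axis e0 t) R" by (rule subset_ball) simp
      show "\<exists>R f. R > 0 \<and> ball t R \<subseteq> I \<and> real_analytic_on f (ball (axis e0 t) R) \<and> solution (ball (axis e0 t) R) f \<and>
        (\<forall>\<tau>. \<bar>\<tau> - t\<bar> < R \<longrightarrow> f (axis e0 \<tau>) = h \<tau>)"
      proof (intro exI[of _ "min R d"] exI[of _ f] conjI allI impI)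
        show "real_analytic_on f (ball (axis e0 t) (min R d))"
          using R(2) sub unfolding real_analytic_on_def by blast
        show "solution (ball (axis e0 t) (min R d)) f" by (rule solution_mono[OF R(3) sub])
      qed (use R d in auto)
    qed
    then obtain R f where Rf: "\<And>t. t \<in> I \<Longrightarrow> R t > 0" "\<And>t. t \<in> I \<Longrightarrow> ball t (R t) \<subseteq> I"
        "\<And>t. t \<in> I \<Longrightarrow> real_analytic_on (f t) (ball (axis e0 t) (R t))"
        "\<And>t. t \<in> I \<Longrightarrow> solution (ball (axis e0 t) (R t)) (f t)"
        "\<And>t \<tau>. t \<in> I \<Longrightarrow> \<bar>\<tau> - t\<bar> < R t \<Longrightarrow> f t (axis e0 \<tau>) = h \<tau>"
      by metis
    define B where "B t = ball (axis e0 t :: real ^ 'n) (R t)" for t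
    define W where "W = (\<Union>t\<in>I. B t)"
    \<comment> \<open>The choice among the local solutions is immaterial, since any two agree where
      both are defined.\<close>
    define u where "u X = f (SOME t. t \<in> I \<and> X \<in> B t) X" for X
    have uf: "u X = f t X" if "t \<in> I" "X \<in> B t" for t X
    proof -
      define t' where "t' = (SOME t. t \<in> I \<and> X \<in> B t)"
      have t': "t' \<in> I \<and> X \<in> B t'" unfolding t'_def by (rule someI[of _ t]) (use that in blast)
      have "f t' X = f t X"
        by (rule solutions_agree_on_balls[where h = h and f = "f t'" and g = "f t" and X = X
              and t = t' and r = "R t'" and t' = t and r' = "R t"]) (use t' that Rf in \<open>auto simp: B_def\<close>)
      then show ?thesis by (simp add: u_def t'_def)
    qed
    have "real_analytic_on u W"
      unfolding W_def
    proof (rule real_analytic_on_UN)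
      fix t assume t: "t \<in> I"
      show "real_analytic_on u (B t)"
        by (rule real_analytic_on_cong_open[of "f t"]) (use Rf(3)[OF t] uf t in \<open>auto simp: B_def\<close>)
    qed
    moreover have "solution W u"
      unfolding solution_def
    proof (intro conjI ballI allI)
      show "u ` W \<subseteq> U"
      proof
        fix y assume "y \<in> u ` W"
        then obtain X t where "y = u X" and t: "t \<in> I" "X \<in> B t" by (auto simp: W_def)
        moreover have "f t X \<in> U" using Rf(4)[OF t(1)] t(2) unfolding solution_def B_def by blast
        ultimately show "y \<in> U" by (simp add: uf[OF t])
      qed
      fix X i assume "X \<in> W"
      then obtain t where t: "t \<in> I" "X \<in> B t" by (auto simp: W_def)
      have pd: "partial_derivative i u X = partial_derivative i (f t) X" for i
        by (rule partial_derivative_cong_open[of "B t"]) (use t uf in \<open>auto simp: B_def\<close>)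
      have "partial_derivative i (f t) X = A i (f t X) *v partial_derivative e0 (f t) X"
        using Rf(4)[OF t(1)] t(2) unfolding solution_def B_def by blast
      then show "partial_derivative i u X = A i (u X) *v partial_derivative e0 u X"
        unfolding pd uf[OF t] .
    qed
    moreover have "\<forall>t\<in>I. u (axis e0 t) = h t"
      using uf Rf(1,5) by (auto simp: B_def)
    moreover have "open W" "axis e0 ` I \<subseteq> W" using Rf(1) by (auto simp: W_def B_def)
    ultimately show "\<exists>W u. cauchy_solution e U F I h W u"
      unfolding cauchy by blast
  next
    fix I :: "real set" and h :: "real \<Rightarrow> real ^ 'n" and W u W' u'
    assume "open I \<and> is_interval I \<and> real_analytic_on h I \<and> h ` I \<subseteq> U"
      and "cauchy_solution e U F I h W u \<and> cauchy_solution e U F I h W' u'"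
    then have I: "open I" and W: "open W" "axis e0 ` I \<subseteq> W" "real_analytic_on u W" "solution W u" "\<forall>t\<in>I. u (axis e0 t) = h t"
      and W': "open W'" "axis e0 ` I \<subseteq> W'" "real_analytic_on u' W'" "solution W' u'" "\<forall>t\<in>I. u' (axis e0 t) = h t"
      unfolding cauchy by auto
    \<comment> \<open>The largest open set on which the solutions agree; local uniqueness puts the
      whole initial curve into it.\<close>
    define Z where "Z = {X. eventually (\<lambda>X. u X = u' X) (nhds X)}"
    have "open Z" unfolding Z_def open_subopen[of "{x. _ x}"] by (auto simp: eventually_nhds)
    moreover have "axis e0 t \<in> Z" if t: "t \<in> I" for t
    proof -
      have "real_analytic_on u (W \<inter> W')" "solution (W \<inter> W') u" "real_analytic_on u' (W \<inter> W')" "solution (W \<inter> W') u'"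
        using W(3,4) W'(3,4) by (auto simp: real_analytic_on_def intro: solution_mono)
      then have "eventually (\<lambda>X. u X = u' X) (nhds (axis e0 t))"
        using W W' t by (intro local_unique_open[OF I t, of u u' "W \<inter> W'"]) auto
      then show ?thesis by (simp add: Z_def)
    qed
    ultimately show "\<exists>V. open V \<and> axis e0 ` I \<subseteq> V \<and> V \<subseteq> W \<inter> W' \<and> (\<forall>x\<in>V. u x = u' x)"
      using W W' by (intro exI[of _ "Z \<inter> W \<inter> W'"]) (auto simp: Z_def dest: eventually_nhds_x_imp_x)
  qed
qed

end

section \<open>The characteristic polynomial\<close>

text \<open>In the Leibniz expansion, deleting the factor i leaves a product of Kronecker symbols.
  It survives only if p fixes every index other than i, and then p fixes i too, so that only the
  identity permutation contributes.\<close>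

lemma has_derivative_det_id: "(det has_derivative trace) (at (mat 1 :: real ^ 'n ^ 'n))"
proof -
  have D: "((\<lambda>Y::real^'n^'n. \<Sum>p | p permutes UNIV. of_int (sign p) * (\<Prod>i\<in>UNIV. Y $ i $ p i)) has_derivative
      (\<lambda>H. \<Sum>p | p permutes UNIV. of_int (sign p) * (\<Sum>i\<in>UNIV. H $ i $ p i * (\<Prod>j\<in>UNIV - {i}. mat 1 $ j $ p j)))) (at (mat 1))"
    by (intro has_derivative_sum has_derivative_mult_right has_derivative_prod
        bounded_linear_imp_has_derivative bounded_linear_compose[OF bounded_linear_vec_nth bounded_linear_vec_nth])
  have "(\<Sum>p | p permutes UNIV. of_int (sign p) * (\<Sum>i\<in>UNIV. H $ i $ p i * (\<Prod>j\<in>UNIV - {i}. mat 1 $ j $ p j))) = trace H"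
    for H :: "real^'n^'n"
  proof -
    have z: "(\<Prod>j\<in>UNIV - {i}. (mat 1 :: real^'n^'n) $ j $ p j) = (if p = id then 1 else 0)" if p: "p permutes UNIV" for p i
    proof (cases "p = id")
      case False
      have "\<exists>j. j \<noteq> i \<and> p j \<noteq> j"
      proof (rule ccontr)
        assume "\<not> ?thesis"
        then have fixj: "p j = j" if "j \<noteq> i" for j using that by blast
        have "p i = i"
        proof (rule ccontr)
          assume "p i \<noteq> i"
          then have "p (p i) = p i" by (rule fixj)
          then show False using permutes_inj[OF p] \<open>p i \<noteq> i\<close> by (simp add: inj_eq)
        qed
        with fixj have "p = id" by (metis eq_id_iff)
        with False show False by simp
      qed
      then obtain j where "j \<noteq> i" "p j \<noteq> j" by blast
      then show ?thesis using False by (auto simp: mat_def intro!: prod_zero bexI[of _ j])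
    qed (simp add: mat_def)
    have "(\<Sum>p | p permutes UNIV. of_int (sign p) * (\<Sum>i\<in>UNIV. H $ i $ p i * (\<Prod>j\<in>UNIV - {i}. mat 1 $ j $ p j)))
        = (\<Sum>p | p permutes (UNIV::'n set). if p = id then trace H else 0)"
      by (intro sum.cong refl) (auto simp: z trace_def sign_id)
    also have "\<dots> = trace H"
      by (subst sum.delta) (auto simp: permutes_id)
    finally show ?thesis .
  qed
  with D show ?thesis by (simp add: det_def[abs_def])
qed

text \<open>Multiplicativity, det X = det M det (R X), moves the derivative to the identity matrix.
  This is Jacobi's formula at an invertible \<open>M\<close>.\<close>

lemma has_derivative_det:
  fixes M R :: "real ^ 'n ^ 'n"
  assumes R: "R ** M = mat 1" "M ** R = mat 1"
  shows "(det has_derivative (\<lambda>H. det M * trace (R ** H))) (at M)"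
proof -
  have "linear (\<lambda>X. R ** X)"
    by (rule linearI) (simp_all add: matrix_add_ldistrib matrix_scalar_ac scalar_matrix_assoc[symmetric])
  then have "((\<lambda>X. R ** X) has_derivative (\<lambda>H. R ** H)) (at M)"
    by (intro bounded_linear_imp_has_derivative) (simp add: linear_conv_bounded_linear)
  moreover have "(det has_derivative trace) (at (R ** M))"
    unfolding R by (rule has_derivative_det_id)
  ultimately have "((\<lambda>X. det (R ** X)) has_derivative (\<lambda>H. trace (R ** H))) (at M)"
    by (rule has_derivative_compose[where g = det])
  then have "((\<lambda>X. det M * det (R ** X)) has_derivative (\<lambda>H. det M * trace (R ** H))) (at M)"
    by (rule has_derivative_mult_right)
  moreover have "det M * det (R ** X) = det X" for X
  proof -
    have "det M * det (R ** X) = det (M ** (R ** X))" by (simp add: det_mul)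
    then show ?thesis by (simp add: matrix_mul_assoc R)
  qed
  ultimately show ?thesis by simp
qed

text \<open>Diagonal and off-diagonal entries of \<lambda> Id - A in the common form a + b \<lambda>
  that \<open>coeff_prod_linear\<close> expects, with b = 0 off the diagonal.\<close>

definition cp_entry :: "'a::comm_ring_1 ^ 'n ^ 'n \<Rightarrow> 'n \<Rightarrow> 'n \<Rightarrow> 'a poly" where
  "cp_entry A i j = [:- (A $ i $ j), if i = j then 1 else 0:]"

lemma matrix_char_poly_eq: "matrix_char_poly A = det (\<chi> i j. cp_entry A i j)"
proof -
  have "mat [:0, 1:] - (\<chi> i j. [:A $ i $ j:]) = (\<chi> i j. cp_entry A i j)"
    by (simp add: vec_eq_iff mat_def cp_entry_def)
  then show ?thesis by (simp add: matrix_char_poly_def)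
qed

lemma poly_of_int_sign: "poly (of_int (sign p)) x = of_int (sign p)"
  by (cases p rule: sign_cases) auto

lemma poly_matrix_char_poly: "poly (matrix_char_poly A) x = det (mat x - (A :: real ^ 'n ^ 'n))"
proof -
  have "poly (cp_entry A i j) x = (mat x - A) $ i $ j" for i j
    by (simp add: cp_entry_def mat_def)
  then show ?thesis
    by (simp add: matrix_char_poly_eq det_def poly_sum poly_prod poly_of_int_sign)
qed

lemma coeff_prod_linear:
  fixes q :: "'i \<Rightarrow> 'a::comm_ring_1 poly"
  assumes "finite S" "\<And>i. i \<in> S \<Longrightarrow> q i = [:a i, b i:]"
  shows "(\<forall>j>card S. coeff (\<Prod>i\<in>S. q i) j = 0) \<and> coeff (\<Prod>i\<in>S. q i) (card S) = (\<Prod>i\<in>S. b i)"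
  using assms
proof (induction S rule: finite_induct)
  case (insert x S)
  have e: "(\<Prod>i\<in>insert x S. q i) = smult (a x) (\<Prod>i\<in>S. q i) + pCons 0 (smult (b x) (\<Prod>i\<in>S. q i))"
    using insert by simp
  have IH: "\<And>j. j > card S \<Longrightarrow> coeff (\<Prod>i\<in>S. q i) j = 0" "coeff (\<Prod>i\<in>S. q i) (card S) = (\<Prod>i\<in>S. b i)"
    using insert by auto
  have "coeff (\<Prod>i\<in>insert x S. q i) (Suc j) = a x * coeff (\<Prod>i\<in>S. q i) (Suc j) + b x * coeff (\<Prod>i\<in>S. q i) j" for j
    unfolding e by simp
  note c = this
  show ?case
  proof (intro conjI allI impI)
    fix j assume "j > card (insert x S)"
    then obtain k where "j = Suc k" "k > card S" using insert by (cases j) auto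
    then show "coeff (\<Prod>i\<in>insert x S. q i) j = 0" using c IH by simp
  next
    show "coeff (\<Prod>i\<in>insert x S. q i) (card (insert x S)) = (\<Prod>i\<in>insert x S. b i)"
      using insert c[of "card S"] IH by simp
  qed
qed simp

lemma coeff_matrix_char_poly:
  fixes A :: "real ^ 'n ^ 'n"
  shows "coeff (matrix_char_poly A) j = (\<Sum>p | p permutes UNIV. of_int (sign p) * coeff (\<Prod>i\<in>UNIV. cp_entry A i (p i)) j)"
proof -
  have "coeff (of_int (sign p) * q) j = of_int (sign p) * coeff q j" for p :: "'n \<Rightarrow> 'n" and q :: "real poly"
    by (cases p rule: sign_cases) auto
  then show ?thesis by (simp add: matrix_char_poly_eq det_def coeff_sum)
qed

text \<open>In degree n the products of the linear coefficients form the Leibniz expansion of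
  \<open>det (mat 1)\<close>.\<close>

lemma coeff_matrix_char_poly_top:
  fixes A :: "real ^ 'n ^ 'n"
  shows "j > CARD('n) \<Longrightarrow> coeff (matrix_char_poly A) j = 0" "coeff (matrix_char_poly A) CARD('n) = 1"
proof -
  have c: "(\<forall>j>CARD('n). coeff (\<Prod>i\<in>UNIV. cp_entry A i (p i)) j = 0) \<and>
      coeff (\<Prod>i\<in>UNIV. cp_entry A i (p i)) CARD('n) = (\<Prod>i\<in>UNIV. mat 1 $ i $ p i)" for p
    by (rule coeff_prod_linear[where a = "\<lambda>i. - (A $ i $ p i)"]) (auto simp: cp_entry_def mat_def)
  show "coeff (matrix_char_poly A) j = 0" if "j > CARD('n)"
    using that by (simp add: coeff_matrix_char_poly c)
  have "coeff (matrix_char_poly A) CARD('n) = det (mat 1 :: real ^ 'n ^ 'n)"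
    by (simp add: coeff_matrix_char_poly c det_def)
  then show "coeff (matrix_char_poly A) CARD('n) = 1" by simp
qed

lemma analytic_at_coeff_prod:
  assumes "finite S" "\<And>i k. i \<in> S \<Longrightarrow> analytic_at (\<lambda>u. coeff (q i u) k) p"
  shows "analytic_at (\<lambda>u. coeff (\<Prod>i\<in>S. q i u) k) p"
  using assms
proof (induction S arbitrary: k rule: finite_induct)
  case (insert x S)
  then show ?case
    by (auto simp: coeff_mult intro!: analytic_at_sum analytic_at_mult)
qed (simp add: analytic_at_const)

lemma analytic_at_coeff_char_poly:
  fixes L :: "real ^ 'n \<Rightarrow> real ^ 'm ^ 'm"
  assumes L: "\<And>i j. analytic_at (\<lambda>u. L u $ i $ j) p"
  shows "analytic_at (\<lambda>u. coeff (matrix_char_poly (L u)) k) p"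
proof -
  have "analytic_at (\<lambda>u. coeff (cp_entry (L u) i j) k) p" for i j k
  proof (cases k)
    case 0
    have "analytic_at (\<lambda>u. 0 - L u $ i $ j) p" by (intro analytic_at_diff analytic_at_const L)
    then show ?thesis using 0 by (simp add: cp_entry_def)
  qed (simp add: cp_entry_def analytic_at_const)
  then show ?thesis
    unfolding coeff_matrix_char_poly
    by (intro analytic_at_sum analytic_at_mult analytic_at_const analytic_at_coeff_prod) auto
qed

text \<open>Meant for identities that involve the resolvent, which exists only away from the roots
  of the characteristic polynomial.\<close>

lemma poly_eq_if_eq_off_roots:
  fixes p q r :: "real poly"
  assumes "r \<noteq> 0" "\<And>x. poly r x \<noteq> 0 \<Longrightarrow> poly p x = poly q x"
  shows "p = q"
proof (rule ccontr)
  assume "p \<noteq> q"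
  then have "finite {x. poly (p - q) x = 0}" by (intro poly_roots_finite) simp
  moreover have "finite {x. poly r x = 0}" by (rule poly_roots_finite[OF assms(1)])
  ultimately have "finite ({x. poly (p - q) x = 0} \<union> {x. poly r x = 0})" by simp
  moreover have "{x. poly (p - q) x = 0} \<union> {x. poly r x = 0} = UNIV"
    using assms(2) by auto
  ultimately have "finite (UNIV :: real set)" by metis
  then show False using infinite_UNIV_char_0 by blast
qed

section \<open>Nijenhuis operators\<close>

lemma matrix_diff_ldistrib: "A ** (B - C) = A ** B - A ** (C :: real ^ 'k ^ 'n)"
  and matrix_diff_rdistrib: "(A' - B') ** C' = A' ** C' - B' ** (C' :: real ^ 'k ^ 'n)"
  by (simp_all add: vec_eq_iff matrix_matrix_mult_def algebra_simps sum_subtractf)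

text \<open>
  In the next two lemmas \<open>l\<close> is the value of a Nijenhuis operator at a point and \<open>D v\<close> its derivative
  in the direction \<open>v\<close>. The inverse \<open>R\<close> of \<open>mat x - l\<close> gives the logarithmic derivative of the
  characteristic polynomial.
\<close>

lemma nijenhuis_trace:
  fixes l R :: "real ^ 'n ^ 'n" and D :: "real ^ 'n \<Rightarrow> real ^ 'n ^ 'n"
  assumes nij: "\<And>v w. D (l *v v) *v w - D (l *v w) *v v + l *v (D w *v v) - l *v (D v *v w) = 0"
    and lin: "linear D" and R: "R ** (mat x - l) = mat 1" "(mat x - l) ** R = mat 1"
  shows "trace (R ** D (l *v v)) = x * trace (R ** D v) - trace (D v)"
proof -
  have Gl: "linear (\<lambda>w. D w *v v)"
    by (rule linearI) (simp_all add: linear_add[OF lin] linear_scale[OF lin] matrix_vector_mult_add_rdistrib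
        scaleR_matrix_vector_assoc)
  define G where "G = matrix (\<lambda>w. D w *v v)"
  have G: "G *v w = D w *v v" for w
    unfolding G_def by (rule fun_cong[OF matrix_vector_mul(2)[OF Gl]])
  \<comment> \<open>The Nijenhuis identity with v fixed, read as an equality of matrices acting on
    w.\<close>
  have "D (l *v v) = G ** l - l ** G + l ** D v"
  proof (rule matrix_eq[THEN iffD2], rule allI)
    fix w
    show "D (l *v v) *v w = (G ** l - l ** G + l ** D v) *v w"
      using nij[of v w]
      by (simp add: matrix_vector_mult_add_rdistrib matrix_vector_mult_diff_rdistrib G matrix_vector_mul_assoc[symmetric] algebra_simps)
  qed
  then have 1: "trace (R ** D (l *v v)) = trace (R ** (G ** l)) - trace (R ** (l ** G)) + trace (R ** (l ** D v))"
    by (simp add: matrix_add_ldistrib matrix_diff_ldistrib trace_add trace_sub)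
  have xR: "mat x ** R = R ** mat x"
    by (simp add: vec_eq_iff matrix_matrix_mult_def mat_def if_distrib if_distribR cong: if_cong)
  have Rl: "R ** l = R ** mat x - mat 1" and lR: "l ** R = mat x ** R - mat 1"
    using R by (simp_all add: matrix_diff_ldistrib matrix_diff_rdistrib algebra_simps)
  \<comment> \<open>Since \<open>R\<close> commutes with l, the commutator of \<open>G\<close> and l
    is invisible under the trace against \<open>R\<close>.\<close>
  have "trace (R ** (G ** l)) = trace (l ** (R ** G))"
    using trace_mul_sym[of "R ** G" l] by (simp add: matrix_mul_assoc)
  also have "\<dots> = trace (R ** (l ** G))"
    by (simp add: matrix_mul_assoc Rl lR xR)
  finally have "trace (R ** D (l *v v)) = trace ((R ** l) ** D v)"
    using 1 by (simp add: matrix_mul_assoc)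
  also have "(R ** l) ** D v = x *\<^sub>R (R ** D v) - D v"
  proof -
    have "mat x = x *\<^sub>R (mat 1 :: real ^ 'n ^ 'n)" by (simp add: vec_eq_iff mat_def)
    then show ?thesis unfolding Rl
      by (simp add: matrix_diff_rdistrib matrix_scalar_ac scalar_matrix_assoc[symmetric])
  qed
  finally show ?thesis by (simp add: trace_sub) (simp add: trace_def sum_distrib_left)
qed

text \<open>
  Both families of the proposition have this form, with derivatives \<open>F k\<close>: \<open>L\<^sup>k\<close> with \<open>\<gamma> = 0\<close> and
  \<open>\<theta> = 0\<close>, and \<open>M\<^sub>k\<close> with \<open>\<gamma> k = f\<^sub>k\<close> and \<open>\<theta> = df\<^sub>1\<close>, where \<open>df\<^sub>k = \<theta> \<circ> M\<^bsub>k-1\<^esub>\<close>.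
\<close>

lemma nijenhuis_family:
  fixes l :: "real ^ 'n ^ 'n" and D :: "real ^ 'n \<Rightarrow> real ^ 'n ^ 'n" and P :: "nat \<Rightarrow> real ^ 'n ^ 'n"
    and F :: "nat \<Rightarrow> real ^ 'n \<Rightarrow> real ^ 'n ^ 'n" and \<theta> :: "real ^ 'n \<Rightarrow> real" and \<gamma> :: "nat \<Rightarrow> real"
  assumes nij: "\<And>v w. D (l *v v) *v w - D (l *v w) *v v + l *v (D w *v v) - l *v (D v *v w) = 0"
    and lin: "linear D" "linear \<theta>"
    and P: "P 0 = mat 1" "\<And>k. P (Suc k) = l ** P k - \<gamma> (Suc k) *\<^sub>R mat 1"
    and F: "\<And>v. F 0 v = 0" "\<And>k v. Suc k \<le> K \<Longrightarrow> F (Suc k) v = D v ** P k + l ** F k v - \<theta> (P k *v v) *\<^sub>R mat 1"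
  shows "P i ** P k = P k ** P i"
    and "i \<le> K \<Longrightarrow> k \<le> K \<Longrightarrow> F k (P i *v v) *v v - F i (P k *v v) *v v + P k *v (F i v *v v) - P i *v (F k v *v v) = 0"
proof -
  have idv: "(c *\<^sub>R mat 1) *v v = c *\<^sub>R v" for c :: real and v :: "real ^ 'n"
    by (simp add: scaleR_matrix_vector_assoc[symmetric])
  have Pv: "P 0 *v v = v" "P (Suc k) *v v = l *v (P k *v v) - \<gamma> (Suc k) *\<^sub>R v" for k v
    by (simp_all add: P matrix_vector_mult_diff_rdistrib matrix_vector_mul_assoc[symmetric] idv)
  have Fv: "F 0 v *v w = 0" "Suc k \<le> K \<Longrightarrow> F (Suc k) v *v w = D v *v (P k *v w) + l *v (F k v *v w) - \<theta> (P k *v v) *\<^sub>R w" for k v w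
    by (simp_all add: F matrix_vector_mult_diff_rdistrib matrix_vector_mult_add_rdistrib matrix_vector_mul_assoc[symmetric] idv)
  note scale = matrix_vector_mult_scaleR
  note diff = matrix_vector_mult_diff_distrib
  have lP: "l *v (P k *v v) = P k *v (l *v v)" for k v
  proof (induction k arbitrary: v)
    case (Suc k)
    show ?case by (simp add: Pv diff scale Suc)
  qed (simp add: P)
  have PP: "P i *v (P k *v v) = P k *v (P i *v v)" for i k v
  proof (induction k arbitrary: v)
    case (Suc k)
    show ?case by (simp add: Pv diff scale Suc lP[symmetric])
  qed (simp add: P)
  then show "P i ** P k = P k ** P i"
    by (simp add: matrix_eq matrix_vector_mul_assoc[symmetric])
  have lin_simps: "D (x - y) = D x - D y" "D (c *\<^sub>R x) = c *\<^sub>R D x" "\<theta> (x - y) = \<theta> x - \<theta> y" "\<theta> (c *\<^sub>R x) = c * \<theta> x" for c x y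
    using lin by (simp_all add: linear_diff linear_scale)
  \<comment> \<open>A mixed form of the Nijenhuis identity, for independent v and w; for
    \<open>P 1 = l\<close> and \<theta> = 0 it is the identity itself. The right-hand side records
    that the coefficients \<gamma> vary from point to point.\<close>
  have N: "D (P k *v v) *v w - P k *v (D v *v w) + l *v (F k w *v v) - F k (l *v w) *v v = \<theta> (P k *v w) *\<^sub>R v - \<theta> w *\<^sub>R (P k *v v)"
    if "k \<le> K" for k v w
    using that
  proof (induction k arbitrary: v w)
    case (Suc k)
    then have K: "Suc k \<le> K" and IH: "D (P k *v v) *v w - P k *v (D v *v w) + l *v (F k w *v v) - F k (l *v w) *v v
        = \<theta> (P k *v w) *\<^sub>R v - \<theta> w *\<^sub>R (P k *v v)" for v w by auto
    have 1: "D (l *v (P k *v v)) *v w - D (l *v w) *v (P k *v v) + l *v (D w *v (P k *v v)) = l *v (D (P k *v v) *v w)"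
      using nij[of "P k *v v" w] by simp
    have 2: "l *v (D (P k *v v) *v w) - l *v (P k *v (D v *v w)) + l *v (l *v (F k w *v v)) - l *v (F k (l *v w) *v v)
        = \<theta> (P k *v w) *\<^sub>R (l *v v) - \<theta> w *\<^sub>R (l *v (P k *v v))"
      using arg_cong[OF IH[of v w], of "\<lambda>x. l *v x"]
      by (simp add: diff scale matrix_vector_right_distrib)
    have 3: "\<theta> (P k *v (l *v w)) = \<theta> (l *v (P k *v w))" by (simp add: lP)
    show ?case
      unfolding Pv Fv(2)[OF K] lin_simps
      using 1 2
      by (simp add: diff scale matrix_vector_right_distrib matrix_vector_mult_diff_rdistrib scaleR_matrix_vector_assoc[symmetric] 3 algebra_simps)
  qed (simp add: P Fv)
  \<comment> \<open>Induction on k with i fixed: the identity for k + 1 is l applied to the identity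
    for k, plus the mixed relation \<open>N\<close> for i with w = \<open>P k *v v\<close>.\<close>
  show "F k (P i *v v) *v v - F i (P k *v v) *v v + P k *v (F i v *v v) - P i *v (F k v *v v) = 0" if i: "i \<le> K" "k \<le> K"
    using i(2)
  proof (induction k)
    case 0
    then show ?case by (simp add: P Fv)
  next
    case (Suc k)
    then have K: "Suc k \<le> K" and IH: "F k (P i *v v) *v v - F i (P k *v v) *v v + P k *v (F i v *v v) - P i *v (F k v *v v) = 0"
      by auto
    have Flin: "F j (x - y) = F j x - F j y \<and> F j (c *\<^sub>R x) = c *\<^sub>R F j x" if "j \<le> K" for j x y c
      using that
    proof (induction j)
      case (Suc j)
      then have K: "Suc j \<le> K" and a: "F j (x - y) = F j x - F j y" "F j (c *\<^sub>R x) = c *\<^sub>R F j x" by auto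
      have "F (Suc j) (x - y) = F (Suc j) x - F (Suc j) y"
        unfolding F(2)[OF K] diff lin_simps a matrix_diff_rdistrib matrix_diff_ldistrib scaleR_diff_left by simp
      moreover have "F (Suc j) (c *\<^sub>R x) = c *\<^sub>R F (Suc j) x"
        unfolding F(2)[OF K] scale lin_simps a
        by (simp add: scalar_matrix_assoc[symmetric] matrix_scalar_ac scaleR_add_right scaleR_diff_right)
      ultimately show ?case by blast
    qed (simp add: F)
    have 1: "l *v (F k (P i *v v) *v v) - l *v (F i (P k *v v) *v v) + l *v (P k *v (F i v *v v)) - l *v (P i *v (F k v *v v)) = 0"
      using arg_cong[OF IH, of "\<lambda>x. l *v x"] by (simp add: diff matrix_vector_right_distrib)
    have 2: "D (P i *v v) *v (P k *v v) - P i *v (D v *v (P k *v v)) + l *v (F i (P k *v v) *v v) - F i (l *v (P k *v v)) *v v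
        = \<theta> (P i *v (P k *v v)) *\<^sub>R v - \<theta> (P k *v v) *\<^sub>R (P i *v v)"
      by (rule N[OF i(1)])
    have 3: "\<theta> (P k *v (P i *v v)) = \<theta> (P i *v (P k *v v))" by (simp add: PP)
    have 4: "F i (l *v (P k *v v) - \<gamma> (Suc k) *\<^sub>R v) *v v = F i (l *v (P k *v v)) *v v - \<gamma> (Suc k) *\<^sub>R (F i v *v v)"
      using Flin[OF i(1)] by (simp add: matrix_vector_mult_diff_rdistrib scaleR_matrix_vector_assoc[symmetric])
    have "F (Suc k) (P i *v v) *v v - F i (P (Suc k) *v v) *v v + P (Suc k) *v (F i v *v v) - P i *v (F (Suc k) v *v v)
        = (l *v (F k (P i *v v) *v v) - l *v (F i (P k *v v) *v v) + l *v (P k *v (F i v *v v)) - l *v (P i *v (F k v *v v)))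
        + ((D (P i *v v) *v (P k *v v) - P i *v (D v *v (P k *v v)) + l *v (F i (P k *v v) *v v) - F i (l *v (P k *v v)) *v v)
          - (\<theta> (P i *v (P k *v v)) *\<^sub>R v - \<theta> (P k *v v) *\<^sub>R (P i *v v)))"
      unfolding Pv Fv(2)[OF K] 4
      by (simp add: diff scale matrix_vector_right_distrib 3 lP[symmetric])
    also have "\<dots> = 0" unfolding 1 2 by simp
    finally show ?case .
  qed
qed

section \<open>Derivatives of operator fields and the bracket\<close>

lemma frechet_derivative_eqI: "(f has_derivative f') (at x) \<Longrightarrow> frechet_derivative f (at x) h = f' h"
  by (metis frechet_derivative_at)

lemma smooth_on_const: "smooth_on (\<lambda>_. c) U"
proof -
  have "C_diff_on k (\<lambda>_. c) U" for k
    by (induction k arbitrary: c) auto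
  then show ?thesis by (simp add: smooth_on_def)
qed

lemma smooth_on_differentiable:
  assumes "smooth_on f U" "open U" "u \<in> U" shows "f differentiable (at u)"
proof -
  have "C_diff_on (Suc 0) f U" using assms(1) unfolding smooth_on_def by blast
  then show ?thesis using assms(2,3) by (simp add: differentiable_on_eq_differentiable_at)
qed

lemma has_derivative_mat_vec:
  fixes A :: "'a::real_normed_vector \<Rightarrow> real ^ 'n ^ 'm"
  assumes A: "(A has_derivative A') (at u)" and x: "(x has_derivative x') (at u)"
  shows "((\<lambda>u. A u *v x u) has_derivative (\<lambda>h. A' h *v x u + A u *v x' h)) (at u)"
proof -
  have "((\<lambda>u. \<chi> i. \<Sum>j\<in>UNIV. A u $ i $ j * x u $ j) has_derivative
      (\<lambda>h. \<chi> i. \<Sum>j\<in>UNIV. A u $ i $ j * x' h $ j + A' h $ i $ j * x u $ j)) (at u)"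
    by (intro has_derivative_vec has_derivative_sum has_derivative_mult
        bounded_linear.has_derivative[OF bounded_linear_vec_nth] A x)
  then show ?thesis
    by (simp add: matrix_vector_mult_def vec_eq_iff sum.distrib plus_vec_def add.commute)
qed

lemma has_derivative_mat_mat:
  fixes A :: "'a::real_normed_vector \<Rightarrow> real ^ 'n ^ 'm" and B :: "'a \<Rightarrow> real ^ 'k ^ 'n"
  assumes A: "(A has_derivative A') (at u)" and B: "(B has_derivative B') (at u)"
  shows "((\<lambda>u. A u ** B u) has_derivative (\<lambda>h. A' h ** B u + A u ** B' h)) (at u)"
proof -
  have "((\<lambda>u. \<chi> i k. \<Sum>j\<in>UNIV. A u $ i $ j * B u $ j $ k) has_derivative
      (\<lambda>h. \<chi> i k. \<Sum>j\<in>UNIV. A u $ i $ j * B' h $ j $ k + A' h $ i $ j * B u $ j $ k)) (at u)"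
    by (intro has_derivative_matrix has_derivative_sum has_derivative_mult
        bounded_linear.has_derivative[OF bounded_linear_vec_nth] A B)
  then show ?thesis
    by (simp add: matrix_matrix_mult_def vec_eq_iff sum.distrib plus_vec_def add.commute)
qed

lemma frechet_derivative_apply_op:
  assumes A: "A differentiable (at u)" and x: "\<xi> differentiable (at u)"
  shows "frechet_derivative (apply_op A \<xi>) (at u) h
    = frechet_derivative A (at u) h *v \<xi> u + A u *v frechet_derivative \<xi> (at u) h"
proof -
  have "((\<lambda>u. A u *v \<xi> u) has_derivative (\<lambda>h. frechet_derivative A (at u) h *v \<xi> u + A u *v frechet_derivative \<xi> (at u) h)) (at u)"
    using A x by (intro has_derivative_mat_vec) (simp_all add: frechet_derivative_works)
  then show ?thesis
    unfolding apply_op_def[abs_def] by (rule frechet_derivative_eqI)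
qed

text \<open>The derivative of \<xi> enters only through terms that cancel, the last pair because
  \<open>A\<close> and \<open>B\<close> commute at u. The bracket is thus algebraic in the value of
  \<xi> at u.\<close>

lemma op_bracket_eq:
  fixes A B :: "real ^ 'n \<Rightarrow> real ^ 'n ^ 'n" and u :: "real ^ 'n"
  defines "FA \<equiv> frechet_derivative A (at u)" and "FB \<equiv> frechet_derivative B (at u)"
  assumes A: "A differentiable (at u)" and B: "B differentiable (at u)" and x: "\<xi> differentiable (at u)"
    and c: "A u ** B u = B u ** A u"
  shows "op_bracket A B \<xi> u
    = FB (A u *v \<xi> u) *v \<xi> u - FA (B u *v \<xi> u) *v \<xi> u + B u *v (FA (\<xi> u) *v \<xi> u) - A u *v (FB (\<xi> u) *v \<xi> u)"
proof -
  have cv: "A u *v (B u *v y) = B u *v (A u *v y)" for y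
    by (simp add: matrix_vector_mul_assoc c)
  show ?thesis
    unfolding op_bracket_def lie_bracket_def frechet_derivative_apply_op[OF A x] frechet_derivative_apply_op[OF B x]
      FA_def[symmetric] FB_def[symmetric]
    by (simp add: apply_op_def matrix_vector_right_distrib matrix_vector_mult_diff_distrib cv)
qed

text \<open>The Nijenhuis condition is tensorial, so it suffices to evaluate it on constant vector fields.\<close>

lemma nijenhuis_pointwise:
  fixes L :: "real ^ 'n \<Rightarrow> real ^ 'n ^ 'n"
  assumes nij: "nijenhuis_on U L" and u: "u \<in> U" and L: "L differentiable (at u)"
  defines "D \<equiv> frechet_derivative L (at u)"
  shows "D (L u *v v) *v w - D (L u *v w) *v v + L u *v (D w *v v) - L u *v (D v *v w) = 0"
proof -
  have c: "(\<lambda>_. x) differentiable (at u)" for x :: "real ^ 'n" by simp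
  have fd: "frechet_derivative (apply_op L (\<lambda>_. x)) (at u) h = D h *v x" for x h
    unfolding frechet_derivative_apply_op[OF L c] D_def by simp
  have neg: "L u *v (- x) = - (L u *v x)" for x
    using matrix_vector_mult_diff_distrib[of "L u" 0 x] by simp
  have "nijenhuis_torsion L (\<lambda>_. v) (\<lambda>_. w) u = 0"
    using nij u smooth_on_const unfolding nijenhuis_on_def by blast
  then show ?thesis
    unfolding nijenhuis_torsion_def lie_bracket_def fd
    by (simp add: apply_op_def neg algebra_simps)
qed

lemma char_coeff_derivative:
  fixes L :: "real ^ 'n \<Rightarrow> real ^ 'n ^ 'n"
  assumes L: "\<And>i j. analytic_at (\<lambda>u. L u $ i $ j) u"
  defines "D \<equiv> frechet_derivative L (at u)"
  assumes nij: "\<And>v w. D (L u *v v) *v w - D (L u *v w) *v v + L u *v (D w *v v) - L u *v (D v *v w) = 0"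
    and k: "1 \<le> k" "k < CARD('n)"
  shows "frechet_derivative (\<lambda>u. char_coeff (L u) (Suc k)) (at u) v
    = frechet_derivative (\<lambda>u. char_coeff (L u) k) (at u) (L u *v v)
      - char_coeff (L u) k * frechet_derivative (\<lambda>u. char_coeff (L u) 1) (at u) v"
proof -
  let ?n = "CARD('n)"
  define c where "c j u = coeff (matrix_char_poly (L u)) j" for j u
  define dc where "dc j = frechet_derivative (c j) (at u)" for j
  have Ld: "(L has_derivative D) (at u)"
    unfolding D_def using differentiable_matrix[of L, OF analytic_at_differentiable[OF L]]
    by (simp add: frechet_derivative_works)
  have cd: "(c j has_derivative dc j) (at u)" for j
    unfolding dc_def c_def
    using analytic_at_differentiable[OF analytic_at_coeff_char_poly[OF L]] by (simp add: frechet_derivative_works)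
  define cp where "cp = matrix_char_poly (L u)"
  have poly_c: "poly (matrix_char_poly (L u)) x = (\<Sum>j\<in>{..?n}. c j u * x ^ j)" for u x
  proof -
    have "degree (matrix_char_poly (L u)) \<le> ?n"
      by (rule degree_le) (simp add: coeff_matrix_char_poly_top)
    then show ?thesis
      unfolding c_def poly_altdef
      by (intro sum.mono_neutral_left) (auto simp: coeff_eq_0)
  qed
  define Q where "Q v = (\<Sum>j\<in>{..?n}. monom (dc j v) j)" for v
  have Q_coeff: "coeff (Q v) j = (if j \<le> ?n then dc j v else 0)" for v j
    by (simp add: Q_def coeff_sum)
  \<comment> \<open>Jacobi's formula: the logarithmic derivative of the characteristic polynomial
    along v is minus the trace of the resolvent \<open>R\<close> against \<open>D v\<close>.\<close>
  have key: "poly (Q v) x = - poly cp x * trace (R ** D v)"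
    if R: "R ** (mat x - L u) = mat 1" "(mat x - L u) ** R = mat 1" for v x R
  proof -
    have "((\<lambda>u. \<Sum>j\<in>{..?n}. c j u * x ^ j) has_derivative (\<lambda>v. \<Sum>j\<in>{..?n}. dc j v * x ^ j)) (at u)"
      by (intro has_derivative_sum has_derivative_mult_left cd)
    moreover have "((\<lambda>u. mat x - L u) has_derivative (\<lambda>v. - D v)) (at u)"
      using has_derivative_diff[OF has_derivative_const[of "mat x"] Ld] by simp
    from has_derivative_compose[OF this has_derivative_det[OF R]]
    have "((\<lambda>u. \<Sum>j\<in>{..?n}. c j u * x ^ j) has_derivative (\<lambda>v. det (mat x - L u) * trace (R ** (- D v)))) (at u)"
      unfolding poly_c[symmetric] poly_matrix_char_poly .
    ultimately have "(\<lambda>v. \<Sum>j\<in>{..?n}. dc j v * x ^ j) = (\<lambda>v. det (mat x - L u) * trace (R ** (- D v)))"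
      by (rule has_derivative_unique)
    from fun_cong[OF this, of v] have "(\<Sum>j\<in>{..?n}. dc j v * x ^ j) = det (mat x - L u) * trace (R ** (- D v))" .
    moreover have "trace (R ** (- D v)) = - trace (R ** D v)"
      by (simp add: trace_def matrix_matrix_mult_def sum_negf)
    ultimately show ?thesis
      by (simp add: Q_def poly_sum poly_monom cp_def poly_matrix_char_poly)
  qed
  have "Q (L u *v v) = pCons 0 (Q v) + smult (trace (D v)) cp"
  proof (rule poly_eq_if_eq_off_roots)
    show "cp \<noteq> 0"
      using coeff_matrix_char_poly_top(2)[of "L u"] unfolding cp_def by auto
    fix x assume "poly cp x \<noteq> 0"
    then have "invertible (mat x - L u)"
      by (simp add: cp_def poly_matrix_char_poly invertible_det_nz)
    then obtain R where R: "R ** (mat x - L u) = mat 1" "(mat x - L u) ** R = mat 1"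
      unfolding invertible_def by blast
    have tr: "trace (R ** D (L u *v v)) = x * trace (R ** D v) - trace (D v)"
      by (rule nijenhuis_trace[OF nij has_derivative_linear[OF Ld] R])
    show "poly (Q (L u *v v)) x = poly (pCons 0 (Q v) + smult (trace (D v)) cp) x"
      unfolding poly_add poly_pCons poly_smult key[OF R] tr by (simp add: algebra_simps)
  qed
  \<comment> \<open>The coefficient f_k is minus the one of degree n - k, so raising the degree by
    one on the polynomial side means passing from f_{k+1} to f_k.\<close>
  then have co: "coeff (Q (L u *v v)) (Suc j) = coeff (Q v) j + trace (D v) * coeff cp (Suc j)" for j
    by simp
  have dtop: "dc ?n v = 0" for v
  proof -
    have "c ?n = (\<lambda>_. 1)" by (simp add: c_def fun_eq_iff coeff_matrix_char_poly_top)
    then show ?thesis by (simp add: dc_def)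
  qed
  have cc: "frechet_derivative (\<lambda>u. char_coeff (L u) j) (at u) v = - dc (?n - j) v" for j v
  proof -
    have "((\<lambda>u. char_coeff (L u) j) has_derivative (\<lambda>v. - dc (?n - j) v)) (at u)"
      using has_derivative_minus[OF cd[of "?n - j"]] by (simp add: char_coeff_def c_def)
    then show ?thesis by (rule frechet_derivative_eqI)
  qed
  have "?n > 0" by simp
  then obtain n' where n': "?n = Suc n'" using gr0_implies_Suc by blast
  \<comment> \<open>The identity in degree n: the leading coefficient is constantly 1, so the trace
    of \<open>D v\<close> is the derivative of f_1.\<close>
  have tr: "trace (D v) = - dc (?n - 1) v"
    using co[of n'] dtop coeff_matrix_char_poly_top(2)[of "L u"] n' by (simp add: Q_coeff cp_def)
  obtain j where j: "?n - k = Suc j" using k by (metis Suc_diff_Suc)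
  then have j': "?n - Suc k = j" and jn: "Suc j \<le> ?n" by auto
  show ?thesis
    unfolding cc using co[of j] jn j j' tr
    by (simp add: Q_coeff cp_def char_coeff_def)
qed

section \<open>The recursions of the two families\<close>

lemma mat_power_Suc: "mat_power A (Suc k) = A ** mat_power A k"
  and mat_power_0: "mat_power A 0 = mat 1"
  by (simp_all add: mat_power_def)

text \<open>The subtracted zero gives both families the same form of recursion.\<close>

lemma op_I_Suc: "op_I L (Suc k) u = L u ** op_I L k u - 0 *\<^sub>R mat 1" and op_I_0: "op_I L 0 u = mat 1"
  by (simp_all add: op_I_def mat_power_Suc mat_power_0)

lemma op_II_0: "op_II L 0 u = mat 1"
  by (simp add: op_II_def mat_power_0)

lemma matrix_mult_sum_right: "A ** sum f S = (\<Sum>i\<in>S. A ** (f i :: real ^ 'k ^ 'n))"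
  by (induction S rule: infinite_finite_induct) (simp_all add: matrix_add_ldistrib)

text \<open>Horner's scheme for the characteristic polynomial evaluated at \<open>L u\<close>, of
  which \<open>op_II\<close> is the k-th stage.\<close>

lemma op_II_Suc: "op_II L (Suc k) u = L u ** op_II L k u - char_coeff (L u) (Suc k) *\<^sub>R mat 1"
proof -
  have "(\<Sum>i = 1..k. char_coeff (L u) i *\<^sub>R mat_power (L u) (Suc k - i))
      = (\<Sum>i = 1..k. L u ** (char_coeff (L u) i *\<^sub>R mat_power (L u) (k - i)))"
    by (intro sum.cong refl) (simp add: Suc_diff_le mat_power_Suc matrix_scalar_ac scalar_matrix_assoc[symmetric])
  also have "\<dots> = L u ** (\<Sum>i = 1..k. char_coeff (L u) i *\<^sub>R mat_power (L u) (k - i))"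
    by (rule matrix_mult_sum_right[symmetric])
  finally show ?thesis
    by (simp add: op_II_def mat_power_Suc mat_power_0 matrix_diff_ldistrib)
qed

text \<open>The index 0 is included: \<open>Q 0\<close> is the identity, which belongs to x^n, and
  starts the recursion. The condition on \<theta> says that the differentials of the coefficients
  are pulled back from one covector field by the operators of the family itself.\<close>

lemma family_properties:
  fixes U :: "(real ^ 'n) set" and L :: "real ^ 'n \<Rightarrow> real ^ 'n ^ 'n" and Q :: "nat \<Rightarrow> real ^ 'n \<Rightarrow> real ^ 'n ^ 'n"
    and e :: "nat \<Rightarrow> 'n" and g :: "nat \<Rightarrow> real ^ 'n \<Rightarrow> real" and \<theta> :: "real ^ 'n \<Rightarrow> real ^ 'n \<Rightarrow> real"
  assumes U: "open U" and e: "bij_betw e {1..CARD('n)} UNIV"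
    and L: "\<And>u i j. u \<in> U \<Longrightarrow> analytic_at (\<lambda>u. L u $ i $ j) u" and nij: "nijenhuis_on U L"
    and Q: "\<And>u. Q 0 u = mat 1" "\<And>k u. Q (Suc k) u = L u ** Q k u - g (Suc k) u *\<^sub>R mat 1"
    and g: "\<And>k u. u \<in> U \<Longrightarrow> analytic_at (g k) u"
    and \<theta>: "\<And>u. u \<in> U \<Longrightarrow> linear (\<theta> u)"
      "\<And>k u v. u \<in> U \<Longrightarrow> Suc k \<le> CARD('n) - 1 \<Longrightarrow> frechet_derivative (g (Suc k)) (at u) v = \<theta> u (Q k u *v v)"
  shows "property_B U Q \<and> property_A e U Q"
proof -
  let ?n = "CARD('n)"
  have Qan: "analytic_at (\<lambda>u. Q k u $ i $ j) u" if u: "u \<in> U" for k i j u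
  proof (induction k arbitrary: i j)
    case 0
    then show ?case by (simp add: Q analytic_at_const)
  next
    case (Suc k)
    have "analytic_at (\<lambda>u. (\<Sum>m\<in>UNIV. L u $ i $ m * Q k u $ m $ j) - g (Suc k) u * mat 1 $ i $ j) u"
      by (intro analytic_at_diff analytic_at_sum analytic_at_mult analytic_at_const Suc L g u)
    then show ?case by (simp add: Q matrix_matrix_mult_def)
  qed
  have Qdiff: "Q k differentiable (at u)" if "u \<in> U" for k u
    by (intro differentiable_matrix analytic_at_differentiable Qan that)
  have Ldiff: "L differentiable (at u)" if "u \<in> U" for u
    by (intro differentiable_matrix analytic_at_differentiable L that)
  define F where "F u k = frechet_derivative (Q k) (at u)" for u k
  have F0: "F u 0 v = 0" for u v
  proof -
    have "Q 0 = (\<lambda>_. mat 1)" by (simp add: fun_eq_iff Q)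
    then show ?thesis by (simp add: F_def)
  qed
  have FS: "F u (Suc k) v = frechet_derivative L (at u) v ** Q k u + L u ** F u k v - \<theta> u (Q k u *v v) *\<^sub>R mat 1"
    if u: "u \<in> U" and k: "Suc k \<le> ?n - 1" for u k v
  proof -
    have "((\<lambda>u. L u ** Q k u - g (Suc k) u *\<^sub>R mat 1) has_derivative
        (\<lambda>h. (frechet_derivative L (at u) h ** Q k u + L u ** F u k h) - frechet_derivative (g (Suc k)) (at u) h *\<^sub>R mat 1)) (at u)"
      unfolding F_def using Ldiff[OF u] Qdiff[OF u] analytic_at_differentiable[OF g[OF u]]
      by (intro has_derivative_diff has_derivative_mat_mat has_derivative_scaleR_left)
         (simp_all add: frechet_derivative_works)
    then have "frechet_derivative (\<lambda>u. L u ** Q k u - g (Suc k) u *\<^sub>R mat 1) (at u) v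
        = frechet_derivative L (at u) v ** Q k u + L u ** F u k v - \<theta> u (Q k u *v v) *\<^sub>R mat 1"
      unfolding \<theta>(2)[OF u k, symmetric] by (rule frechet_derivative_eqI)
    moreover have "Q (Suc k) = (\<lambda>u. L u ** Q k u - g (Suc k) u *\<^sub>R mat 1)"
      by (simp add: fun_eq_iff Q)
    ultimately show ?thesis
      by (simp only: F_def)
  qed
  have comm: "Q i u ** Q k u = Q k u ** Q i u"
    and bracket: "i \<le> ?n - 1 \<Longrightarrow> k \<le> ?n - 1 \<Longrightarrow>
      F u k (Q i u *v v) *v v - F u i (Q k u *v v) *v v + Q k u *v (F u i v *v v) - Q i u *v (F u k v *v v) = 0"
    if u: "u \<in> U" for u i k v
  proof -
    note fam = nijenhuis_family[where l = "L u" and D = "frechet_derivative L (at u)" and P = "\<lambda>k. Q k u"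
        and F = "F u" and \<theta> = "\<theta> u" and \<gamma> = "\<lambda>k. g k u" and K = "?n - 1",
        OF nijenhuis_pointwise[OF nij u Ldiff[OF u]] linear_frechet_derivative[OF Ldiff[OF u]] \<theta>(1)[OF u] Q F0 FS[OF u]]
    show "Q i u ** Q k u = Q k u ** Q i u" by (rule fam(1))
    show "F u k (Q i u *v v) *v v - F u i (Q k u *v v) *v v + Q k u *v (F u i v *v v) - Q i u *v (F u k v *v v) = 0"
      if "i \<le> ?n - 1" "k \<le> ?n - 1"
      by (rule fam(2)[OF _ that])
  qed
  have "property_B U Q"
    unfolding property_B_def
  proof (intro ballI conjI allI impI)
    fix k j u assume "k \<in> {1..?n - 1}" "j \<in> {1..?n - 1}"
    then have kj: "k \<le> ?n - 1" "j \<le> ?n - 1" by auto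
    assume u: "u \<in> U"
    show "Q k u ** Q j u = Q j u ** Q k u" by (rule comm[OF u])
    fix \<xi> :: "real ^ 'n \<Rightarrow> real ^ 'n" assume "smooth_on \<xi> U"
    then have "\<xi> differentiable (at u)" by (rule smooth_on_differentiable[OF _ U u])
    from op_bracket_eq[OF Qdiff[OF u] Qdiff[OF u] this comm[OF u]]
    show "op_bracket (Q k) (Q j) \<xi> u = 0"
      using bracket[OF u kj, of "\<xi> u"] by (simp add: F_def)
  qed
  moreover have "property_A e U Q"
  proof -
    \<comment> \<open>The coordinate numbered j is governed by the operator of index n - j, so
      \<open>e CARD('n)\<close> receives \<open>Q 0\<close>.\<close>
    define idx where "idx i = ?n - inv_into {1..?n} e i" for i
    have idx_le: "idx i \<le> ?n - 1" for i
    proof -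
      have "inv_into {1..?n} e i \<in> {1..?n}"
        using e by (intro inv_into_into) (auto simp: bij_betw_def)
      then show ?thesis by (auto simp: idx_def)
    qed
    have idx_e: "idx (e j) = ?n - j" if "j \<in> {1..?n}" for j
      using e that by (simp add: idx_def bij_betw_def)
    have n1: "?n \<in> {1..?n}" by (simp add: Suc_le_eq)
    interpret quasilinear U "\<lambda>i. Q (idx i)" "e ?n"
    proof
      show "open U" by (rule U)
      fix u assume u: "u \<in> U"
      show "analytic_at (\<lambda>u. Q (idx i) u $ m $ p) u" for i m p by (rule Qan[OF u])
      show "Q (idx i) u ** Q (idx k) u = Q (idx k) u ** Q (idx i) u" for i k by (rule comm[OF u])
      show "Q (idx (e ?n)) u = mat 1" using idx_e[OF n1] by (simp add: Q)
      show "frechet_derivative (Q (idx i)) (at u) (Q (idx k) u *v v) *v v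
          - frechet_derivative (Q (idx k)) (at u) (Q (idx i) u *v v) *v v
          + Q (idx i) u *v (frechet_derivative (Q (idx k)) (at u) v *v v)
          - Q (idx k) u *v (frechet_derivative (Q (idx i)) (at u) v *v v) = 0" for i k v
        using bracket[OF u idx_le idx_le, of i k v] unfolding F_def .
    qed
    show ?thesis
    proof (rule property_A[OF e refl])
      fix k assume "k \<in> {1..?n - 1}"
      then have "?n - k \<in> {1..?n}" "?n - (?n - k) = k" by auto
      then show "Q (idx (e (?n - k))) = Q k" using idx_e[of "?n - k"] by simp
    qed
  qed
  ultimately show ?thesis ..
qed

theorem proposition3p2:
  fixes U :: "(real ^ 'n) set"
    and L :: "real ^ 'n \<Rightarrow> real ^ 'n ^ 'n"
    and e :: "nat \<Rightarrow> 'n"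
  assumes "open U" and "connected U"
    and "real_analytic_on L U"
    and "nijenhuis_on U L"
    and "gl_regular_on U L"
    and "bij_betw e {1..CARD('n)} UNIV"
  shows "property_B U (op_I L) \<and> property_A e U (op_I L)
       \<and> property_B U (op_II L) \<and> property_A e U (op_II L)"
proof -
  have L: "analytic_at (\<lambda>u. L u $ i $ j) u" if "u \<in> U" for u i j
    using real_analytic_on_imp_analytic_at[OF assms(3) that
        bounded_linear_compose[OF bounded_linear_vec_nth[of j] bounded_linear_vec_nth[of i]]] .
  have I: "property_B U (op_I L) \<and> property_A e U (op_I L)"
    by (rule family_properties[where L = L and Q = "op_I L" and g = "\<lambda>_ _. 0" and \<theta> = "\<lambda>_ _. 0",
          OF assms(1,6) L assms(4) op_I_0 op_I_Suc])
       (simp_all add: analytic_at_const linear_zero)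
  have II: "property_B U (op_II L) \<and> property_A e U (op_II L)"
  proof (rule family_properties[where L = L and Q = "op_II L" and g = "\<lambda>k u. char_coeff (L u) k"
        and \<theta> = "\<lambda>u. frechet_derivative (\<lambda>u. char_coeff (L u) 1) (at u)",
        OF assms(1,6) L assms(4) op_II_0 op_II_Suc])
    have cc: "analytic_at (\<lambda>u. char_coeff (L u) k) u" if "u \<in> U" for k u
      using analytic_at_diff[OF analytic_at_const[of 0] analytic_at_coeff_char_poly[OF L[OF that]]]
      by (simp add: char_coeff_def)
    then show "analytic_at (\<lambda>u. char_coeff (L u) k) u" if "u \<in> U" for k u using that .
    show lin: "linear (frechet_derivative (\<lambda>u. char_coeff (L u) 1) (at u))" if "u \<in> U" for u
      by (intro linear_frechet_derivative analytic_at_differentiable cc that)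
    fix k u v assume u: "u \<in> U" and k: "Suc k \<le> CARD('n) - 1"
    have Ld: "L differentiable (at u)"
      by (intro differentiable_matrix analytic_at_differentiable L u)
    show "frechet_derivative (\<lambda>u. char_coeff (L u) (Suc k)) (at u) v
        = frechet_derivative (\<lambda>u. char_coeff (L u) 1) (at u) (op_II L k u *v v)"
      using k
    proof (induction k arbitrary: v)
      case (Suc k)
      \<comment> \<open>By \<open>char_coeff_derivative\<close>, df_{k+2} (v) = df_{k+1} (L v) -
        f_{k+1} df_1 (v). With df_{k+1} = df_1 \<circ> M_k this becomes df_1 (M_k L v - f_{k+1} v),
        which requires L on the right of M_k.\<close>
      have "op_II L (Suc k) u *v v = op_II L k u *v (L u *v v) - char_coeff (L u) (Suc k) *\<^sub>R v"
      proof -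
        have "L u ** op_II L k u = op_II L k u ** L u" for k
        proof (induction k)
          case (Suc k)
          then show ?case
            by (simp add: op_II_Suc matrix_diff_ldistrib matrix_diff_rdistrib matrix_mul_assoc
                matrix_scalar_ac scalar_matrix_assoc[symmetric])
        qed (simp add: op_II_0)
        then show ?thesis
          by (simp add: op_II_Suc matrix_vector_mult_diff_rdistrib matrix_vector_mul_assoc scaleR_matrix_vector_assoc[symmetric])
      qed
      then show ?case
        using char_coeff_derivative[OF L[OF u] nijenhuis_pointwise[OF assms(4) u Ld], of "Suc k" v] Suc
        by (simp add: linear_diff[OF lin[OF u], unfolded One_nat_def] linear_scale[OF lin[OF u], unfolded One_nat_def])
    qed (simp add: op_II_0)
  qed
  from I II show ?thesis by blast
qed

end
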